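(* Let $\mu\in\mathbb R$, $\sigma\ge0$, and let $\varphi\in\mathcal D$ have Stieltjes measure $\mathrm d\varphi(u)=w(u)\,\mathrm du+\sum_{j=1}^Jm_j\,\delta_{t_j}(\mathrm du)$ with $J$ finite, $w\in L^\infty(0,1)$, $m_j>0$ and $t_j\in(0,1]$ distinct. Let $U:\mathbb R\to\mathbb R$ be increasing and locally Lipschitz, and suppose there exist $a,b\ge0$ with $\sup_{\zeta\in\partial U(x)}|\zeta|\le a+b|x|$ for all $x\in\mathbb R$. Let $q^*\in\mathsf K\cap\mathsf M$ satisfy LICQ, i.e. the gradients of the two moment constraints at $q^*$ are linearly independent (equivalently, $\sigma^2>0$). If $q^*$ is a local minimizer of $\Psi$ over $\mathsf K\cap\mathsf M$ with respect to the $\mathcal H$-topology, then there exist multipliers $(\lambda_1,\lambda_2)\in\mathbb R^2$, a measurable selector $\xi(u)\in\partial U(q^*(u))$ for $\mathrm du$-a.e. $u$, pointwise selectors $\xi_j\in\partial U(q^*(t_j))$ ($j=1,\dots,J$), and $z^*\in N_{\mathsf K}(q^* )$ such that $$0=\rho_\varphi\,\widehat\xi+(\lambda_1+2\lambda_2q^* )\rho_0+z^*\quad\text{in }\mathcal H,$$ where $\widehat\xi=\xi$ $\mathrm du$-a.e. and $\widehat\xi(t_j)=\xi_j$. Equivalently, for every $V\in\mathsf K$, $$\int_0^1\bigl(w(u)\xi(u)+\lambda_1+2\lambda_2q^*(u)\bigr)\bigl(V(u)-q^*(u)\bigr)\,\mathrm du+\sum_{j=1}^Jm_j\xi_j\bigl(V(t_j)-q^*(t_j)\bigr)\ge0.$$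 Moreover, $z^*$ satisfies $\mathcal J_\nu z^*(t)\ge0$ for $t\in[0,1]$, $\mathcal J_\nu z^*(1)=0$, and $\int_0^1\mathcal J_\nu z^*(t)\,\mathrm dq^*(t)=0$, where the last integral is the Stieltjes integral.
   Context: $\mathcal D$ is the set of nondecreasing right-continuous $\varphi:[0,1]\to[0,1]$ with $\varphi(0)=0$, $\varphi(1)=1$. "Increasing" means nondecreasing. Dominating measure on $[0,1]$: $\mathrm d\nu:=\mathrm du+\sum_{j=1}^J\delta_{t_j}(\mathrm du)$; Hilbert space $\mathcal H:=L^2(\mathrm d\nu)$ (so the values $q(t_j)$ are well defined for $q\in\mathcal H$). Densities: $\rho_\varphi:=\mathrm d\varphi/\mathrm d\nu$, so $\rho_\varphi=w$ $\mathrm du$-a.e. and $\rho_\varphi(t_j)=m_j$; $\rho_0:=\mathrm du/\mathrm d\nu$, so $\rho_0=1$ $\mathrm du$-a.e. and $\rho_0(t_j)=0$. Functional: $\Psi(q):=\int_0^1w(u)U(q(u))\,\mathrm du+\sum_{j=1}^Jm_jU(q(t_j))$ for $q\in\mathcal H$. Monotone cone: $\mathsf K\subset\mathcal H$ is the set of $q\in\mathcal H$ having a ($\nu$-a.e. equal) nondecreasing representative; $\mathrm dq$ is the Stieltjes measure of it. Moment set: $\mathsf M:=\{q\in\mathcal H:\int_0^1q\,\mathrm du=\mu,\ \int_0^1q^2\,\mathrm du=\mu^2+\sigma^2\}$ (Lebesgue moments). Normal cone in $\mathcal H$: $N_{\mathsf K}(q):=\{z\in\mathcal H:\int z(h-q)\,\mathrm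 d\nu\le0\ \forall h\in\mathsf K\}$. For $z\in\mathcal H$, $\mathcal J_\nu z(t):=\int_{[0,t]}z(s)\,\mathrm d\nu(s)$. Clarke subdifferential: for a locally Lipschitz $U:\mathbb R\to\mathbb R$, $U^\circ(x;h):=\limsup_{y\to x,\,t\to0^+}\frac{U(y+th)-U(y)}{t}$ and $\partial U(x):=\{v\in\mathbb R: vh\le U^\circ(x;h)\ \forall h\in\mathbb R\}$. *)

theory Defs
  imports "HOL-Analysis.Analysis"
begin

definition nu :: "real set \<Rightarrow> real measure" where
  "nu T = measure_of UNIV (sets borel)
     (\<lambda>A. emeasure lborel (A \<inter> {0..1}) + (\<Sum>t\<in>T. indicator A t))"

lemma sets_nu [simp, measurable_cong]: "sets (nu T) = sets borel"
  and space_nu [simp]: "space (nu T) = UNIV"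
  using sets.sigma_sets_eq[of "borel :: real measure"] by (simp_all add: nu_def)

lemma emeasure_nu:
  assumes "A \<in> sets borel"
  shows "emeasure (nu T) A = emeasure lborel (A \<inter> {0..1}) + (\<Sum>t\<in>T. indicator A t)"
proof (rule emeasure_measure_of[OF nu_def])
  let ?\<mu> = "\<lambda>A. emeasure lborel (A \<inter> {0..1}) + (\<Sum>t\<in>T. indicator A t :: ennreal)"
  show "positive (sets (nu T)) ?\<mu>"
    by (simp add: positive_def)
  show "countably_additive (sets (nu T)) ?\<mu>"
  proof (rule countably_additiveI)
    fix A :: "nat \<Rightarrow> real set"
    assume A: "range A \<subseteq> sets (nu T)" "disjoint_family A"
    have "(\<Sum>i. emeasure lborel (A i \<inter> {0..1})) = emeasure lborel (\<Union>i. A i \<inter> {0..1})"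
      using A by (intro suminf_emeasure) (auto simp: disjoint_family_on_def)
    moreover have "(\<Sum>i. \<Sum>t\<in>T. indicator (A i) t :: ennreal) = (\<Sum>t\<in>T. \<Sum>i. indicator (A i) t)"
      by (rule suminf_sum) auto
    moreover have "(\<Sum>i. indicator (A i) t :: ennreal) = indicator (\<Union>i. A i) t" for t
      using A(2) by (rule suminf_indicator)
    ultimately show "(\<Sum>i. ?\<mu> (A i)) = ?\<mu> (\<Union>i. A i)"
      by (simp add: suminf_add[symmetric])
  qed
qed (use assms in auto)

text \<open>Elements of \<open>L2 M\<close> are functions; equality in the Hilbert space is equality \<open>M\<close>-a.e.\<close>

definition L2 :: "real measure \<Rightarrow> (real \<Rightarrow> real) set" where
  "L2 M = {q. q \<in> borel_measurable M \<and> integrable M (\<lambda>u. (q u)\<^sup>2)}"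

definition L2_inner :: "real measure \<Rightarrow> (real \<Rightarrow> real) \<Rightarrow> (real \<Rightarrow> real) \<Rightarrow> real" where
  "L2_inner M f g = (LINT u|M. f u * g u)"

definition L2_norm :: "real measure \<Rightarrow> (real \<Rightarrow> real) \<Rightarrow> real" where
  "L2_norm M f = sqrt (L2_inner M f f)"

definition has_L2_gradient ::
    "real measure \<Rightarrow> ((real \<Rightarrow> real) \<Rightarrow> real) \<Rightarrow> (real \<Rightarrow> real) \<Rightarrow> (real \<Rightarrow> real) \<Rightarrow> bool" where
  "has_L2_gradient M G q g \<longleftrightarrow> g \<in> L2 M \<and>
     (\<forall>\<epsilon>>0. \<exists>\<delta>>0. \<forall>h\<in>L2 M. L2_norm M h < \<delta> \<longrightarrow>
        \<bar>G (\<lambda>u. q u + h u) - G q - L2_inner M g h\<bar> \<le> \<epsilon> * L2_norm M h)"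

text \<open>The measure on \<open>[a, b]\<close> generated by a nondecreasing \<open>f\<close>: \<open>interval_measure\<close> needs a
  right-continuous function on the whole line, so we take right limits on \<open>[a, b)\<close> and extend by the
  constants \<open>f a\<close> and \<open>f b\<close>. A jump of \<open>f\<close> at an interior point \<open>t\<close> gives an atom of mass
  \<open>f(t+) - f(t-)\<close>, whatever the value \<open>f t\<close>; the atom at \<open>a\<close> is \<open>f(a+) - f a\<close> and that at \<open>b\<close> is
  \<open>f b - f(b-)\<close>.\<close>

definition stieltjes_Icc :: "real \<Rightarrow> real \<Rightarrow> (real \<Rightarrow> real) \<Rightarrow> real measure" where
  "stieltjes_Icc a b f =
     interval_measure (\<lambda>x. if x < a then f a else if x < b then Inf (f ` {x<..b}) else f b)"

text \<open>For an interval \<open>D\<close> on which \<open>f\<close> is nondecreasing but possibly unbounded, the measures on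
  \<open>[a, b] \<subseteq> D\<close> increase to the Stieltjes measure of \<open>f\<close> on \<open>D\<close>.\<close>

definition stieltjes :: "real set \<Rightarrow> (real \<Rightarrow> real) \<Rightarrow> real measure" where
  "stieltjes D f = (SUP (a, b) \<in> {(a, b). a \<in> D \<and> b \<in> D \<and> a \<le> b}. stieltjes_Icc a b f)"

definition distortions :: "(real \<Rightarrow> real) set" where
  "distortions = {\<phi>. \<phi> ` {0..1} \<subseteq> {0..1} \<and> mono_on {0..1} \<phi> \<and>
     (\<forall>u\<in>{0..<1}. continuous (at_right u) \<phi>) \<and> \<phi> 0 = 0 \<and> \<phi> 1 = 1}"

definition rho_phi :: "real set \<Rightarrow> (real \<Rightarrow> real) \<Rightarrow> real \<Rightarrow> real" where
  "rho_phi T \<phi> u = enn2real (RN_deriv (nu T) (stieltjes_Icc 0 1 \<phi>) u)"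

definition rho_0 :: "real set \<Rightarrow> real \<Rightarrow> real" where
  "rho_0 T u = enn2real (RN_deriv (nu T) (density lborel (indicator {0..1})) u)"

definition Psi :: "nat \<Rightarrow> (nat \<Rightarrow> real) \<Rightarrow> (nat \<Rightarrow> real) \<Rightarrow> (real \<Rightarrow> real) \<Rightarrow> (real \<Rightarrow> real) \<Rightarrow>
    (real \<Rightarrow> real) \<Rightarrow> real" where
  "Psi J t m w U q = (LBINT u:{0..1}. w u * U (q u)) + (\<Sum>j=1..J. m j * U (q (t j)))"

text \<open>Members of the cone may be unbounded near 0 and near 1, so a real-valued representative cannot
  be required to be monotone on all of \<open>[0, 1]\<close>. The points left out, 0 and (unless it is in \<open>T\<close>) 1,
  are \<open>nu T\<close>-null.\<close>

definition rep_dom :: "real set \<Rightarrow> real set" where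
  "rep_dom T = {0<..<1} \<union> T"

definition mono_rep :: "real set \<Rightarrow> (real \<Rightarrow> real) \<Rightarrow> (real \<Rightarrow> real) \<Rightarrow> bool" where
  "mono_rep T q p \<longleftrightarrow> mono_on (rep_dom T) p \<and> (AE u in nu T. q u = p u)"

definition mono_cone :: "real set \<Rightarrow> (real \<Rightarrow> real) set" where
  "mono_cone T = {q \<in> L2 (nu T). \<exists>p. mono_rep T q p}"

definition moment1 :: "(real \<Rightarrow> real) \<Rightarrow> real" where
  "moment1 q = (LBINT u:{0..1}. q u)"

definition moment2 :: "(real \<Rightarrow> real) \<Rightarrow> real" where
  "moment2 q = (LBINT u:{0..1}. (q u)\<^sup>2)"

definition moment_set :: "real set \<Rightarrow> real \<Rightarrow> real \<Rightarrow> (real \<Rightarrow> real) set" where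
  "moment_set T \<mu> \<sigma> = {q \<in> L2 (nu T). moment1 q = \<mu> \<and> moment2 q = \<mu>\<^sup>2 + \<sigma>\<^sup>2}"

definition LICQ :: "real set \<Rightarrow> (real \<Rightarrow> real) \<Rightarrow> bool" where
  "LICQ T q \<longleftrightarrow> (\<exists>g1 g2. has_L2_gradient (nu T) moment1 q g1 \<and> has_L2_gradient (nu T) moment2 q g2 \<and>
     (\<forall>c1 c2. (AE u in nu T. c1 * g1 u + c2 * g2 u = 0) \<longrightarrow> c1 = 0 \<and> c2 = 0))"

definition L2_local_min ::
    "real measure \<Rightarrow> ((real \<Rightarrow> real) \<Rightarrow> real) \<Rightarrow> (real \<Rightarrow> real) set \<Rightarrow> (real \<Rightarrow> real) \<Rightarrow> bool" where
  "L2_local_min M F S q \<longleftrightarrow> q \<in> S \<and>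
     (\<exists>\<epsilon>>0. \<forall>h\<in>S. L2_norm M (\<lambda>u. h u - q u) < \<epsilon> \<longrightarrow> F q \<le> F h)"

definition normal_cone :: "real set \<Rightarrow> (real \<Rightarrow> real) \<Rightarrow> (real \<Rightarrow> real) set" where
  "normal_cone T q = {z \<in> L2 (nu T). \<forall>h\<in>mono_cone T. (LINT u|nu T. z u * (h u - q u)) \<le> 0}"

definition J_nu :: "real set \<Rightarrow> (real \<Rightarrow> real) \<Rightarrow> real \<Rightarrow> real" where
  "J_nu T z s = (LINT u:{0..s}|nu T. z u)"

text \<open>As usual for Clarke's derivative, \<open>y = x\<close> is admitted in the limit superior.\<close>

definition clarke_deriv :: "(real \<Rightarrow> real) \<Rightarrow> real \<Rightarrow> real \<Rightarrow> ereal" where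
  "clarke_deriv U x h = Limsup (nhds x \<times>\<^sub>F at_right 0) (\<lambda>(y, s). ereal ((U (y + s * h) - U y) / s))"

definition clarke_subdiff :: "(real \<Rightarrow> real) \<Rightarrow> real \<Rightarrow> real set" where
  "clarke_subdiff U x = {v. \<forall>h. ereal (v * h) \<le> clarke_deriv U x h}"

definition selectors :: "nat \<Rightarrow> (nat \<Rightarrow> real) \<Rightarrow> (real \<Rightarrow> real) \<Rightarrow> (real \<Rightarrow> real) \<Rightarrow>
    (real \<Rightarrow> real) \<Rightarrow> (nat \<Rightarrow> real) \<Rightarrow> bool" where
  "selectors J t U q \<xi> \<xi>s \<longleftrightarrow> \<xi> \<in> borel_measurable borel \<and>
     (AE u in lborel. u \<in> {0..1} \<longrightarrow> \<xi> u \<in> clarke_subdiff U (q u)) \<and>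
     (\<forall>j\<in>{1..J}. \<xi>s j \<in> clarke_subdiff U (q (t j)))"

definition xi_hat :: "nat \<Rightarrow> (nat \<Rightarrow> real) \<Rightarrow> (real \<Rightarrow> real) \<Rightarrow> (nat \<Rightarrow> real) \<Rightarrow> real \<Rightarrow> real" where
  "xi_hat J t \<xi> \<xi>s u = (if u \<in> t ` {1..J} then \<xi>s (inv_into {1..J} t u) else \<xi> u)"

end

theory Submission
  imports Defs
begin

text \<open>
Two directions are free at \<open>qs\<close>: adding a constant and rescaling both keep a function in the
monotone cone, and LICQ says that \<open>qs\<close> is not constant on \<open>[0, 1]\<close>, so these two moves alone can
repair both moments. Hence a direction \<open>d\<close> with \<open>qs + s d\<close> in the cone for some \<open>s > 0\<close> and with zero derivative
of both moments extends to a feasible curve: standardize \<open>qs + s d\<close> to mean \<open>\<mu>\<close> and variance \<open>\<sigma>\<^sup>2\<close>; the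
correction is of order \<open>s\<^sup>2\<close> (\<open>feasible_curve\<close>). Along this curve local minimality, the bound on difference
quotients that the linear growth of the subdifferential supplies, and dominated convergence give \<open>\<integral> \<rho> U\<^sup>\<circ>(qs; d) d\<nu> \<ge> 0\<close>, where \<open>U\<^sup>\<circ>\<close> is
Clarke's directional derivative (\<open>directional_nonneg\<close>).

On the line, \<open>U\<^sup>\<circ>(x; y) = c y + r \<bar>y\<bar>\<close>, where \<open>[c - r, c + r]\<close> is the Clarke subdifferential at \<open>x\<close>.
So a sublinear functional is nonnegative on a convex cone of directions, and a single linear functional
below it, of the form \<open>d \<mapsto> \<integral> \<rho> (c + \<theta> r) d\<close> with \<open>\<bar>\<theta>\<bar> \<le> 1\<close>, is to be nonnegative there as well. This
is a Hahn-Banach and Riesz statement, proved here by hand (\<open>sublinear_selector\<close>). Replace \<open>\<bar>y\<bar>\<close> by the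
smooth \<open>sqrt (y\<^sup>2 + \<kappa>\<^sup>2)\<close>, which lies above it, so that the functional stays bounded below on the cone. At a
near-minimizer \<open>d\<close> the first-order condition holds up to a small error, and the derivative there is already of
the required form, with \<open>\<theta> = d / sqrt (d\<^sup>2 + \<kappa>\<^sup>2)\<close>. The admissible \<open>\<theta>\<close> for smaller and smaller errors form
nested convex sets, and elements of nearly minimal norm converge almost everywhere by the parallelogram
law (\<open>nested_convex_AE_limit\<close>).

Given the selector, an arbitrary \<open>V - qs\<close> becomes an admissible direction after adding the right
combination of \<open>1\<close> and \<open>qs\<close>; the coefficients of that combination are linear in the two moment derivatives
of \<open>V - qs\<close>, and reading them off yields the multipliers (\<open>exists_multipliers\<close>). The variational inequality
and the inclusion in the normal cone are two readings of the pairing with one density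
(\<open>variational_form_pairing\<close>).

For the last claims, test the normal cone. Adding or subtracting constants gives \<open>\<integral> z = 0\<close>, adding
\<open>- indicator {..s}\<close> gives \<open>J \<ge> 0\<close>. For \<open>a \<le> b\<close> the clipping \<open>P\<close> of \<open>p\<close> to \<open>[p a, p b]\<close> may be
both added and subtracted, so \<open>\<integral> z P = 0\<close>. By Fubini \<open>\<integral> J\<close> against the Stieltjes measure on \<open>[a, b]\<close>
is the sum of \<open>z t (P t - P (t-))\<close> over the atoms. Here the monotonicity of \<open>U\<close> enters: an atom has
\<open>z t = - m \<xi> \<le> 0\<close>, so the integral of the nonnegative \<open>J\<close> is nonpositive and \<open>J\<close> vanishes almost
everywhere (\<open>J_nu_stieltjes_Icc_null\<close>). Without the sign at the atoms this can fail for a \<open>p\<close> that jumps up to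
its value at \<open>t\<close>.
\<close>

section \<open>The dominating measure\<close>

lemma null_sets_nu_iff:
  assumes "finite T"
  shows "N \<in> null_sets (nu T) \<longleftrightarrow> N \<in> sets borel \<and> N \<inter> {0..1} \<in> null_sets lborel \<and> N \<inter> T = {}"
proof -
  have "(\<Sum>t\<in>T. indicator N t :: ennreal) = 0 \<longleftrightarrow> N \<inter> T = {}"
    using assms by (auto simp: sum_eq_0_iff indicator_def)
  then show ?thesis
    by (auto simp: null_sets_def emeasure_nu)
qed

text \<open>Membership in \<open>L2 (nu T)\<close> identifies functions only up to null sets, but every point of \<open>T\<close> carries mass.
Statements almost everywhere therefore split into a Lebesgue part and a pointwise part.\<close>

lemma AE_nu:
  assumes "finite T"
  shows "(AE u in nu T. P u) \<longleftrightarrow> (AE u in lborel. u \<in> {0..1} \<longrightarrow> P u) \<and> (\<forall>t\<in>T. P t)"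
proof
  assume "AE u in nu T. P u"
  then obtain N where N: "{u \<in> space (nu T). \<not> P u} \<subseteq> N" "N \<in> null_sets (nu T)"
    by (auto simp: eventually_ae_filter)
  have "AE u in lborel. u \<notin> N \<inter> {0..1}"
    using N(2) by (intro AE_not_in) (simp add: null_sets_nu_iff[OF assms])
  moreover have "\<forall>t\<in>T. P t"
    using N by (auto simp: null_sets_nu_iff[OF assms])
  ultimately show "(AE u in lborel. u \<in> {0..1} \<longrightarrow> P u) \<and> (\<forall>t\<in>T. P t)"
    using N(1) by (auto elim!: eventually_mono)
next
  assume R: "(AE u in lborel. u \<in> {0..1} \<longrightarrow> P u) \<and> (\<forall>t\<in>T. P t)"
  then obtain N where N: "{u \<in> space lborel. \<not> (u \<in> {0..1} \<longrightarrow> P u)} \<subseteq> N" "N \<in> null_sets lborel"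
    by (auto simp: eventually_ae_filter)
  have fT: "T \<in> sets borel"
    using assms by (simp add: borel_closed finite_imp_closed)
  have "(N \<union> - {0..1}) - T \<in> null_sets (nu T)"
  proof -
    have "((N \<union> - {0..1}) - T) \<inter> {0..1} \<subseteq> N" by auto
    then have "((N \<union> - {0..1}) - T) \<inter> {0..1} \<in> null_sets lborel"
      by (rule null_sets_subset[OF N(2), rotated]) (use N(2) fT in \<open>auto simp: null_sets_def\<close>)
    then show ?thesis
      unfolding null_sets_nu_iff[OF assms] using null_setsD2[OF N(2)] fT by auto
  qed
  then have "AE u in nu T. u \<notin> (N \<union> - {0..1}) - T"
    by (rule AE_not_in)
  then show "AE u in nu T. P u"
    by (rule eventually_mono) (use N(1) R in auto)
qed

lemma nn_integral_nu:
  assumes "finite T" "f \<in> borel_measurable borel"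
  shows "(\<integral>\<^sup>+u. f u \<partial>nu T) = (\<integral>\<^sup>+u. f u * indicator {0..1} u \<partial>lborel) + (\<Sum>t\<in>T. f t)"
  using assms(2)
proof (induction f rule: borel_measurable_induct)
  case (cong f g)
  then show ?case by (metis UNIV_I ext space_borel)
next
  case (set A)
  have "(\<integral>\<^sup>+u. indicator A u * indicator {0..1} u \<partial>lborel) = emeasure lborel (A \<inter> {0..1})"
    using set by (simp flip: indicator_inter_arith)
  then show ?case
    using set by (simp add: emeasure_nu)
next
  case (mult u c)
  then show ?case
    by (simp add: nn_integral_cmult mult.assoc distrib_left sum_distrib_left)
next
  case (add u v)
  then show ?case
    by (simp add: nn_integral_add distrib_right sum.distrib algebra_simps)
next
  case (seq U)
  have i: "incseq (\<lambda>i u. U i u * indicator {0..1} u)"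
    using \<open>incseq U\<close> by (auto simp: incseq_def le_fun_def intro!: mult_right_mono)
  have "(\<integral>\<^sup>+u. (SUP i. U i) u \<partial>nu T) = (SUP i. \<integral>\<^sup>+u. U i u \<partial>nu T)"
    unfolding SUP_apply by (rule nn_integral_monotone_convergence_SUP) (use seq in auto)
  also have "\<dots> = (SUP i. (\<integral>\<^sup>+u. U i u * indicator {0..1} u \<partial>lborel) + (\<Sum>t\<in>T. U i t))"
    using seq by simp
  also have "\<dots> = (SUP i. \<integral>\<^sup>+u. U i u * indicator {0..1} u \<partial>lborel) + (SUP i. \<Sum>t\<in>T. U i t)"
    by (intro ennreal_SUP_add)
      (use i \<open>incseq U\<close> in \<open>auto simp: incseq_def le_fun_def intro!: nn_integral_mono sum_mono\<close>)
  also have "(SUP i. \<integral>\<^sup>+u. U i u * indicator {0..1} u \<partial>lborel)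
      = (\<integral>\<^sup>+u. (SUP i. U i u * indicator {0..1} u) \<partial>lborel)"
    by (rule nn_integral_monotone_convergence_SUP[symmetric]) (use i seq in auto)
  also have "\<dots> = (\<integral>\<^sup>+u. (SUP i. U i) u * indicator {0..1} u \<partial>lborel)"
    by (intro nn_integral_cong) (auto simp: indicator_def image_comp)
  also have "(SUP i. \<Sum>t\<in>T. U i t) = (\<Sum>t\<in>T. (SUP i. U i) t)"
    unfolding SUP_apply
    by (rule ennreal_SUP_sum) (use \<open>incseq U\<close> in \<open>auto simp: incseq_def le_fun_def\<close>)
  finally show ?case .
qed

lemma finite_measure_nu:
  assumes "finite T" shows "finite_measure (nu T)"
proof
  have "emeasure (nu T) (space (nu T)) = emeasure lborel {0..1::real} + (\<Sum>t\<in>T. 1)"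
    by (simp add: emeasure_nu)
  then show "emeasure (nu T) (space (nu T)) \<noteq> \<infinity>"
    using assms by (simp add: ennreal_of_nat_eq_real_of_nat)
qed

lemma integrable_nu_iff:
  fixes f :: "real \<Rightarrow> real"
  assumes "finite T" and [measurable]: "f \<in> borel_measurable borel"
  shows "integrable (nu T) f \<longleftrightarrow> integrable lborel (\<lambda>u. indicator {0..1} u * f u)"
proof -
  have "(\<integral>\<^sup>+u. ennreal \<bar>f u\<bar> \<partial>nu T) = (\<integral>\<^sup>+u. ennreal \<bar>f u\<bar> * indicator {0..1} u \<partial>lborel) + (\<Sum>t\<in>T. ennreal \<bar>f t\<bar>)"
    by (rule nn_integral_nu[OF assms(1)]) simp
  moreover have "(\<integral>\<^sup>+u. ennreal \<bar>indicator {0..1} u * f u\<bar> \<partial>lborel) = (\<integral>\<^sup>+u. ennreal \<bar>f u\<bar> * indicator {0..1} u \<partial>lborel)"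
    by (rule nn_integral_cong) (auto simp: indicator_def)
  ultimately show ?thesis
    using assms(1) by (simp add: integrable_iff_bounded ennreal_add_eq_top less_top[symmetric])
qed

lemma integral_nu:
  fixes f :: "real \<Rightarrow> real"
  assumes "finite T" "integrable (nu T) f"
  shows "(LINT u|nu T. f u) = (LINT u:{0..1}|lborel. f u) + (\<Sum>t\<in>T. f t)"
proof -
  have [measurable]: "f \<in> borel_measurable borel"
    using assms(2) by (auto simp: measurable_cong_sets[OF sets_nu refl] dest!: borel_measurable_integrable)
  have il: "integrable lborel (\<lambda>u. indicator {0..1} u * f u)"
    using assms integrable_nu_iff by simp
  have part: "(\<integral>\<^sup>+u. ennreal (s * f u) \<partial>nu T) = (\<integral>\<^sup>+u. ennreal (s * (indicator {0..1} u * f u)) \<partial>lborel) + (\<Sum>t\<in>T. ennreal (s * f t))" for s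
  proof -
    have "(\<integral>\<^sup>+u. ennreal (s * f u) * indicator {0..1} u \<partial>lborel) = (\<integral>\<^sup>+u. ennreal (s * (indicator {0..1} u * f u)) \<partial>lborel)"
      by (rule nn_integral_cong) (auto simp: indicator_def)
    then show ?thesis by (subst nn_integral_nu[OF assms(1)]) auto
  qed
  have fin: "(\<integral>\<^sup>+u. ennreal (s * (indicator {0..1} u * f u)) \<partial>lborel) < \<infinity>" if "s = 1 \<or> s = -1" for s
    using integrableD(2,3)[OF il] that by (auto simp: less_top)
  have e: "enn2real (x + (\<Sum>t\<in>T. ennreal (g t))) = enn2real x + (\<Sum>t\<in>T. max 0 (g t))" if "x < \<infinity>" for x g
  proof -
    have "(\<Sum>t\<in>T. ennreal (g t)) = (\<Sum>t\<in>T. ennreal (max 0 (g t)))"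
      by (rule sum.cong) (auto simp: max_def ennreal_neg)
    also have "\<dots> = ennreal (\<Sum>t\<in>T. max 0 (g t))"
      by (rule sum_ennreal) simp
    finally show ?thesis
      using that by (simp add: enn2real_plus sum_nonneg)
  qed
  have "(LINT u|nu T. f u) = enn2real (\<integral>\<^sup>+u. ennreal (1 * f u) \<partial>nu T) - enn2real (\<integral>\<^sup>+u. ennreal (-1 * f u) \<partial>nu T)"
    using real_lebesgue_integral_def[OF assms(2)] by simp
  also have "\<dots> = enn2real (\<integral>\<^sup>+u. ennreal (1 * (indicator {0..1} u * f u)) \<partial>lborel) + (\<Sum>t\<in>T. max 0 (1 * f t))
      - (enn2real (\<integral>\<^sup>+u. ennreal (-1 * (indicator {0..1} u * f u)) \<partial>lborel) + (\<Sum>t\<in>T. max 0 (-1 * f t)))"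
    unfolding part using e[OF fin[of 1]] e[OF fin[of "-1"]] by simp
  also have "\<dots> = (LINT u|lborel. indicator {0..1} u * f u) + ((\<Sum>t\<in>T. max 0 (f t)) - (\<Sum>t\<in>T. max 0 (- f t)))"
    using real_lebesgue_integral_def[OF il] by simp
  also have "(\<Sum>t\<in>T. max 0 (f t)) - (\<Sum>t\<in>T. max 0 (- f t)) = (\<Sum>t\<in>T. f t)"
    unfolding sum_subtractf[symmetric] by (rule sum.cong) auto
  finally show ?thesis by (simp add: set_lebesgue_integral_def)
qed

section \<open>Square-integrable functions\<close>

lemma L2_measurable: "f \<in> L2 M \<Longrightarrow> f \<in> borel_measurable M"
  by (simp add: L2_def)

lemma integrable_L2_mult:
  assumes "f \<in> L2 M" "g \<in> L2 M"
  shows "integrable M (\<lambda>x. f x * g x)"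
proof (rule Bochner_Integration.integrable_bound)
  show "integrable M (\<lambda>x. (f x)\<^sup>2 + (g x)\<^sup>2)" "(\<lambda>x. f x * g x) \<in> borel_measurable M"
    using assms by (auto simp: L2_def)
  have "\<bar>y * z\<bar> \<le> y\<^sup>2 + z\<^sup>2" for y z :: real
  proof -
    have "2 * (\<bar>y\<bar> * \<bar>z\<bar>) \<le> y\<^sup>2 + z\<^sup>2"
      using sum_squares_bound[of "\<bar>y\<bar>" "\<bar>z\<bar>"] by (simp add: mult.assoc)
    moreover have "0 \<le> \<bar>y\<bar> * \<bar>z\<bar>" by simp
    ultimately show ?thesis unfolding abs_mult by linarith
  qed
  then show "AE x in M. norm (f x * g x) \<le> norm ((f x)\<^sup>2 + (g x)\<^sup>2)"
    by (simp add: abs_of_nonneg)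
qed

lemma L2_add:
  assumes "f \<in> L2 M" "g \<in> L2 M" shows "(\<lambda>x. f x + g x) \<in> L2 M"
  using assms integrable_L2_mult[OF assms]
  by (auto simp: L2_def power2_sum mult.assoc)

lemma L2_cmult: "f \<in> L2 M \<Longrightarrow> (\<lambda>x. s * f x) \<in> L2 M"
  by (auto simp: L2_def power_mult_distrib)

lemma L2_diff:
  assumes "f \<in> L2 M" "g \<in> L2 M" shows "(\<lambda>x. f x - g x) \<in> L2 M"
  using L2_add[OF assms(1) L2_cmult[OF assms(2), of "-1"]] by simp

lemma L2_abs: "f \<in> L2 M \<Longrightarrow> (\<lambda>x. \<bar>f x\<bar>) \<in> L2 M"
  by (auto simp: L2_def)

lemma L2_const: "finite_measure M \<Longrightarrow> (\<lambda>x. s) \<in> L2 M"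
  by (simp add: L2_def finite_measure.integrable_const)

lemma integrable_L2: "finite_measure M \<Longrightarrow> f \<in> L2 M \<Longrightarrow> integrable M f"
  using integrable_L2_mult[OF _ L2_const[of M 1]] by simp

lemma L2_bound:
  assumes "f \<in> L2 M" "g \<in> borel_measurable M" "AE x in M. \<bar>g x\<bar> \<le> \<bar>f x\<bar>"
  shows "g \<in> L2 M"
proof -
  have "integrable M (\<lambda>x. (g x)\<^sup>2)"
  proof (rule Bochner_Integration.integrable_bound)
    show "integrable M (\<lambda>x. (f x)\<^sup>2)" using assms by (simp add: L2_def)
    show "AE x in M. norm ((g x)\<^sup>2) \<le> norm ((f x)\<^sup>2)"
      using assms(3) by eventually_elim (simp add: power_mono abs_le_square_iff)
  qed (use assms in auto)
  then show ?thesis using assms by (simp add: L2_def)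
qed

lemma L2_bounded:
  assumes "finite_measure M" "g \<in> borel_measurable M" "AE x in M. \<bar>g x\<bar> \<le> B"
  shows "g \<in> L2 M"
  by (rule L2_bound[OF L2_const[OF assms(1), of B] assms(2)]) (use assms(3) in \<open>auto elim: eventually_mono\<close>)

lemma L2_norm_square: "(L2_norm M f)\<^sup>2 = (LINT u|M. (f u)\<^sup>2)"
proof -
  have "L2_inner M f f \<ge> 0" by (simp add: L2_inner_def)
  then show ?thesis by (simp add: L2_norm_def) (simp add: L2_inner_def power2_eq_square)
qed

section \<open>A linear minorant that is nonnegative on a cone\<close>

text \<open>This stands in for weak compactness of the unit ball. The least norm over \<open>C n\<close> increases with \<open>n\<close> and is
bounded, so midpoints of near-minimizers cannot have a much smaller norm; the parallelogram law then makes
the near-minimizers Cauchy in \<open>L\<^sup>2\<close>, and choosing them with geometric errors gives convergence almost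
everywhere, after which convex constraints pass to the limit by dominated convergence.\<close>

lemma (in finite_measure) nested_convex_AE_limit:
  fixes C :: "nat \<Rightarrow> ('a \<Rightarrow> real) set"
  assumes ne: "\<And>n. C n \<noteq> {}" and dec: "\<And>m n. m \<le> n \<Longrightarrow> C n \<subseteq> C m"
    and mid: "\<And>n f g. f \<in> C n \<Longrightarrow> g \<in> C n \<Longrightarrow> (\<lambda>x. (f x + g x) / 2) \<in> C n"
    and meas: "\<And>n f. f \<in> C n \<Longrightarrow> f \<in> borel_measurable M"
    and bound: "\<And>n f x. f \<in> C n \<Longrightarrow> \<bar>f x\<bar> \<le> 1"
  obtains f \<theta> where "\<And>k. f k \<in> C k" "\<theta> \<in> borel_measurable M" "\<And>x. \<bar>\<theta> x\<bar> \<le> 1"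
    "AE x in M. (\<lambda>k. f k x) \<longlonglongrightarrow> \<theta> x"
proof -
  define E where "E f = (LINT x|M. (f x)\<^sup>2)" for f :: "'a \<Rightarrow> real"
  define I where "I n = Inf (E ` C n)" for n
  have int2: "integrable M (\<lambda>x. f x * g x)" if "f \<in> C n" "g \<in> C n'" for f g n n'
  proof (rule integrable_const_bound)
    have "\<bar>f x * g x\<bar> \<le> 1 * 1" for x
      unfolding abs_mult using bound[OF that(1)] bound[OF that(2)] by (intro mult_mono) auto
    then show "AE x in M. norm (f x * g x) \<le> 1" by simp
    show "(\<lambda>x. f x * g x) \<in> borel_measurable M" using meas that by measurable
  qed
  have bdd: "bdd_below (E ` C n)" for n
    by (rule bdd_belowI[of _ 0]) (auto simp: E_def)
  have E_le: "E f \<le> measure M (space M)" if "f \<in> C n" for f n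
  proof -
    have "E f \<le> (LINT x|M. 1)"
      unfolding E_def
      by (rule integral_mono) (use int2[OF that that] bound[OF that] in \<open>auto simp: power2_eq_square[symmetric] abs_square_le_1\<close>)
    then show ?thesis by simp
  qed
  have I_le: "I n \<le> E f" if "f \<in> C n" for f n
    unfolding I_def using that bdd by (auto intro: cINF_lower)
  have I_mono: "incseq I"
    unfolding incseq_def I_def using dec ne bdd by (intro allI impI cINF_superset_mono) auto
  have "I n \<le> measure M (space M)" for n
    using ne[of n] I_le E_le by (meson equals0I order_trans)
  then obtain L where L: "I \<longlonglongrightarrow> L" "\<And>n. I n \<le> L"
    using incseq_convergent[OF I_mono] by blast
  define e :: "nat \<Rightarrow> real" where "e k = (1/4) ^ k" for k
  have e_pos: "e k > 0" and e_dec: "e (Suc k) \<le> e k" for k by (simp_all add: e_def)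
  have "\<exists>n f. k \<le> n \<and> f \<in> C n \<and> L - I n < e k \<and> E f < I n + e k" for k
  proof -
    have "eventually (\<lambda>n. L - e k < I n) sequentially"
      using L(1) e_pos[of k] by (intro order_tendstoD(1)) auto
    then obtain n where n: "k \<le> n" "L - e k < I n"
      by (metis eventually_sequentially nle_le)
    have "\<exists>f\<in>C n. E f < I n + e k"
      using cInf_lessD[of "E ` C n" "I n + e k"] ne e_pos[of k] by (auto simp: I_def)
    then show ?thesis using n by (auto simp: algebra_simps)
  qed
  then obtain N f where Nf: "\<And>k. k \<le> N k" "\<And>k. f k \<in> C (N k)" "\<And>k. L - I (N k) < e k"
      "\<And>k. E (f k) < I (N k) + e k"
    by metis
  have [measurable]: "f k \<in> borel_measurable M" for k using meas Nf by blast
  have close: "(LINT x|M. (f (Suc k) x - f k x)\<^sup>2) \<le> 8 * e k" for k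
  proof -
    define n where "n = min (N k) (N (Suc k))"
    have f: "f k \<in> C n" "f (Suc k) \<in> C n"
      using Nf(2)[of k] Nf(2)[of "Suc k"] dec[of n "N k"] dec[of n "N (Suc k)"] by (auto simp: n_def)
    have n: "L - I n < e k"
      using Nf(3)[of k] Nf(3)[of "Suc k"] e_dec[of k] by (auto simp: n_def min_def)
    \<comment> \<open>the parallelogram law, pointwise\<close>
    have sq: "(f (Suc k) x - f k x)\<^sup>2 =
        2 * (f k x)\<^sup>2 + 2 * (f (Suc k) x)\<^sup>2 - 4 * ((f k x + f (Suc k) x) / 2)\<^sup>2" for x
      by (simp add: power2_eq_square field_simps)
    have "(LINT x|M. (f (Suc k) x - f k x)\<^sup>2) =
        2 * E (f k) + 2 * E (f (Suc k)) - 4 * E (\<lambda>x. (f k x + f (Suc k) x) / 2)"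
    proof -
      have "integrable M (\<lambda>x. (f k x)\<^sup>2)" "integrable M (\<lambda>x. (f (Suc k) x)\<^sup>2)"
          "integrable M (\<lambda>x. ((f k x + f (Suc k) x) / 2)\<^sup>2)"
        using int2[OF f(1) f(1)] int2[OF f(2) f(2)] int2[OF mid[OF f] mid[OF f]]
        by (simp_all only: power2_eq_square)
      then show ?thesis
        unfolding sq E_def by (simp del: power_divide)
    qed
    then show ?thesis
      using I_le[OF mid[OF f]] Nf(4)[of k] Nf(4)[of "Suc k"] n e_dec[of k] L(2)[of "N k"] L(2)[of "N (Suc k)"]
      by linarith
  qed
  define K where "K = 4 + measure M (space M) / 2"
  have L1: "(\<integral>\<^sup>+x. ennreal \<bar>f (Suc k) x - f k x\<bar> \<partial>M) \<le> ennreal (K * (1/2)^k)" for k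
  proof -
    let ?g = "\<lambda>x. f (Suc k) x - f k x"
    have g2: "(?g x)\<^sup>2 = f (Suc k) x * f (Suc k) x + f k x * f k x - 2 * (f k x * f (Suc k) x)" for x
      by (simp add: power2_eq_square algebra_simps)
    have i: "integrable M (\<lambda>x. (?g x)\<^sup>2)"
      unfolding g2 using int2[OF Nf(2) Nf(2)]
      by (intro Bochner_Integration.integrable_diff Bochner_Integration.integrable_add integrable_mult_right)
    \<comment> \<open>Young's inequality with weight \<open>2^k\<close>: it trades the squared error \<open>8 / 4^k\<close> for a summable first-order error\<close>
    have p: "\<bar>y\<bar> \<le> (2^k * y\<^sup>2 + (1/2)^k) / 2" for y :: real
    proof -
      have "0 \<le> (2^k * \<bar>y\<bar> - 1)\<^sup>2" by simp
      also have "\<dots> = 2^k * (2^k * y\<^sup>2 - 2 * \<bar>y\<bar> + (1/2)^k)"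
        by (simp add: power2_eq_square algebra_simps power_one_over)
      finally have "0 \<le> 2^k * y\<^sup>2 - 2 * \<bar>y\<bar> + (1/2)^k"
        using zero_less_power[of "2::real" k] by (subst (asm) zero_le_mult_iff) linarith
      then show ?thesis by simp
    qed
    have "(\<integral>\<^sup>+x. ennreal \<bar>?g x\<bar> \<partial>M) \<le> (\<integral>\<^sup>+x. ennreal ((2^k * (?g x)\<^sup>2 + (1/2)^k) / 2) \<partial>M)"
      by (intro nn_integral_mono ennreal_leI p)
    also have "\<dots> = ennreal (LINT x|M. (2^k * (?g x)\<^sup>2 + (1/2)^k) / 2)"
      using i by (intro nn_integral_eq_integral) auto
    also have "(LINT x|M. (2^k * (?g x)\<^sup>2 + (1/2)^k) / 2) = (2^k * (LINT x|M. (?g x)\<^sup>2) + (1/2)^k * measure M (space M)) / 2"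
      using i by simp
    also have "\<dots> \<le> (2^k * (8 * e k) + (1/2)^k * measure M (space M)) / 2"
      using close[of k] by (simp add: mult_left_mono)
    also have "\<dots> = K * (1/2)^k"
    proof -
      have "(2::real)^k * (1/4)^k = (1/2)^k" by (simp flip: power_mult_distrib)
      then show ?thesis by (simp add: K_def e_def algebra_simps)
    qed
    finally show ?thesis by (simp add: ennreal_leI)
  qed
  have "(\<integral>\<^sup>+x. (\<Sum>k. ennreal \<bar>f (Suc k) x - f k x\<bar>) \<partial>M) = (\<Sum>k. \<integral>\<^sup>+x. ennreal \<bar>f (Suc k) x - f k x\<bar> \<partial>M)"
    by (rule nn_integral_suminf) simp
  also have "\<dots> \<le> (\<Sum>k. ennreal (K * (1/2)^k))"
    by (intro suminf_le L1) auto
  also have "\<dots> < \<infinity>"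
    by (subst suminf_ennreal_eq[of _ "K * 2"])
      (use sums_mult[OF geometric_sums[of "1/2::real"], of K] in \<open>auto simp: K_def\<close>)
  finally have "AE x in M. (\<Sum>k. ennreal \<bar>f (Suc k) x - f k x\<bar>) \<noteq> \<infinity>"
    by (intro nn_integral_PInf_AE) auto
  then have conv: "AE x in M. convergent (\<lambda>k. f k x)"
  proof eventually_elim
    case (elim x)
    then have "summable (\<lambda>k. \<bar>f (Suc k) x - f k x\<bar>)"
      by (intro summable_suminf_not_top) (auto simp: infinity_ennreal_def)
    then have "summable (\<lambda>k. f (Suc k) x - f k x)"
      by (rule summable_rabs_cancel)
    then have "convergent (\<lambda>n. f n x - f 0 x)"
      by (simp add: summable_iff_convergent sum_lessThan_telescope[of "\<lambda>n. f n x"])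
    then show ?case using convergent_add_const_iff[of "- f 0 x" "\<lambda>n. f n x"] by (simp add: add.commute)
  qed
  define \<theta> where "\<theta> x = max (-1) (min 1 (lim (\<lambda>k. f k x)))" for x
  show thesis
  proof
    show "f k \<in> C k" for k using Nf(1,2) dec by blast
    show "\<theta> \<in> borel_measurable M" unfolding \<theta>_def by measurable
    show "\<bar>\<theta> x\<bar> \<le> 1" for x by (auto simp: \<theta>_def)
    show "AE x in M. (\<lambda>k. f k x) \<longlonglongrightarrow> \<theta> x"
      using conv
    proof eventually_elim
      case (elim x)
      then have l: "(\<lambda>k. f k x) \<longlonglongrightarrow> lim (\<lambda>k. f k x)" by (simp add: convergent_LIMSEQ_iff)
      have "-1 \<le> f k x" "f k x \<le> 1" for k using bound[OF Nf(2)[of k], of x] by auto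
      then have "-1 \<le> lim (\<lambda>k. f k x)" "lim (\<lambda>k. f k x) \<le> 1"
        using l by (auto intro: LIMSEQ_le_const LIMSEQ_le_const2)
      then show ?case using l by (simp add: \<theta>_def)
    qed
  qed
qed

text \<open>The square root lies below its tangent, which bounds the smoothed absolute value by its first-order
expansion plus a quadratic error with constant \<open>1 / \<kappa>\<close>.\<close>

lemma smoothed_abs_quadratic_bound:
  fixes y s h \<kappa> :: real
  assumes "\<kappa> > 0"
  shows "sqrt ((y + s * h)\<^sup>2 + \<kappa>\<^sup>2) \<le> sqrt (y\<^sup>2 + \<kappa>\<^sup>2) + s * (y / sqrt (y\<^sup>2 + \<kappa>\<^sup>2) * h) + s\<^sup>2 / 2 * (h\<^sup>2 / \<kappa>)"
proof -
  define A where "A = sqrt (y\<^sup>2 + \<kappa>\<^sup>2)"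
  define B where "B = sqrt ((y + s * h)\<^sup>2 + \<kappa>\<^sup>2)"
  have A: "A \<ge> \<kappa>" "A\<^sup>2 = y\<^sup>2 + \<kappa>\<^sup>2"
    unfolding A_def using assms by (auto intro!: real_le_rsqrt)
  have B: "B\<^sup>2 = (y + s * h)\<^sup>2 + \<kappa>\<^sup>2"
    unfolding B_def by simp
  have "0 \<le> (B - A)\<^sup>2" by simp
  then have "2 * A * B \<le> A\<^sup>2 + B\<^sup>2" by (simp add: power2_eq_square algebra_simps)
  also have "\<dots> = 2 * A\<^sup>2 + 2 * s * y * h + s\<^sup>2 * h\<^sup>2"
    unfolding A(2) B by (simp add: power2_eq_square algebra_simps)
  finally have "B \<le> (2 * A\<^sup>2 + 2 * s * y * h + s\<^sup>2 * h\<^sup>2) / (2 * A)"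
    using A(1) assms by (simp add: pos_le_divide_eq mult.commute)
  also have "\<dots> = A + s * (y / A * h) + s\<^sup>2 / 2 * (h\<^sup>2 / A)"
    using A(1) assms by (simp add: field_simps power2_eq_square)
  finally have "B \<le> A + s * (y / A * h) + s\<^sup>2 / 2 * (h\<^sup>2 / A)" .
  also have "s\<^sup>2 / 2 * (h\<^sup>2 / A) \<le> s\<^sup>2 / 2 * (h\<^sup>2 / \<kappa>)"
    using A(1) assms by (intro mult_left_mono divide_left_mono) auto
  finally show ?thesis by (simp add: A_def B_def)
qed

text \<open>Among \<open>d\<close> in the cone take a near-minimizer of \<open>\<integral> c d + r sqrt (d\<^sup>2 + \<kappa>\<^sup>2)\<close>; this functional dominates the
given one, so its infimum is finite, and moving from \<open>d\<close> to \<open>d + \<delta> h\<close> stays in the cone. Choosing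
\<open>\<kappa> = 1 + r\<close> keeps \<open>\<integral> r \<kappa>\<close> finite and bounds the second-order term \<open>\<integral> (r / \<kappa>) h\<^sup>2\<close> by \<open>\<integral> h\<^sup>2\<close>, although
\<open>r\<close> is only square-integrable. No minimizer is needed: an error \<open>\<delta>\<^sup>2\<close> in the value costs an error of order
\<open>\<delta>\<close> in the derivative.\<close>

lemma sublinear_approximate_selector:
  assumes fm: "finite_measure M" and c: "c \<in> L2 M" and r: "r \<in> L2 M" "\<And>x. 0 \<le> r x"
    and C: "C \<subseteq> L2 M" "C \<noteq> {}" "\<And>d h s. d \<in> C \<Longrightarrow> h \<in> C \<Longrightarrow> s > 0 \<Longrightarrow> (\<lambda>x. d x + s * h x) \<in> C"
    and nonneg: "\<And>d. d \<in> C \<Longrightarrow> 0 \<le> (LINT x|M. c x * d x + r x * \<bar>d x\<bar>)"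
    and \<delta>: "\<delta> > 0"
  obtains \<theta> where "\<theta> \<in> borel_measurable M" "\<And>x. \<bar>\<theta> x\<bar> \<le> 1"
    "\<And>h. h \<in> C \<Longrightarrow> - \<delta> * (1 + (LINT x|M. (h x)\<^sup>2) / 2) \<le> (LINT x|M. (c x + r x * \<theta> x) * h x)"
proof -
  interpret finite_measure M by (rule fm)
  note [measurable] = L2_measurable[OF c] L2_measurable[OF r(1)]
  define S where "S d x = sqrt ((d x)\<^sup>2 + (1 + r x)\<^sup>2)" for d x
  define F where "F d = (LINT x|M. c x * d x + r x * S d x)" for d
  have r1: "1 + r x > 0" for x using r(2)[of x] by linarith
  have S: "\<bar>d x\<bar> \<le> S d x" "0 < S d x" "S d x \<le> \<bar>d x\<bar> + (1 + r x)" for d x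
    unfolding S_def using r1[of x] sqrt_sum_squares_le_sum_abs[of "d x" "1 + r x"]
    by (auto simp: sum_power2_gt_zero_iff real_le_rsqrt)
  have [measurable]: "S d \<in> borel_measurable M" if "d \<in> C" for d
  proof -
    note [measurable] = L2_measurable[OF subsetD[OF C(1) that]]
    show ?thesis unfolding S_def by measurable
  qed
  have Si: "integrable M (\<lambda>x. r x * S d x)" if d: "d \<in> C" for d
  proof (rule Bochner_Integration.integrable_bound)
    show "integrable M (\<lambda>x. r x * \<bar>d x\<bar> + r x * (1 + r x))"
      using d C(1) by (intro Bochner_Integration.integrable_add integrable_L2_mult L2_add L2_abs L2_const fm r) auto
    show "AE x in M. norm (r x * S d x) \<le> norm (r x * \<bar>d x\<bar> + r x * (1 + r x))"
      unfolding distrib_left[symmetric] using S r(2) by (auto intro!: AE_I2 mult_left_mono simp: abs_mult)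
        (smt (verit) S mult_left_mono r(2))+
  qed (use d in measurable)
  have ci: "integrable M (\<lambda>x. c x * d x)" if "d \<in> C" for d
    using that C(1) c by (auto intro: integrable_L2_mult)
  have F0: "0 \<le> F d" if d: "d \<in> C" for d
  proof -
    have "(LINT x|M. c x * d x + r x * \<bar>d x\<bar>) \<le> F d"
      unfolding F_def using d C(1) S r
      by (intro integral_mono Bochner_Integration.integrable_add integrable_L2_mult L2_abs Si c)
        (auto intro!: mult_left_mono)
    with nonneg[OF d] show ?thesis by simp
  qed
  have bdd: "bdd_below (F ` C)" using F0 by (intro bdd_belowI[of _ 0]) auto
  have "\<exists>d\<in>C. F d < Inf (F ` C) + \<delta>\<^sup>2"
    using cInf_lessD[of "F ` C" "Inf (F ` C) + \<delta>\<^sup>2"] C(2) \<delta> by auto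
  then obtain d where d: "d \<in> C" "F d < Inf (F ` C) + \<delta>\<^sup>2" by blast
  note [measurable] = L2_measurable[OF subsetD[OF C(1) d(1)]]
  define \<theta> where "\<theta> x = d x / S d x" for x
  have \<theta>1: "\<bar>\<theta> x\<bar> \<le> 1" for x using S[of d x] by (simp add: \<theta>_def abs_div)
  have \<theta>m[measurable]: "\<theta> \<in> borel_measurable M" unfolding \<theta>_def using d(1) by measurable
  have rt: "(\<lambda>x. c x + r x * \<theta> x) \<in> L2 M"
  proof (intro L2_add c L2_bound[OF r(1)] AE_I2)
    show "\<bar>r x * \<theta> x\<bar> \<le> \<bar>r x\<bar>" for x
      using \<theta>1[of x] by (simp add: abs_mult mult_left_le)
  qed measurable
  show thesis
  proof (rule that[of \<theta>])
    fix h assume h: "h \<in> C"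
    let ?G = "LINT x|M. (c x + r x * \<theta> x) * h x" and ?H = "LINT x|M. (h x)\<^sup>2"
    have Hi: "integrable M (\<lambda>x. (h x)\<^sup>2)" using h C(1) by (auto simp: L2_def)
    have Gi: "integrable M (\<lambda>x. (c x + r x * \<theta> x) * h x)"
      using h C(1) by (intro integrable_L2_mult rt) auto
    have dh: "(\<lambda>x. d x + \<delta> * h x) \<in> C" using C(3)[OF d(1) h \<delta>] .
    have "F (\<lambda>x. d x + \<delta> * h x) \<le> (LINT x|M. (c x * d x + r x * S d x) + \<delta> * ((c x + r x * \<theta> x) * h x) + \<delta>\<^sup>2 / 2 * (h x)\<^sup>2)"
      unfolding F_def
    proof (rule integral_mono)
      fix x
      have "S (\<lambda>x. d x + \<delta> * h x) x \<le> S d x + \<delta> * (\<theta> x * h x) + \<delta>\<^sup>2 / 2 * ((h x)\<^sup>2 / (1 + r x))"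
        unfolding S_def \<theta>_def by (rule smoothed_abs_quadratic_bound[OF r1])
      then have "r x * S (\<lambda>x. d x + \<delta> * h x) x \<le> r x * (S d x + \<delta> * (\<theta> x * h x) + \<delta>\<^sup>2 / 2 * ((h x)\<^sup>2 / (1 + r x)))"
        using r(2) by (rule mult_left_mono)
      also have "\<dots> = r x * S d x + \<delta> * (r x * \<theta> x * h x) + \<delta>\<^sup>2 / 2 * (r x / (1 + r x) * (h x)\<^sup>2)"
        by (simp add: algebra_simps)
      also have "\<delta>\<^sup>2 / 2 * (r x / (1 + r x) * (h x)\<^sup>2) \<le> \<delta>\<^sup>2 / 2 * (1 * (h x)\<^sup>2)"
        using r(2)[of x] by (intro mult_left_mono mult_right_mono) auto
      finally show "c x * (d x + \<delta> * h x) + r x * S (\<lambda>x. d x + \<delta> * h x) x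
          \<le> (c x * d x + r x * S d x) + \<delta> * ((c x + r x * \<theta> x) * h x) + \<delta>\<^sup>2 / 2 * (h x)\<^sup>2"
        by (simp add: algebra_simps)
    qed (use Si[OF dh] ci[OF dh] Si[OF d(1)] ci[OF d(1)] Gi Hi in auto)
    also have "\<dots> = F d + \<delta> * ?G + \<delta>\<^sup>2 / 2 * ?H"
      unfolding F_def using Si[OF d(1)] ci[OF d(1)] Gi Hi by simp
    finally have "Inf (F ` C) \<le> F d + \<delta> * ?G + \<delta>\<^sup>2 / 2 * ?H"
      using cINF_lower[OF bdd dh] by linarith
    then have "0 \<le> \<delta> * (\<delta> * (1 + ?H / 2) + ?G)"
      using d(2) by (simp add: algebra_simps power2_eq_square)
    then show "- \<delta> * (1 + ?H / 2) \<le> ?G"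
      using \<delta> by (simp add: zero_le_mult_iff)
  qed (use \<theta>1 \<theta>m in auto)
qed

text \<open>The sandwich theorem for the sublinear functional \<open>\<integral> c d + r \<bar>d\<bar>\<close>, together with the representation of the
linear functional in between.\<close>

lemma sublinear_selector:
  assumes fm: "finite_measure M" and c: "c \<in> L2 M" and r: "r \<in> L2 M" "\<And>x. 0 \<le> r x"
    and C: "C \<subseteq> L2 M" "C \<noteq> {}" "\<And>d h s. d \<in> C \<Longrightarrow> h \<in> C \<Longrightarrow> s > 0 \<Longrightarrow> (\<lambda>x. d x + s * h x) \<in> C"
    and nonneg: "\<And>d. d \<in> C \<Longrightarrow> 0 \<le> (LINT x|M. c x * d x + r x * \<bar>d x\<bar>)"
  obtains \<theta> where "\<theta> \<in> borel_measurable M" "\<And>x. \<bar>\<theta> x\<bar> \<le> 1"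
    "\<And>h. h \<in> C \<Longrightarrow> 0 \<le> (LINT x|M. (c x + r x * \<theta> x) * h x)"
proof -
  interpret finite_measure M by (rule fm)
  note [measurable] = L2_measurable[OF c] L2_measurable[OF r(1)]
  define H where "H h = 1 + (LINT x|M. (h x)\<^sup>2) / 2" for h :: "real \<Rightarrow> real"
  have H0: "H h > 0" for h unfolding H_def by (rule add_pos_nonneg) auto
  define G where "G \<theta> h = (LINT x|M. (c x + r x * \<theta> x) * h x)" for \<theta> h
  define D where "D n = {\<theta> \<in> borel_measurable M. (\<forall>x. \<bar>\<theta> x\<bar> \<le> 1) \<and>
    (\<forall>h\<in>C. - inverse (real (Suc n)) * H h \<le> G \<theta> h)}" for n
  have bnd: "integrable M (\<lambda>x. (\<bar>c x\<bar> + r x) * \<bar>h x\<bar>)" if "h \<in> C" for h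
    using that C(1) by (intro integrable_L2_mult L2_add L2_abs c r) auto
  have le: "\<bar>(c x + r x * y) * z\<bar> \<le> (\<bar>c x\<bar> + r x) * \<bar>z\<bar>" if "\<bar>y\<bar> \<le> 1" for x y z
  proof -
    have "\<bar>c x + r x * y\<bar> \<le> \<bar>c x\<bar> + r x"
      using abs_triangle_ineq[of "c x" "r x * y"] mult_left_le[OF that r(2)[of x]] r(2)[of x] by (simp add: abs_mult)
    then show ?thesis unfolding abs_mult by (rule mult_right_mono) simp
  qed
  have int: "integrable M (\<lambda>x. (c x + r x * \<theta> x) * h x)"
    if "h \<in> C" "\<theta> \<in> borel_measurable M" "\<And>x. \<bar>\<theta> x\<bar> \<le> 1" for \<theta> h
  proof (rule Bochner_Integration.integrable_bound[OF bnd[OF that(1)]])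
    show "(\<lambda>x. (c x + r x * \<theta> x) * h x) \<in> borel_measurable M"
      using that(2) L2_measurable[OF subsetD[OF C(1) that(1)]] by measurable
    show "AE x in M. norm ((c x + r x * \<theta> x) * h x) \<le> norm ((\<bar>c x\<bar> + r x) * \<bar>h x\<bar>)"
      using le[OF that(3)] r(2) by (intro AE_I2) (auto intro: order_trans[OF _ abs_ge_self])
  qed
  obtain f \<theta> where f: "\<And>k. f k \<in> D k" and \<theta>: "\<theta> \<in> borel_measurable M" "\<And>x. \<bar>\<theta> x\<bar> \<le> 1"
    and lim: "AE x in M. (\<lambda>k. f k x) \<longlonglongrightarrow> \<theta> x"
  proof (rule nested_convex_AE_limit[of D])
    fix n
    have "inverse (real (Suc n)) > 0" by simp
    from fm c r C nonneg this show "D n \<noteq> {}"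
    proof (rule sublinear_approximate_selector)
      fix \<theta> assume "\<theta> \<in> borel_measurable M" "\<And>x. \<bar>\<theta> x\<bar> \<le> 1"
        "\<And>h. h \<in> C \<Longrightarrow> - inverse (real (Suc n)) * (1 + (LINT x|M. (h x)\<^sup>2) / 2)
          \<le> (LINT x|M. (c x + r x * \<theta> x) * h x)"
      then have "\<theta> \<in> D n" by (simp add: D_def H_def G_def)
      then show "D n \<noteq> {}" by blast
    qed
  next
    fix m n :: nat assume "m \<le> n"
    then have "- inverse (real (Suc m)) * H h \<le> - inverse (real (Suc n)) * H h" for h
      using H0[of h] by (intro mult_right_mono) (auto intro: le_imp_inverse_le)
    then show "D n \<subseteq> D m" unfolding D_def by (blast intro: order_trans)
  next
    fix n f g assume fg: "f \<in> D n" "g \<in> D n"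
    have "G (\<lambda>x. (f x + g x) / 2) h = (G f h + G g h) / 2" if "h \<in> C" for h
    proof -
      have i: "integrable M (\<lambda>x. (c x + r x * f x) * h x)" "integrable M (\<lambda>x. (c x + r x * g x) * h x)"
        using fg that by (auto simp: D_def intro!: int)
      have "G (\<lambda>x. (f x + g x) / 2) h = (LINT x|M. ((c x + r x * f x) * h x + (c x + r x * g x) * h x) / 2)"
        unfolding G_def by (rule Bochner_Integration.integral_cong) (auto simp: field_simps)
      also have "\<dots> = (G f h + G g h) / 2" unfolding G_def using i by simp
      finally show ?thesis .
    qed
    moreover have "\<bar>(f x + g x) / 2\<bar> \<le> 1" for x
    proof -
      have "\<bar>f x\<bar> \<le> 1" "\<bar>g x\<bar> \<le> 1" using fg by (auto simp: D_def)
      then show ?thesis by (auto simp: abs_if split: if_splits)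
    qed
    ultimately show "(\<lambda>x. (f x + g x) / 2) \<in> D n"
      using fg by (auto simp: D_def) (smt (verit) field_sum_of_halves)
  next
    show "f \<in> borel_measurable M" "\<bar>f x\<bar> \<le> 1" if "f \<in> D n" for n f x
      using that by (auto simp: D_def)
  qed blast
  show thesis
  proof (rule that[OF \<theta>])
    fix h assume h: "h \<in> C"
    note [measurable] = L2_measurable[OF subsetD[OF C(1) h]]
    have fk: "f k \<in> borel_measurable M" "\<bar>f k x\<bar> \<le> 1" "- inverse (real (Suc k)) * H h \<le> G (f k) h" for k x
      using f[of k] h by (auto simp: D_def)
    note [measurable] = fk(1) \<theta>(1)
    have "(\<lambda>k. G (f k) h) \<longlonglongrightarrow> (LINT x|M. (c x + r x * \<theta> x) * h x)"
      unfolding G_def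
    proof (rule integral_dominated_convergence[OF _ _ bnd[OF h]])
      show "AE x in M. (\<lambda>k. (c x + r x * f k x) * h x) \<longlonglongrightarrow> (c x + r x * \<theta> x) * h x"
        using lim by eventually_elim (intro tendsto_intros)
      show "AE x in M. norm ((c x + r x * f k x) * h x) \<le> (\<bar>c x\<bar> + r x) * \<bar>h x\<bar>" for k
        using le[OF fk(2)] by (intro AE_I2) auto
    qed measurable
    moreover have "(\<lambda>k. - inverse (real (Suc k)) * H h) \<longlonglongrightarrow> 0"
      using tendsto_mult_right[OF LIMSEQ_inverse_real_of_nat, of "- H h"] by (simp add: mult.commute)
    ultimately show "0 \<le> (LINT x|M. (c x + r x * \<theta> x) * h x)"
      using fk(3) by (intro LIMSEQ_le[of "\<lambda>k. - inverse (real (Suc k)) * H h" 0 "\<lambda>k. G (f k) h"]) auto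
  qed
qed

section \<open>Clarke subdifferentials on the real line\<close>

text \<open>For a locally Lipschitz \<open>U\<close> Clarke's derivative is finite, and all computations take place in the reals.
The subdifferential is then the interval from \<open>- clarke_dir U x (- 1)\<close> to \<open>clarke_dir U x 1\<close>.\<close>

definition clarke_dir :: "(real \<Rightarrow> real) \<Rightarrow> real \<Rightarrow> real \<Rightarrow> real" where
  "clarke_dir U x h = real_of_ereal (clarke_deriv U x h)"

lemma clarke_deriv_le_iff:
  "clarke_deriv U x h \<le> ereal C \<longleftrightarrow>
    (\<forall>C'>C. \<exists>\<delta>>0. \<forall>y s. \<bar>y - x\<bar> < \<delta> \<longrightarrow> 0 < s \<longrightarrow> s < \<delta> \<longrightarrow> U (y + s * h) - U y < C' * s)"
  (is "_ \<longleftrightarrow> (\<forall>C'>C. ?P C')")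
proof -
  let ?F = "nhds x \<times>\<^sub>F at_right (0::real)"
  let ?q = "\<lambda>(y, s). ereal ((U (y + s * h) - U y) / s)"
  have ev: "(\<forall>\<^sub>F z in ?F. ?q z < ereal C') \<longleftrightarrow> ?P C'" for C'
  proof
    assume "\<forall>\<^sub>F z in ?F. ?q z < ereal C'"
    then obtain Pf Pg where P: "eventually Pf (nhds x)" "eventually Pg (at_right (0::real))"
        "\<And>y s. Pf y \<Longrightarrow> Pg s \<Longrightarrow> (U (y + s * h) - U y) / s < C'"
      unfolding eventually_prod_filter by auto
    obtain d1 where d1: "d1 > 0" "\<And>y. \<bar>y - x\<bar> < d1 \<Longrightarrow> Pf y"
      using P(1) by (auto simp: eventually_nhds_metric dist_real_def)
    obtain d2 where d2: "d2 > 0" "\<And>s. 0 < s \<Longrightarrow> s < d2 \<Longrightarrow> Pg s"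
      using P(2) by (auto simp: eventually_at_right_field)
    show "?P C'"
      by (rule exI[of _ "min d1 d2"]) (use d1 d2 P(3) in \<open>auto simp flip: pos_divide_less_eq\<close>)
  next
    assume "?P C'"
    then obtain \<delta> where \<delta>: "\<delta> > 0" "\<And>y s. \<bar>y - x\<bar> < \<delta> \<Longrightarrow> 0 < s \<Longrightarrow> s < \<delta> \<Longrightarrow> U (y + s * h) - U y < C' * s"
      by blast
    show "\<forall>\<^sub>F z in ?F. ?q z < ereal C'"
      unfolding eventually_prod_filter
    proof (intro exI conjI allI impI)
      show "\<forall>\<^sub>F y in nhds x. \<bar>y - x\<bar> < \<delta>"
        using \<delta>(1) by (auto simp: eventually_nhds_metric dist_real_def)
      show "\<forall>\<^sub>F s in at_right 0. 0 < s \<and> s < \<delta>"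
        using \<delta>(1) by (auto simp: eventually_at_right_field)
      show "?q (y, s) < ereal C'" if "\<bar>y - x\<bar> < \<delta>" "0 < s \<and> s < \<delta>" for y s
        using \<delta>(2)[OF that(1)] that(2) by (auto simp: pos_divide_less_eq)
    qed
  qed
  have "clarke_deriv U x h \<le> ereal C \<longleftrightarrow> (\<forall>y>ereal C. \<forall>\<^sub>F z in ?F. ?q z < y)"
    unfolding clarke_deriv_def by (rule Limsup_le_iff)
  also have "\<dots> \<longleftrightarrow> (\<forall>C'>C. \<forall>\<^sub>F z in ?F. ?q z < ereal C')"
  proof (intro iffI allI impI)
    fix y assume *: "\<forall>C'>C. \<forall>\<^sub>F z in ?F. ?q z < ereal C'" and y: "ereal C < y"
    show "\<forall>\<^sub>F z in ?F. ?q z < y"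
      using y * by (cases y) (auto simp: case_prod_beta)
  qed auto
  finally show ?thesis unfolding ev .
qed

lemma local_lipschitzE_real:
  fixes U :: "real \<Rightarrow> real"
  assumes "local_lipschitz (UNIV :: real set) UNIV (\<lambda>_. U)"
  obtains u L where "u > 0" "L \<ge> 0" "\<And>y z. \<bar>y - x\<bar> \<le> u \<Longrightarrow> \<bar>z - x\<bar> \<le> u \<Longrightarrow> \<bar>U y - U z\<bar> \<le> L * \<bar>y - z\<bar>"
proof -
  obtain u L where u: "u > 0" and L: "L-lipschitz_on (cball x u) U"
  proof (rule local_lipschitzE[OF assms, of 0 x])
    fix u L assume "0 < u" "\<And>s. s \<in> cball (0::real) u \<inter> UNIV \<Longrightarrow> L-lipschitz_on (cball x u \<inter> UNIV) U"
    from this(1) this(2)[of 0] show thesis using that[of u L] by auto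
  qed auto
  show thesis
  proof (rule that[OF u lipschitz_on_nonneg[OF L]])
    show "\<bar>U y - U z\<bar> \<le> L * \<bar>y - z\<bar>" if "\<bar>y - x\<bar> \<le> u" "\<bar>z - x\<bar> \<le> u" for y z
      using lipschitz_onD[OF L, of y z] that by (simp add: dist_real_def abs_minus_commute)
  qed
qed

context
  fixes U :: "real \<Rightarrow> real"
  assumes ll: "local_lipschitz (UNIV :: real set) UNIV (\<lambda>_. U)"
begin

lemma clarke_deriv_real: "clarke_deriv U x h = ereal (clarke_dir U x h)"
proof -
  obtain u L where u: "u > 0" "L \<ge> 0"
    and L: "\<And>y z. \<bar>y - x\<bar> \<le> u \<Longrightarrow> \<bar>z - x\<bar> \<le> u \<Longrightarrow> \<bar>U y - U z\<bar> \<le> L * \<bar>y - z\<bar>"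
    using local_lipschitzE_real[OF ll] by blast
  define \<delta> where "\<delta> = u / (2 * (1 + \<bar>h\<bar>))"
  have \<delta>0: "\<delta> > 0" "\<delta> \<le> u" and \<delta>: "\<delta> * \<bar>h\<bar> \<le> u / 2"
    using u(1) by (auto simp: \<delta>_def divide_simps mult_le_cancel_left)
  have lip: "\<bar>U (y + s * h) - U y\<bar> \<le> L * \<bar>h\<bar> * s" if "\<bar>y - x\<bar> < \<delta>" "0 < s" "s < \<delta>" for y s
  proof -
    have sh: "\<bar>s * h\<bar> \<le> u / 2"
      unfolding abs_mult using \<delta> that mult_right_mono[of s \<delta> "\<bar>h\<bar>"] by simp
    have "\<delta> \<le> u / 2" using u(1) by (auto simp: \<delta>_def divide_simps)
    then have "\<bar>U (y + s * h) - U y\<bar> \<le> L * \<bar>y + s * h - y\<bar>"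
      using that sh by (intro L) linarith+
    then show ?thesis using that by (simp add: abs_mult mult_ac)
  qed
  have "clarke_deriv U x h \<le> ereal (L * \<bar>h\<bar>)"
    unfolding clarke_deriv_le_iff
  proof (intro allI impI exI conjI)
    fix C' y s assume C': "L * \<bar>h\<bar> < C'" and s: "\<bar>y - x\<bar> < \<delta>" "0 < s" "s < \<delta>"
    have "L * \<bar>h\<bar> * s < C' * s" using C' s by simp
    then show "U (y + s * h) - U y < C' * s" using lip[OF s] by linarith
  qed (rule \<delta>0)
  moreover have "\<not> clarke_deriv U x h \<le> ereal (- L * \<bar>h\<bar> - 2)"
  proof
    assume "clarke_deriv U x h \<le> ereal (- L * \<bar>h\<bar> - 2)"
    then obtain \<delta>' where \<delta>': "\<delta>' > 0"
      "\<And>y s. \<bar>y - x\<bar> < \<delta>' \<Longrightarrow> 0 < s \<Longrightarrow> s < \<delta>' \<Longrightarrow> U (y + s * h) - U y < (- L * \<bar>h\<bar> - 1) * s"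
      unfolding clarke_deriv_le_iff by (drule_tac x="- L * \<bar>h\<bar> - 1" in spec) auto
    define s where "s = min \<delta> \<delta>' / 2"
    have "0 < s" "s < \<delta>" "s < \<delta>'" using \<delta>0 \<delta>'(1) by (auto simp: s_def)
    then show False using lip[of x s] \<delta>'(2)[of x s] \<delta>0 \<delta>'(1) by (simp add: algebra_simps)
  qed
  ultimately have "\<bar>clarke_deriv U x h\<bar> \<noteq> \<infinity>" by (cases "clarke_deriv U x h") auto
  then show ?thesis by (simp add: clarke_dir_def ereal_real')
qed

lemma clarke_dir_le_iff:
  "clarke_dir U x h \<le> C \<longleftrightarrow>
    (\<forall>C'>C. \<exists>\<delta>>0. \<forall>y s. \<bar>y - x\<bar> < \<delta> \<longrightarrow> 0 < s \<longrightarrow> s < \<delta> \<longrightarrow> U (y + s * h) - U y < C' * s)"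
  using clarke_deriv_le_iff[of U x h C] by (simp add: clarke_deriv_real)

lemma clarke_dir_lessD:
  assumes "clarke_dir U x h < C"
  obtains \<delta> where "\<delta> > 0" "\<And>y s. \<bar>y - x\<bar> < \<delta> \<Longrightarrow> 0 < s \<Longrightarrow> s < \<delta> \<Longrightarrow> U (y + s * h) - U y < C * s"
  using assms clarke_dir_le_iff[of x h "clarke_dir U x h"] by blast

lemma clarke_dir_zero: "0 \<le> clarke_dir U x 0"
proof (rule ccontr)
  assume "\<not> 0 \<le> clarke_dir U x 0"
  then obtain \<delta> where "\<delta> > 0" "\<And>y s. \<bar>y - x\<bar> < \<delta> \<Longrightarrow> 0 < s \<Longrightarrow> s < \<delta> \<Longrightarrow> U (y + s * 0) - U y < 0 * s"
    using clarke_dir_lessD[of x 0 0] by auto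
  from this(2)[of x "\<delta>/2"] this(1) show False by simp
qed

lemma clarke_dir_scale:
  assumes k: "k > 0"
  shows "clarke_dir U x (k * h) \<le> k * clarke_dir U x h"
  unfolding clarke_dir_le_iff
proof (intro allI impI)
  fix C' assume "k * clarke_dir U x h < C'"
  then have "clarke_dir U x h < C' / k" using k by (simp add: field_simps)
  then obtain \<delta> where \<delta>: "\<delta> > 0" "\<And>y s. \<bar>y - x\<bar> < \<delta> \<Longrightarrow> 0 < s \<Longrightarrow> s < \<delta> \<Longrightarrow> U (y + s * h) - U y < C' / k * s"
    using clarke_dir_lessD by blast
  show "\<exists>\<delta>>0. \<forall>y s. \<bar>y - x\<bar> < \<delta> \<longrightarrow> 0 < s \<longrightarrow> s < \<delta> \<longrightarrow> U (y + s * (k * h)) - U y < C' * s"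
  proof (intro exI[of _ "min \<delta> (\<delta> / k)"] conjI allI impI)
    fix y s assume "\<bar>y - x\<bar> < min \<delta> (\<delta> / k)" "0 < s" "s < min \<delta> (\<delta> / k)"
    then show "U (y + s * (k * h)) - U y < C' * s"
      using \<delta>(2)[of y "s * k"] k by (simp add: pos_less_divide_eq mult.assoc)
  qed (use \<delta> k in auto)
qed

text \<open>The difference quotient over \<open>[x, x + s]\<close> occurs in both upper limits with opposite signs, with base point
\<open>x\<close> in one and \<open>x + s\<close> in the other; hence the subdifferential is nonempty.\<close>

lemma clarke_dir_opposite: "0 \<le> clarke_dir U x 1 + clarke_dir U x (-1)"
proof (rule ccontr)
  assume neg: "\<not> 0 \<le> clarke_dir U x 1 + clarke_dir U x (-1)"
  define e where "e = - (clarke_dir U x 1 + clarke_dir U x (-1)) / 2"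
  have e: "e > 0" "(clarke_dir U x 1 + e) + (clarke_dir U x (-1) + e) = 0"
    using neg by (auto simp: e_def field_simps)
  obtain d1 where d1: "d1 > 0"
    "\<And>y s. \<bar>y - x\<bar> < d1 \<Longrightarrow> 0 < s \<Longrightarrow> s < d1 \<Longrightarrow> U (y + s * 1) - U y < (clarke_dir U x 1 + e) * s"
    using clarke_dir_lessD[of x 1 "clarke_dir U x 1 + e"] e(1) by auto
  obtain d2 where d2: "d2 > 0"
    "\<And>y s. \<bar>y - x\<bar> < d2 \<Longrightarrow> 0 < s \<Longrightarrow> s < d2 \<Longrightarrow> U (y + s * (-1)) - U y < (clarke_dir U x (-1) + e) * s"
    using clarke_dir_lessD[of x "-1" "clarke_dir U x (-1) + e"] e(1) by auto
  define s where "s = min d1 d2 / 2"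
  have s: "0 < s" "s < d1" "s < d2" using d1(1) d2(1) by (auto simp: s_def)
  have "0 < (clarke_dir U x 1 + e) * s + (clarke_dir U x (-1) + e) * s"
    using d1(2)[of x s] d2(2)[of "x + s" s] s d1(1) by simp
  also have "\<dots> = 0" using e(2) by (metis distrib_right mult_zero_left)
  finally show False by simp
qed

lemma clarke_subdiffI:
  assumes "- clarke_dir U x (-1) \<le> v" "v \<le> clarke_dir U x 1"
  shows "v \<in> clarke_subdiff U x"
  unfolding clarke_subdiff_def clarke_deriv_real
proof (intro CollectI allI)
  fix h :: real
  consider "h > 0" | "h = 0" | "h < 0" by linarith
  then have "v * h \<le> clarke_dir U x h"
  proof cases
    case 1
    have "v \<le> (1 / h) * clarke_dir U x h"
      using clarke_dir_scale[of "1/h" x h] assms(2) 1 by simp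
    then show ?thesis using 1 by (simp add: field_simps)
  next
    case 2 then show ?thesis using clarke_dir_zero by simp
  next
    case 3
    have "- v \<le> (1 / - h) * clarke_dir U x h"
      using clarke_dir_scale[of "1/(-h)" x h] assms(1) 3 by simp
    then show ?thesis using 3 by (simp add: field_simps)
  qed
  then show "ereal (v * h) \<le> ereal (clarke_dir U x h)" by simp
qed

lemma clarke_subdiffD:
  assumes "v \<in> clarke_subdiff U x"
  shows "- clarke_dir U x (-1) \<le> v" "v \<le> clarke_dir U x 1"
proof -
  have "ereal (v * h) \<le> ereal (clarke_dir U x h)" for h
    using assms unfolding clarke_subdiff_def clarke_deriv_real by blast
  from this[of 1] this[of "-1"] show "- clarke_dir U x (-1) \<le> v" "v \<le> clarke_dir U x 1" by auto
qed

text \<open>The upper limit over nearby base points is upper semicontinuous in the base point.\<close>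

lemma clarke_dir_measurable: "(\<lambda>x. clarke_dir U x h) \<in> borel_measurable borel"
proof (rule borel_measurableI_less)
  fix C
  have "open {x. clarke_dir U x h < C}"
    unfolding open_dist
  proof (intro ballI)
    fix x assume "x \<in> {x. clarke_dir U x h < C}"
    then obtain C' where C': "clarke_dir U x h < C'" "C' < C" using dense by auto
    obtain \<delta> where \<delta>: "\<delta> > 0" "\<And>y s. \<bar>y - x\<bar> < \<delta> \<Longrightarrow> 0 < s \<Longrightarrow> s < \<delta> \<Longrightarrow> U (y + s * h) - U y < C' * s"
      using clarke_dir_lessD[OF C'(1)] by blast
    show "\<exists>e>0. \<forall>x'. dist x' x < e \<longrightarrow> x' \<in> {x. clarke_dir U x h < C}"
    proof (intro exI[of _ "\<delta> / 2"] conjI allI impI)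
      fix x' assume x': "dist x' x < \<delta> / 2"
      have "clarke_dir U x' h \<le> C'"
        unfolding clarke_dir_le_iff
      proof (intro allI impI exI[of _ "\<delta> / 2"] conjI)
        fix C'' y s assume a: "C' < C''" "\<bar>y - x'\<bar> < \<delta> / 2" "0 < s" "s < \<delta> / 2"
        have "\<bar>y - x\<bar> < \<delta>" using a(2) x' unfolding dist_real_def by linarith
        then have "U (y + s * h) - U y < C' * s" using \<delta> a by simp
        also have "\<dots> < C'' * s" using a by simp
        finally show "U (y + s * h) - U y < C'' * s" .
      qed (use \<delta> in simp)
      then show "x' \<in> {x. clarke_dir U x h < C}" using C' by simp
    qed (use \<delta> in simp)
  qed
  then show "{x \<in> space borel. clarke_dir U x h < C} \<in> sets borel" by simp
qed

lemma clarke_increment_bound: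
  assumes "clarke_dir U x 1 < C1" "clarke_dir U x (-1) < C2"
  shows "\<forall>\<^sub>F k in nhds 0. U (x + k) - U x \<le> max (C1 * k) (- C2 * k)"
proof -
  obtain d1 where d1: "d1 > 0" "\<And>y s. \<bar>y - x\<bar> < d1 \<Longrightarrow> 0 < s \<Longrightarrow> s < d1 \<Longrightarrow> U (y + s * 1) - U y < C1 * s"
    using clarke_dir_lessD[OF assms(1)] by auto
  obtain d2 where d2: "d2 > 0" "\<And>y s. \<bar>y - x\<bar> < d2 \<Longrightarrow> 0 < s \<Longrightarrow> s < d2 \<Longrightarrow> U (y + s * (-1)) - U y < C2 * s"
    using clarke_dir_lessD[OF assms(2)] by auto
  have "U (x + k) - U x \<le> max (C1 * k) (- C2 * k)" if "\<bar>k\<bar> < min d1 d2" for k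
  proof -
    consider "k > 0" | "k = 0" | "k < 0" by linarith
    then show ?thesis
      using d1(2)[of x k] d2(2)[of x "-k"] d1(1) d2(1) that by cases auto
  qed
  then show ?thesis
    unfolding eventually_nhds_metric using d1(1) d2(1) by (intro exI[of _ "min d1 d2"]) auto
qed

text \<open>Taking the maximum with the limit bound turns an upper limit into a genuine limit, to which dominated
convergence applies directly.\<close>

lemma clarke_difference_quotient_limsup:
  assumes s: "\<And>n. s n > 0" "s \<longlonglongrightarrow> 0" and d: "d \<longlonglongrightarrow> d0"
  shows "(\<lambda>n. max ((U (x + s n * d n) - U x) / s n) (max (clarke_dir U x 1 * d0) (- clarke_dir U x (-1) * d0)))
    \<longlonglongrightarrow> max (clarke_dir U x 1 * d0) (- clarke_dir U x (-1) * d0)"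
    (is "?X \<longlonglongrightarrow> ?Y")
proof (rule order_tendstoI)
  fix l assume "l < ?Y"
  then show "\<forall>\<^sub>F n in sequentially. l < ?X n" by (auto simp: less_max_iff_disj)
next
  fix l assume l: "?Y < l"
  have "((\<lambda>e. max ((clarke_dir U x 1 + e) * d0) (- (clarke_dir U x (-1) + e) * d0)) \<longlongrightarrow>
      max ((clarke_dir U x 1 + 0) * d0) (- (clarke_dir U x (-1) + 0) * d0)) (at_right 0)"
    by (intro tendsto_intros)
  from order_tendstoD(2)[OF this, of l] l
  have "\<forall>\<^sub>F e in at_right 0. max ((clarke_dir U x 1 + e) * d0) (- (clarke_dir U x (-1) + e) * d0) < l"
    by simp
  moreover have "\<forall>\<^sub>F e::real in at_right 0. e > 0" by (simp add: eventually_at_right_less)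
  ultimately have "\<forall>\<^sub>F e in at_right 0. e > 0 \<and>
      max ((clarke_dir U x 1 + e) * d0) (- (clarke_dir U x (-1) + e) * d0) < l"
    by eventually_elim auto
  then obtain e where e: "e > 0"
      "max ((clarke_dir U x 1 + e) * d0) (- (clarke_dir U x (-1) + e) * d0) < l"
    using eventually_happens[of _ "at_right (0::real)"] by (auto simp: trivial_limit_at_right_real)
  define C1 C2 where "C1 = clarke_dir U x 1 + e" and "C2 = clarke_dir U x (-1) + e"
  have C: "\<forall>\<^sub>F k in nhds 0. U (x + k) - U x \<le> max (C1 * k) (- C2 * k)"
    by (rule clarke_increment_bound) (use e in \<open>auto simp: C1_def C2_def\<close>)
  have "(\<lambda>n. s n * d n) \<longlonglongrightarrow> 0" using tendsto_mult[OF s(2) d] by simp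
  then have "\<forall>\<^sub>F n in sequentially. U (x + s n * d n) - U x \<le> max (C1 * (s n * d n)) (- C2 * (s n * d n))"
    using C by (rule eventually_compose_filterlim[rotated])
  moreover have "(\<lambda>n. max (C1 * d n) (- C2 * d n)) \<longlonglongrightarrow> max (C1 * d0) (- C2 * d0)"
    by (intro tendsto_intros d)
  then have "\<forall>\<^sub>F n in sequentially. max (C1 * d n) (- C2 * d n) < l"
    by (rule order_tendstoD) (use e in \<open>simp add: C1_def C2_def\<close>)
  ultimately show "\<forall>\<^sub>F n in sequentially. ?X n < l"
  proof eventually_elim
    case (elim n)
    have "max (C1 * (s n * d n)) (- C2 * (s n * d n)) = s n * max (C1 * d n) (- C2 * d n)"
      using s(1)[of n] by (simp add: max_mult_distrib_left algebra_simps)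
    then have "(U (x + s n * d n) - U x) / s n \<le> max (C1 * d n) (- C2 * d n)"
      using elim(1) s(1)[of n] by (simp add: pos_divide_le_eq mult.commute)
    then have "(U (x + s n * d n) - U x) / s n < l" using elim(2) by (rule le_less_trans)
    then show ?case using l by simp
  qed
qed

lemma clarke_dir_bound:
  assumes "\<forall>\<zeta>\<in>clarke_subdiff U x. \<bar>\<zeta>\<bar> \<le> B"
  shows "\<bar>clarke_dir U x 1\<bar> \<le> B" "\<bar>clarke_dir U x (-1)\<bar> \<le> B"
proof -
  have "clarke_dir U x 1 \<in> clarke_subdiff U x" "- clarke_dir U x (-1) \<in> clarke_subdiff U x"
    using clarke_dir_opposite[of x] by (auto intro!: clarke_subdiffI)
  then show "\<bar>clarke_dir U x 1\<bar> \<le> B" "\<bar>clarke_dir U x (-1)\<bar> \<le> B"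
    using assms by fastforce+
qed

text \<open>The one-sided mean value inequality. Any slope \<open>B' > B\<close> bounds increments near each point, since Clarke's
derivative also controls base points to the left of \<open>x\<close>; bisection makes the bound global.\<close>

lemma increment_le_of_clarke_dir_le:
  assumes "y \<le> z" "\<And>x. y \<le> x \<Longrightarrow> x \<le> z \<Longrightarrow> clarke_dir U x 1 \<le> B"
  shows "U z - U y \<le> B * (z - y)"
proof (rule field_le_epsilon)
  fix e :: real assume e: "e > 0"
  define B' where "B' = B + e / (1 + (z - y))"
  have "e / (1 + (z - y)) > 0" using e assms(1) by simp
  then have B': "B < B'" by (simp add: B'_def)
  have "U z - U y \<le> B' * (z - y)"
    using assms(1)
  proof (induction rule: Bolzano)
    case (trans a b c)
    then show ?case by (simp add: algebra_simps)
  next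
    case (local x)
    have "clarke_dir U x 1 < B'" using assms(2)[OF local] B' by simp
    then obtain \<delta> where \<delta>: "\<delta> > 0" "\<And>y s. \<bar>y - x\<bar> < \<delta> \<Longrightarrow> 0 < s \<Longrightarrow> s < \<delta> \<Longrightarrow> U (y + s * 1) - U y < B' * s"
      using clarke_dir_lessD by blast
    show ?case
    proof (intro exI[of _ \<delta>] conjI allI impI)
      fix a b assume ab: "a \<le> x \<and> x \<le> b \<and> b - a < \<delta>"
      show "U b - U a \<le> B' * (b - a)"
        using \<delta>(2)[of a "b - a"] ab by (cases "a = b") auto
    qed (use \<delta> in simp)
  qed
  also have "\<dots> = B * (z - y) + e * ((z - y) / (1 + (z - y)))" by (simp add: B'_def algebra_simps)
  also have "\<dots> \<le> B * (z - y) + e * 1"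
    using e assms(1) by (intro add_left_mono mult_left_mono) auto
  finally show "U z - U y \<le> B * (z - y) + e" by simp
qed

text \<open>The linear growth of the subdifferential becomes a quadratic bound on increments. It makes \<open>U \<circ> q\<close>
integrable for \<open>q\<close> in \<open>L\<^sup>2\<close> and supplies the dominating function for the difference quotients.\<close>

lemma mono_clarke_growth_increment:
  assumes "mono U" "a \<ge> 0" "b \<ge> 0" "\<forall>x. \<forall>\<zeta>\<in>clarke_subdiff U x. \<bar>\<zeta>\<bar> \<le> a + b * \<bar>x\<bar>"
  shows "\<bar>U (x + k) - U x\<bar> \<le> (a + b * (\<bar>x\<bar> + \<bar>k\<bar>)) * \<bar>k\<bar>"
proof -
  let ?B = "a + b * (\<bar>x\<bar> + \<bar>k\<bar>)"
  have B: "clarke_dir U v 1 \<le> ?B" if "\<bar>v\<bar> \<le> \<bar>x\<bar> + \<bar>k\<bar>" for v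
  proof -
    have "\<bar>clarke_dir U v 1\<bar> \<le> a + b * \<bar>v\<bar>" using assms(4) by (intro clarke_dir_bound) blast
    also have "\<dots> \<le> ?B" using that assms(3) by (simp add: mult_left_mono)
    finally show ?thesis by simp
  qed
  show ?thesis
  proof (cases "k \<ge> 0")
    case True
    have "U (x + k) - U x \<le> ?B * (x + k - x)"
      using True by (intro increment_le_of_clarke_dir_le B) auto
    moreover have "U x \<le> U (x + k)" using assms(1) True by (simp add: monoD)
    ultimately show ?thesis using True by simp
  next
    case False
    have "U x - U (x + k) \<le> ?B * (x - (x + k))"
      using False by (intro increment_le_of_clarke_dir_le B) auto
    moreover have "U (x + k) \<le> U x" using assms(1) False by (simp add: monoD)
    ultimately show ?thesis using False by simp
  qed
qed

lemma mono_clarke_subdiff_nonneg: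
  assumes "mono U" "v \<in> clarke_subdiff U x"
  shows "0 \<le> v"
proof -
  have "clarke_dir U x (-1) \<le> 0"
    unfolding clarke_dir_le_iff
  proof (intro allI impI exI[of _ 1] conjI)
    fix C' y s :: real assume "0 < C'" "0 < s"
    then have "U (y + s * (-1)) \<le> U y" "0 < C' * s" using assms(1) by (auto simp: monoD)
    then show "U (y + s * (-1)) - U y < C' * s" by linarith
  qed simp
  then show ?thesis using clarke_subdiffD(1)[OF assms(2)] by simp
qed

end

section \<open>The monotone cone\<close>

lemma mono_cone_L2: "q \<in> mono_cone T \<Longrightarrow> q \<in> L2 (nu T)"
  by (simp add: mono_cone_def)

lemma L2_nu_borel: "q \<in> L2 (nu T) \<Longrightarrow> q \<in> borel_measurable borel"
  by (simp add: L2_def measurable_cong_sets[OF sets_nu refl])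

lemma borel_nu: "q \<in> borel_measurable borel \<Longrightarrow> q \<in> borel_measurable (nu T)"
  by (simp add: measurable_cong_sets[OF sets_nu refl])

lemma mono_cone_lincomb:
  assumes "f \<in> mono_cone T" "g \<in> mono_cone T" "s \<ge> 0" "s' \<ge> 0"
  shows "(\<lambda>u. s * f u + s' * g u) \<in> mono_cone T"
proof -
  obtain p p' where p: "mono_rep T f p" "mono_rep T g p'"
    using assms by (auto simp: mono_cone_def)
  have "mono_rep T (\<lambda>u. s * f u + s' * g u) (\<lambda>u. s * p u + s' * p' u)"
    unfolding mono_rep_def
  proof
    show "mono_on (rep_dom T) (\<lambda>u. s * p u + s' * p' u)"
      using p assms(3,4) by (auto simp: mono_rep_def mono_on_def intro!: add_mono mult_left_mono)
    have "AE u in nu T. f u = p u" "AE u in nu T. g u = p' u" using p by (auto simp: mono_rep_def)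
    then show "AE u in nu T. s * f u + s' * g u = s * p u + s' * p' u"
      by eventually_elim simp
  qed
  then show ?thesis
    using assms(1,2) by (auto simp: mono_cone_def intro!: L2_add L2_cmult)
qed

lemma mono_cone_of_mono_on:
  assumes "q \<in> L2 (nu T)" "mono_on (rep_dom T) q" shows "q \<in> mono_cone T"
  using assms by (auto simp: mono_cone_def mono_rep_def)

lemma mono_cone_const: "finite T \<Longrightarrow> (\<lambda>u. s) \<in> mono_cone T"
  by (intro mono_cone_of_mono_on L2_const finite_measure_nu) (auto simp: mono_on_def)

lemma mono_cone_affine:
  assumes "finite T" "f \<in> mono_cone T" "g \<in> mono_cone T" "s \<ge> 0" "s' \<ge> 0"
  shows "(\<lambda>u. c + s * f u + s' * g u) \<in> mono_cone T"
  using mono_cone_lincomb[OF mono_cone_const[OF assms(1), of c] mono_cone_lincomb[OF assms(2-5)], of 1 1]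
  by (simp add: add.assoc)

lemma clamp_in_rep_dom:
  assumes "a \<in> rep_dom T" "b \<in> rep_dom T" "a \<le> b" "T \<subseteq> {0<..1}"
  shows "max a (min b x) \<in> rep_dom T"
proof (cases "max a (min b x) = a \<or> max a (min b x) = b")
  case False
  then have "a < x" "x < b" "max a (min b x) = x" using assms(3) by (auto simp: max_def min_def split: if_splits)
  then show ?thesis using assms by (auto simp: rep_dom_def)
qed (use assms in auto)

lemma Icc_subset_rep_dom:
  assumes "a \<in> rep_dom T" "b \<in> rep_dom T" "T \<subseteq> {0<..1}"
  shows "{a..b} \<subseteq> rep_dom T"
proof
  fix x assume "x \<in> {a..b}"
  then show "x \<in> rep_dom T"
    using clamp_in_rep_dom[OF assms(1,2) _ assms(3), of x] by (auto simp: max_def min_def split: if_splits)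
qed

section \<open>The Stieltjes measure on a compact interval\<close>

text \<open>Freezing \<open>f\<close> outside \<open>[a, b]\<close> makes it a bounded monotone function on the whole line whose
difference from \<open>f\<close> is monotone as well.\<close>

definition clamp_ext :: "real \<Rightarrow> real \<Rightarrow> (real \<Rightarrow> real) \<Rightarrow> real \<Rightarrow> real" where
  "clamp_ext a b f x = f (max a (min b x))"

text \<open>The distribution function from which \<open>stieltjes_Icc\<close> is built. At \<open>x\<close> it lies between the value of
\<open>clamp_ext a b f\<close> at \<open>x\<close> and the values at all later points.\<close>

definition cdf_Icc :: "real \<Rightarrow> real \<Rightarrow> (real \<Rightarrow> real) \<Rightarrow> real \<Rightarrow> real" where
  "cdf_Icc a b f x = (if x < a then f a else if x < b then Inf (f ` {x<..b}) else f b)"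

lemma stieltjes_Icc_cdf: "stieltjes_Icc a b f = interval_measure (cdf_Icc a b f)"
  unfolding stieltjes_Icc_def by (rule arg_cong[where f=interval_measure]) (auto simp: cdf_Icc_def)

lemma sets_stieltjes_Icc [simp, measurable_cong]: "sets (stieltjes_Icc a b f) = sets borel"
  and space_stieltjes_Icc [simp]: "space (stieltjes_Icc a b f) = UNIV"
  by (simp_all add: stieltjes_Icc_def)

context
  fixes a b :: real and f :: "real \<Rightarrow> real"
  assumes ab: "a \<le> b" and f: "mono_on {a..b} f"
begin

lemma clamp_ext_mono: "mono (clamp_ext a b f)"
  using ab by (auto simp: clamp_ext_def mono_def intro!: mono_onD[OF f])

lemma clamp_ext_bounds: "f a \<le> clamp_ext a b f x" "clamp_ext a b f x \<le> f b"
  using ab by (auto simp: clamp_ext_def intro!: mono_onD[OF f])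

lemma cdf_Icc_ge_clamp: "clamp_ext a b f x \<le> cdf_Icc a b f x"
proof -
  consider "x < a" | "a \<le> x" "x < b" | "b \<le> x" by linarith
  then show ?thesis
  proof cases
    case 2
    then have "f x \<le> Inf (f ` {x<..b})"
      by (intro cINF_greatest) (auto intro!: mono_onD[OF f])
    then show ?thesis using 2 by (simp add: cdf_Icc_def clamp_ext_def)
  qed (use ab in \<open>auto simp: cdf_Icc_def clamp_ext_def\<close>)
qed

lemma cdf_Icc_le_clamp:
  assumes "x < y" shows "cdf_Icc a b f x \<le> clamp_ext a b f y"
proof -
  consider "x < a" | "a \<le> x" "x < b" | "b \<le> x" by linarith
  then show ?thesis
  proof cases
    case 1 then show ?thesis using clamp_ext_bounds by (simp add: cdf_Icc_def)
  next
    case 2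
    have "bdd_below (f ` {x<..b})"
      by (rule bdd_belowI[of _ "f a"]) (use 2 ab in \<open>auto intro!: mono_onD[OF f]\<close>)
    then have "Inf (f ` {x<..b}) \<le> f (max a (min b y))"
      by (rule cINF_lower) (use 2 assms in auto)
    then show ?thesis using 2 by (simp add: cdf_Icc_def clamp_ext_def)
  next
    case 3 then show ?thesis using ab assms by (simp add: cdf_Icc_def clamp_ext_def)
  qed
qed

lemma cdf_Icc_bounds: "f a \<le> cdf_Icc a b f x" "cdf_Icc a b f x \<le> f b"
  using cdf_Icc_ge_clamp[of x] clamp_ext_bounds[of x] cdf_Icc_le_clamp[of x "x+1"] clamp_ext_bounds[of "x+1"]
  by linarith+

lemma cdf_Icc_mono: "x \<le> y \<Longrightarrow> cdf_Icc a b f x \<le> cdf_Icc a b f y"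
  using cdf_Icc_ge_clamp[of y] cdf_Icc_le_clamp[of x y] by (cases "x = y") auto

lemma cdf_Icc_right_continuous: "continuous (at_right x) (cdf_Icc a b f)"
  unfolding continuous_within
proof (rule order_tendstoI)
  fix l assume "l < cdf_Icc a b f x"
  then show "\<forall>\<^sub>F y in at_right x. l < cdf_Icc a b f y"
    unfolding eventually_at_right_field
    by (intro exI[of _ "x+1"]) (auto intro: less_le_trans cdf_Icc_mono less_imp_le)
next
  fix l assume l: "cdf_Icc a b f x < l"
  consider "x < a" | "a \<le> x" "x < b" | "b \<le> x" by linarith
  then have "\<exists>y>x. cdf_Icc a b f y < l"
  proof cases
    case 1 then show ?thesis using l by (intro exI[of _ "(x + a)/2"]) (simp add: cdf_Icc_def)
  next
    case 2
    then have "Inf (f ` {x<..b}) < l" using l by (simp add: cdf_Icc_def)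
    then obtain z where z: "x < z" "z \<le> b" "f z < l"
      using cInf_lessD[of "f ` {x<..b}" l] 2 by auto
    have "cdf_Icc a b f ((x + z) / 2) \<le> clamp_ext a b f z" using z by (intro cdf_Icc_le_clamp) auto
    also have "\<dots> = f z" using z 2 by (simp add: clamp_ext_def)
    finally show ?thesis using z by (intro exI[of _ "(x+z)/2"]) auto
  next
    case 3 then show ?thesis using l ab by (intro exI[of _ "x+1"]) (simp add: cdf_Icc_def)
  qed
  then obtain y where "y > x" "cdf_Icc a b f y < l" by blast
  then show "\<forall>\<^sub>F z in at_right x. cdf_Icc a b f z < l"
    unfolding eventually_at_right_field
    by (intro exI[of _ y]) (auto intro: le_less_trans[OF cdf_Icc_mono] less_imp_le)
qed

lemma emeasure_stieltjes_Icc_Ioc: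
  "x \<le> y \<Longrightarrow> emeasure (stieltjes_Icc a b f) {x<..y} = ennreal (cdf_Icc a b f y - cdf_Icc a b f x)"
  unfolding stieltjes_Icc_cdf
  by (rule emeasure_interval_measure_Ioc) (auto intro: cdf_Icc_mono cdf_Icc_right_continuous)

lemma finite_measure_stieltjes_Icc: "finite_measure (stieltjes_Icc a b f)"
proof
  let ?M = "stieltjes_Icc a b f"
  have "(UNIV :: real set) = (\<Union>n::nat. {- real n<..real n})"
  proof (intro set_eqI iffI UNIV_I)
    fix x :: real
    obtain n :: nat where "\<bar>x\<bar> < real n" using reals_Archimedean2 by blast
    then show "x \<in> (\<Union>n::nat. {- real n<..real n})" by (auto intro!: exI[of _ n])
  qed
  then have "emeasure ?M (space ?M) = (SUP n. emeasure ?M {- real n<..real n})"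
    by (simp only: space_stieltjes_Icc) (subst SUP_emeasure_incseq, auto simp: incseq_def)
  also have "\<dots> \<le> ennreal (f b - f a)"
  proof (rule SUP_least)
    fix n :: nat
    have "cdf_Icc a b f (real n) - cdf_Icc a b f (- real n) \<le> f b - f a"
      using cdf_Icc_bounds by (simp add: diff_mono)
    then show "emeasure ?M {- real n<..real n} \<le> ennreal (f b - f a)"
      by (simp add: emeasure_stieltjes_Icc_Ioc ennreal_leI)
  qed
  finally show "emeasure ?M (space ?M) \<noteq> \<infinity>" by (auto simp: top_unique)
qed

lemma measure_stieltjes_Icc_Ioi: "measure (stieltjes_Icc a b f) {x<..} = f b - cdf_Icc a b f x"
proof -
  interpret finite_measure "stieltjes_Icc a b f" by (rule finite_measure_stieltjes_Icc)
  have U: "{x<..} = (\<Union>n::nat. {x<..x + real n})"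
  proof (intro set_eqI iffI)
    fix y assume "y \<in> {x<..}"
    moreover obtain n :: nat where "y - x < real n" using reals_Archimedean2 by blast
    ultimately show "y \<in> (\<Union>n::nat. {x<..x + real n})" by (auto intro!: exI[of _ n])
  qed auto
  have "(\<lambda>n. measure (stieltjes_Icc a b f) {x<..x + real n}) \<longlonglongrightarrow> measure (stieltjes_Icc a b f) {x<..}"
    unfolding U by (rule finite_Lim_measure_incseq) (auto simp: incseq_def)
  moreover have "\<forall>\<^sub>F n in sequentially. measure (stieltjes_Icc a b f) {x<..x + real n} = f b - cdf_Icc a b f x"
  proof -
    obtain N :: nat where N: "b - x < real N" using reals_Archimedean2 by blast
    have "measure (stieltjes_Icc a b f) {x<..x + real n} = f b - cdf_Icc a b f x" if "n \<ge> N" for n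
    proof -
      have n: "b \<le> x + real n" using that N by linarith
      then have "cdf_Icc a b f (x + real n) = f b" using ab by (simp add: cdf_Icc_def)
      then show ?thesis
        using emeasure_stieltjes_Icc_Ioc[of x "x + real n"] cdf_Icc_bounds(2)[of x] by (simp add: measure_def)
    qed
    then show ?thesis by (auto simp: eventually_sequentially)
  qed
  then have "(\<lambda>n. measure (stieltjes_Icc a b f) {x<..x + real n}) \<longlonglongrightarrow> f b - cdf_Icc a b f x"
    by (rule tendsto_eventually)
  ultimately show ?thesis by (rule LIMSEQ_unique)
qed

text \<open>At a jump the value \<open>f s\<close> may be anything between the one-sided limits, and the closed half-line sees the left
one; so only an inequality holds there, with equality at points of continuity.\<close>

lemma measure_stieltjes_Icc_Ici_ge: "f b - clamp_ext a b f s \<le> measure (stieltjes_Icc a b f) {s..}"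
proof -
  interpret finite_measure "stieltjes_Icc a b f" by (rule finite_measure_stieltjes_Icc)
  have U: "{s..} = (\<Inter>n::nat. {s - 1 / real (Suc n)<..})"
  proof (intro set_eqI iffI)
    fix y assume y: "y \<in> (\<Inter>n::nat. {s - 1 / real (Suc n)<..})"
    show "y \<in> {s..}"
    proof (rule ccontr)
      assume "y \<notin> {s..}"
      then obtain n where "1 / real (Suc n) < s - y" using nat_approx_posE[of "s - y"] by auto
      moreover have "s - 1 / real (Suc n) < y" using y by auto
      ultimately show False by linarith
    qed
  qed (auto intro: less_le_trans[rotated])
  have "(\<lambda>n. measure (stieltjes_Icc a b f) {s - 1 / real (Suc n)<..}) \<longlonglongrightarrow> measure (stieltjes_Icc a b f) {s..}"
    unfolding U
    by (rule finite_Lim_measure_decseq) (auto simp: decseq_def frac_le intro: le_less_trans[rotated])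
  moreover have "f b - clamp_ext a b f s \<le> measure (stieltjes_Icc a b f) {s - 1 / real (Suc n)<..}" for n
    using cdf_Icc_le_clamp[of "s - 1 / real (Suc n)" s] by (simp add: measure_stieltjes_Icc_Ioi)
  ultimately show ?thesis by (intro LIMSEQ_le_const) auto
qed

lemma measure_stieltjes_Icc_Ici_eq:
  assumes "isCont (clamp_ext a b f) s"
  shows "measure (stieltjes_Icc a b f) {s..} = f b - clamp_ext a b f s"
proof (rule antisym)
  interpret finite_measure "stieltjes_Icc a b f" by (rule finite_measure_stieltjes_Icc)
  have "measure (stieltjes_Icc a b f) {s..} \<le> f b - clamp_ext a b f x" if "x < s" for x
  proof -
    have "measure (stieltjes_Icc a b f) {s..} \<le> measure (stieltjes_Icc a b f) {x<..}"
      using that by (intro finite_measure_mono) auto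
    then show ?thesis using cdf_Icc_ge_clamp[of x] by (simp add: measure_stieltjes_Icc_Ioi)
  qed
  then have "\<forall>\<^sub>F x in at_left s. measure (stieltjes_Icc a b f) {s..} \<le> f b - clamp_ext a b f x"
    by (auto simp: eventually_at_left_field intro!: exI[of _ "s - 1"])
  moreover have "((\<lambda>x. f b - clamp_ext a b f x) \<longlongrightarrow> f b - clamp_ext a b f s) (at_left s)"
    by (intro tendsto_intros) (use assms in \<open>auto simp: isCont_def intro: tendsto_within_subset\<close>)
  ultimately show "measure (stieltjes_Icc a b f) {s..} \<le> f b - clamp_ext a b f s"
    by (intro tendsto_lowerbound) (auto simp: trivial_limit_at_left_real)
qed (rule measure_stieltjes_Icc_Ici_ge)

end

section \<open>Complementarity of the multiplier with the jumps of the monotone representative\<close>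

lemma normal_cone_nonpos:
  "z \<in> normal_cone T q \<Longrightarrow> h \<in> mono_cone T \<Longrightarrow> (LINT u|nu T. z u * (h u - q u)) \<le> 0"
  by (simp add: normal_cone_def)

lemma normal_cone_pairing_zero:
  assumes "z \<in> normal_cone T q" "h \<in> L2 (nu T)"
    "(\<lambda>u. q u + h u) \<in> mono_cone T" "(\<lambda>u. q u - h u) \<in> mono_cone T"
  shows "(LINT u|nu T. z u * h u) = 0"
  using normal_cone_nonpos[OF assms(1,3)] normal_cone_nonpos[OF assms(1,4)] by simp

lemma mono_cone_add_to_representative:
  assumes "mono_rep T q p" "q \<in> L2 (nu T)" "g \<in> L2 (nu T)" "mono_on (rep_dom T) (\<lambda>u. p u + g u)"
  shows "(\<lambda>u. q u + g u) \<in> mono_cone T"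
proof -
  have "mono_rep T (\<lambda>u. q u + g u) (\<lambda>u. p u + g u)"
    using assms(1,4) by (auto simp: mono_rep_def)
  then show ?thesis using assms(2,3) by (auto simp: mono_cone_def intro: L2_add)
qed

lemma J_nu_eq:
  assumes "finite T" "z \<in> L2 (nu T)" "T \<subseteq> {0..1}"
  shows "J_nu T z s = (LINT u|nu T. indicator {..s} u * z u)"
proof -
  have "AE u in nu T. indicator {0..s} u * z u = indicator {..s} u * z u"
    using assms(1,3) by (subst AE_nu) (auto simp: indicator_def)
  then show ?thesis
    unfolding J_nu_def set_lebesgue_integral_def real_scaleR_def
    using L2_nu_borel[OF assms(2)]
    by (intro integral_cong_AE) (auto intro!: borel_nu)
qed

lemma J_nu_measurable:
  assumes "finite T" "z \<in> L2 (nu T)" "T \<subseteq> {0..1}"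
  shows "J_nu T z \<in> borel_measurable borel"
proof -
  interpret finite_measure "nu T" by (rule finite_measure_nu[OF assms(1)])
  note [measurable] = L2_nu_borel[OF assms(2)]
  have "(\<lambda>s. LINT u|nu T. (if u \<le> s then z u else 0)) \<in> borel_measurable borel"
    by measurable
  moreover have "J_nu T z = (\<lambda>s. LINT u|nu T. (if u \<le> s then z u else 0))"
    unfolding J_nu_eq[OF assms] by (intro ext Bochner_Integration.integral_cong) auto
  ultimately show ?thesis by simp
qed

lemma normal_cone_integral_zero:
  assumes T: "finite T" "q \<in> mono_cone T" and z: "z \<in> normal_cone T q"
  shows "(LINT u|nu T. z u) = 0"
proof -
  have "(LINT u|nu T. z u * 1) = 0"
  proof (rule normal_cone_pairing_zero[OF z])
    show "(\<lambda>u. 1) \<in> L2 (nu T)" by (intro L2_const finite_measure_nu T)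
    show "(\<lambda>u. q u + 1) \<in> mono_cone T" "(\<lambda>u. q u - 1) \<in> mono_cone T"
      using mono_cone_affine[OF T(1) T(2) T(2), of 1 0 1] mono_cone_affine[OF T(1) T(2) T(2), of 1 0 "-1"]
      by (auto simp: add.commute)
  qed
  then show ?thesis by simp
qed

text \<open>Lowering \<open>q\<close> by a constant on an initial segment keeps it monotone.\<close>

lemma normal_cone_J_nonneg:
  assumes T: "finite T" "T \<subseteq> {0..1}" "q \<in> mono_cone T" and z: "z \<in> normal_cone T q"
  shows "0 \<le> J_nu T z s"
proof -
  have zL: "z \<in> L2 (nu T)" using z by (simp add: normal_cone_def)
  let ?h = "\<lambda>u. - indicator {..s} u :: real"
  have hL: "?h \<in> L2 (nu T)"
    by (rule L2_bounded[OF finite_measure_nu[OF T(1)], of _ 1]) (auto intro!: borel_nu simp: indicator_def)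
  have "?h \<in> mono_cone T"
    by (rule mono_cone_of_mono_on[OF hL]) (auto simp: mono_on_def indicator_def)
  then have "(\<lambda>u. q u + ?h u) \<in> mono_cone T"
    using mono_cone_lincomb[OF T(3), of ?h 1 1] by simp
  from normal_cone_nonpos[OF z this] show ?thesis
    unfolding J_nu_eq[OF T(1) zL T(2)] by (simp add: mult.commute)
qed

lemma normal_cone_J_one:
  assumes T: "finite T" "T \<subseteq> {0..1}" "q \<in> mono_cone T" and z: "z \<in> normal_cone T q"
  shows "J_nu T z 1 = 0"
proof -
  have zL: "z \<in> L2 (nu T)" using z by (simp add: normal_cone_def)
  have "AE u in nu T. indicator {..1} u * z u = z u"
    using T(1,2) by (subst AE_nu) (auto simp: indicator_def)
  then have "(LINT u|nu T. indicator {..1} u * z u) = (LINT u|nu T. z u)"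
    using L2_nu_borel[OF zL] by (intro integral_cong_AE) (auto intro!: borel_nu)
  then show ?thesis
    using normal_cone_integral_zero[OF T(1,3) z] J_nu_eq[OF T(1) zL T(2)] by simp
qed

lemma clamp_ext_L2:
  assumes "finite T" "a \<le> b" "mono_on {a..b} p"
  shows "clamp_ext a b p \<in> L2 (nu T)"
proof (rule L2_bounded[OF finite_measure_nu[OF assms(1)]])
  show "clamp_ext a b p \<in> borel_measurable (nu T)"
    by (intro borel_nu borel_measurable_mono clamp_ext_mono assms)
  show "AE x in nu T. \<bar>clamp_ext a b p x\<bar> \<le> max \<bar>p a\<bar> \<bar>p b\<bar>"
    using clamp_ext_bounds[OF assms(2,3)] by (intro AE_I2) (smt (verit))
qed

text \<open>Both \<open>p\<close> plus its clipping and \<open>p\<close> minus its clipping are nondecreasing, so the inequality of the normal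
cone holds with both signs. Clipping, rather than testing with \<open>q\<close> itself, localizes complementarity to
\<open>[a, b]\<close>, where \<open>p\<close> is bounded.\<close>

lemma normal_cone_clamp_zero:
  assumes T: "finite T" "T \<subseteq> {0<..1}" "q \<in> L2 (nu T)" and z: "z \<in> normal_cone T q"
    and p: "mono_rep T q p" and ab: "a \<in> rep_dom T" "b \<in> rep_dom T" "a \<le> b"
  shows "(LINT u|nu T. z u * clamp_ext a b p u) = 0"
proof (rule normal_cone_pairing_zero[OF z])
  have sub: "{a..b} \<subseteq> rep_dom T" using Icc_subset_rep_dom[OF ab(1,2) T(2)] .
  have pm: "mono_on (rep_dom T) p" using p by (simp add: mono_rep_def)
  then have pab: "mono_on {a..b} p" using sub by (rule mono_on_subset)
  show cL: "clamp_ext a b p \<in> L2 (nu T)" by (rule clamp_ext_L2[OF T(1) ab(3) pab])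
  show "(\<lambda>u. q u + clamp_ext a b p u) \<in> mono_cone T"
    by (rule mono_cone_add_to_representative[OF p T(3) cL])
      (use pm clamp_ext_mono[OF ab(3) pab] in \<open>auto simp: mono_on_def mono_def intro!: add_mono\<close>)
  have "mono_on (rep_dom T) (\<lambda>u. p u + - 1 * clamp_ext a b p u)"
  proof (rule mono_onI)
    fix x y assume xy: "x \<in> rep_dom T" "y \<in> rep_dom T" "x \<le> y"
    have d: "x \<in> rep_dom T" "y \<in> rep_dom T" "a \<in> rep_dom T" "b \<in> rep_dom T" using xy ab by auto
    have M: "p v \<le> p v'" if "v \<le> v'" "v \<in> rep_dom T" "v' \<in> rep_dom T" for v v'
      using mono_onD[OF pm that(2,3,1)] .
    have "p x - clamp_ext a b p x \<le> p y - clamp_ext a b p y"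
      unfolding clamp_ext_def using ab(3) xy(3) d
        M[of x y] M[of x a] M[of b y] M[of x b] M[of a b] M[of a y] M[of a x] M[of b x] M[of y a] M[of y b]
      unfolding max_def min_def by (smt (verit))
    then show "p x + - 1 * clamp_ext a b p x \<le> p y + - 1 * clamp_ext a b p y" by simp
  qed
  from mono_cone_add_to_representative[OF p T(3) L2_cmult[OF cL] this]
  show "(\<lambda>u. q u - clamp_ext a b p u) \<in> mono_cone T" by simp
qed

text \<open>Fubini turns \<open>\<integral> J\<close> into \<open>\<integral> z u \<mu>[u, \<infinity>) d\<nu>\<close>. Up to a constant, \<open>- \<mu>[u, \<infinity>)\<close> is the clipped \<open>p\<close> almost
everywhere, and lies below it at the atoms, where \<open>z \<le> 0\<close>; as \<open>z\<close> annihilates constants and the clipped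
\<open>p\<close>, the integral is nonpositive, while \<open>J\<close> is nonnegative.\<close>

lemma J_nu_stieltjes_Icc_null:
  assumes T: "finite T" "T \<subseteq> {0<..1}" "q \<in> mono_cone T" and z: "z \<in> normal_cone T q"
    and zT: "\<And>t. t \<in> T \<Longrightarrow> z t \<le> 0"
    and p: "mono_rep T q p" and ab: "a \<in> rep_dom T" "b \<in> rep_dom T" "a \<le> b"
  shows "AE s in stieltjes_Icc a b p. J_nu T z s = 0"
proof -
  let ?\<mu> = "stieltjes_Icc a b p"
  have T01: "T \<subseteq> {0..1}" using T(2) by auto
  have qL: "q \<in> L2 (nu T)" using T(3) by (rule mono_cone_L2)
  have zL: "z \<in> L2 (nu T)" using z by (simp add: normal_cone_def)
  note [measurable] = L2_nu_borel[OF zL]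
  have pab: "mono_on {a..b} p"
    using p Icc_subset_rep_dom[OF ab(1,2) T(2)] by (auto simp: mono_rep_def intro: mono_on_subset)
  interpret N: finite_measure "nu T" by (rule finite_measure_nu[OF T(1)])
  interpret S: finite_measure ?\<mu> by (rule finite_measure_stieltjes_Icc[OF ab(3) pab])
  interpret pair_sigma_finite ?\<mu> "nu T" ..
  define c where "c = clamp_ext a b p"
  have cL: "c \<in> L2 (nu T)" unfolding c_def by (rule clamp_ext_L2[OF T(1) ab(3) pab])
  define G where "G u = measure ?\<mu> {u..}" for u
  have zi: "integrable (nu T) z" by (rule integrable_L2[OF N.finite_measure_axioms zL])
  have ind: "integrable (?\<mu> \<Otimes>\<^sub>M nu T) (\<lambda>(s, u). indicator {..s} u * z u)"
  proof (rule Fubini_integrable)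
    show "(\<lambda>(s, u). indicator {..s} u * z u) \<in> borel_measurable (?\<mu> \<Otimes>\<^sub>M nu T)"
    proof -
      have "(\<lambda>(s, u). (if u \<le> s then z u else 0)) \<in> borel_measurable (?\<mu> \<Otimes>\<^sub>M nu T)" by measurable
      then show ?thesis by (rule measurable_cong[THEN iffD1, rotated]) auto
    qed
    have zs: "integrable (nu T) (\<lambda>u. indicator {..s} u * z u)" for s
      using integrable_mult_indicator[of "{..s}" "nu T" z] zi by simp
    show "AE s in ?\<mu>. integrable (nu T) (\<lambda>u. case (s, u) of (s, u) \<Rightarrow> indicator {..s} u * z u)"
      using zs by simp
    show "integrable ?\<mu> (\<lambda>s. LINT u|nu T. norm (case (s, u) of (s, u) \<Rightarrow> indicator {..s} u * z u))"
    proof (rule S.integrable_const_bound[of _ "LINT u|nu T. \<bar>z u\<bar>"])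
      have "(LINT u|nu T. norm (indicator {..s} u * z u)) \<le> (LINT u|nu T. \<bar>z u\<bar>)" for s
        using zs zi by (intro integral_mono) (auto simp: indicator_def)
      then show "AE s in ?\<mu>. norm (LINT u|nu T. norm (case (s, u) of (s, u) \<Rightarrow> indicator {..s} u * z u))
          \<le> (LINT u|nu T. \<bar>z u\<bar>)"
        by (intro AE_I2) (simp add: abs_of_nonneg)
      have "(\<lambda>s. LINT u|nu T. (if u \<le> s then \<bar>z u\<bar> else 0)) \<in> borel_measurable ?\<mu>" by measurable
      moreover have "(\<lambda>s. LINT u|nu T. norm (case (s, u) of (s, u) \<Rightarrow> indicator {..s} u * z u))
          = (\<lambda>s. LINT u|nu T. (if u \<le> s then \<bar>z u\<bar> else 0))"
        by (intro ext Bochner_Integration.integral_cong) auto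
      ultimately show "(\<lambda>s. LINT u|nu T. norm (case (s, u) of (s, u) \<Rightarrow> indicator {..s} u * z u)) \<in> borel_measurable ?\<mu>"
        by simp
    qed
  qed
  have Jeq: "J_nu T z = (\<lambda>s. LINT u|nu T. indicator {..s} u * z u)"
    using J_nu_eq[OF T(1) zL T01] by auto
  have Ji: "integrable ?\<mu> (J_nu T z)"
    unfolding Jeq using integrable_fst'[OF ind] by simp
  have "(LINT s|?\<mu>. J_nu T z s) = (LINT u|nu T. LINT s|?\<mu>. indicator {..s} u * z u)"
    unfolding Jeq using Fubini_integral[OF ind] by simp
  also have "\<dots> = (LINT u|nu T. G u * z u)"
  proof (rule Bochner_Integration.integral_cong[OF refl])
    fix u
    have "(LINT s|?\<mu>. indicator {..s} u * z u) = (LINT s|?\<mu>. indicator {u..} s * z u)"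
      by (rule Bochner_Integration.integral_cong) (auto simp: indicator_def)
    also have "\<dots> = G u * z u" by (simp add: G_def)
    finally show "(LINT s|?\<mu>. indicator {..s} u * z u) = G u * z u" .
  qed
  \<comment> \<open>both subtracted terms integrate to zero\<close>
  also have "\<dots> = (LINT u|nu T. G u * z u - (p b * z u - z u * c u))"
  proof -
    have Gz: "integrable (nu T) (\<lambda>u. G u * z u)"
    proof (rule Bochner_Integration.integrable_bound)
      show "integrable (nu T) (\<lambda>u. measure ?\<mu> UNIV * \<bar>z u\<bar>)" using zi by simp
      have "antimono G" unfolding G_def by (auto simp: monotone_def intro!: S.finite_measure_mono)
      then have "mono (\<lambda>u. - G u)" by (auto simp: monotone_def)
      then have "(\<lambda>u. - (- G u)) \<in> borel_measurable borel"
        by (intro borel_measurable_uminus borel_measurable_mono)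
      then show "(\<lambda>u. G u * z u) \<in> borel_measurable (nu T)" by (intro borel_nu) simp
      have "\<bar>G u\<bar> \<le> measure ?\<mu> UNIV" for u
        unfolding G_def using S.finite_measure_mono[of "{u..}" UNIV] by simp
      then show "AE u in nu T. norm (G u * z u) \<le> norm (measure ?\<mu> UNIV * \<bar>z u\<bar>)"
        by (intro AE_I2) (simp add: abs_mult mult_right_mono)
    qed
    have "(LINT u|nu T. z u * c u) = 0"
      unfolding c_def by (rule normal_cone_clamp_zero[OF T(1,2) qL z p ab])
    then show ?thesis
      using Gz zi integrable_L2_mult[OF zL cL] normal_cone_integral_zero[OF T(1,3) z] by simp
  qed
  also have "\<dots> \<le> (LINT u|nu T. 0)"
  proof -
    have "countable {u. \<not> isCont c u}"
      unfolding c_def by (intro mono_ctble_discont clamp_ext_mono ab pab)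
    then have "AE u in lborel. u \<notin> {u. \<not> isCont c u}"
      by (intro AE_not_in countable_imp_null_set_lborel)
    then have "AE u in lborel. u \<in> {0..1} \<longrightarrow> G u * z u - (p b * z u - z u * c u) \<le> 0"
    proof eventually_elim
      case (elim u)
      then have "G u = p b - c u"
        using measure_stieltjes_Icc_Ici_eq[OF ab(3) pab, of u] by (simp add: G_def c_def)
      then show ?case by (simp only:) (simp add: algebra_simps)
    qed
    moreover have "G u * z u - (p b * z u - z u * c u) \<le> 0" if "u \<in> T" for u
    proof -
      have "G u * z u \<le> (p b - c u) * z u"
        using measure_stieltjes_Icc_Ici_ge[OF ab(3) pab, of u] zT[OF that]
        by (intro mult_right_mono_neg) (auto simp: G_def c_def)
      then show ?thesis by (simp add: algebra_simps)
    qed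
    ultimately have "AE u in nu T. G u * z u - (p b * z u - z u * c u) \<le> 0"
      by (simp add: AE_nu[OF T(1)])
    then show ?thesis by (intro integral_mono_AE') auto
  qed
  finally have "(LINT s|?\<mu>. J_nu T z s) \<le> 0" by simp
  moreover have J0: "J_nu T z s \<ge> 0" for s by (rule normal_cone_J_nonneg[OF T(1) T01 T(3) z])
  ultimately have "(LINT s|?\<mu>. J_nu T z s) = 0"
    by (intro antisym integral_nonneg_AE) auto
  then show ?thesis
    using integral_nonneg_eq_0_iff_AE[OF Ji] J0 by auto
qed

text \<open>The supremum \<open>S\<close> of measures without mass on \<open>B\<close> is below its own restriction to the complement of \<open>B\<close>,
since that restriction is still an upper bound.\<close>

lemma emeasure_SUP_null:
  assumes "I \<noteq> {}" "\<And>i. i \<in> I \<Longrightarrow> sets (M i) = sets N" "\<And>i. i \<in> I \<Longrightarrow> emeasure (M i) B = 0" "B \<in> sets N"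
  shows "emeasure (SUP i\<in>I. M i) B = 0"
proof -
  define S where "S = (SUP i\<in>I. M i)"
  have sS: "sets S = sets N" unfolding S_def by (rule sets_SUP) (use assms in auto)
  have B: "B \<in> sets S" using assms(4) sS by simp
  have "S \<le> density S (indicator (space S - B))"
    (is "_ \<le> ?D")
  proof -
    have "M i \<le> ?D" if i: "i \<in> I" for i
    proof -
      have sM: "sets (M i) = sets S" using assms(2)[OF i] sS by simp
      have le: "M i \<le> S" unfolding S_def using i by (rule SUP_upper)
      have "emeasure (M i) A \<le> emeasure (density S (indicator (space S - B))) A" if A: "A \<in> sets S" for A
      proof -
        have "emeasure (M i) A = emeasure (M i) (A - B)"
          using assms(3)[OF i] A B sM by (intro emeasure_Diff_null_set[symmetric]) (auto simp: null_sets_def)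
        also have "\<dots> \<le> emeasure S (A - B)" by (rule le_measureD3[OF le sM])
        also have "\<dots> = emeasure (density S (indicator (space S - B))) A"
          using A B by (subst emeasure_density)
            (auto intro!: nn_integral_cong simp flip: nn_integral_indicator dest: sets.sets_into_space split: split_indicator)
        finally show ?thesis .
      qed
      then show "M i \<le> density S (indicator (space S - B))"
        using sM by (subst le_measure) auto
    qed
    then have "(SUP i\<in>I. M i) \<le> ?D" by (rule SUP_least)
    then show ?thesis unfolding S_def[symmetric] .
  qed
  then have "emeasure S B \<le> emeasure (density S (indicator (space S - B))) B"
    by (rule le_measureD3) simp
  also have "\<dots> = (\<integral>\<^sup>+x. indicator (space S - B) x * indicator B x \<partial>S)"
    using B by (subst emeasure_density) auto
  also have "(\<lambda>x. indicator (space S - B) x * indicator B x :: ennreal) = (\<lambda>x. 0)"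
    by (auto simp: indicator_def)
  also have "(\<integral>\<^sup>+x. 0 \<partial>S) = 0" by simp
  finally show ?thesis by (simp add: S_def)
qed

lemma sets_stieltjes:
  assumes "c \<in> D" shows "sets (stieltjes D p) = sets borel"
  unfolding stieltjes_def by (rule sets_SUP) (use assms in auto)

lemma J_nu_stieltjes_integral_zero:
  assumes T: "finite T" "T \<subseteq> {0<..1}" "q \<in> mono_cone T" and z: "z \<in> normal_cone T q"
    and zT: "\<And>t. t \<in> T \<Longrightarrow> z t \<le> 0" and p: "mono_rep T q p"
  shows "has_bochner_integral (stieltjes (rep_dom T) p) (J_nu T z) 0"
proof -
  let ?M = "stieltjes (rep_dom T) p"
  have D: "1/2 \<in> rep_dom T" by (simp add: rep_dom_def)
  have sM: "sets ?M = sets borel" by (rule sets_stieltjes[OF D])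
  have zL: "z \<in> L2 (nu T)" using z by (simp add: normal_cone_def)
  have Jm: "J_nu T z \<in> borel_measurable borel"
    by (rule J_nu_measurable[OF T(1) zL]) (use T(2) in auto)
  define B where "B = {s. J_nu T z s \<noteq> 0}"
  have B: "B \<in> sets borel" using measurable_sets[OF Jm, of "- {0}"] by (auto simp: B_def vimage_def)
  have "emeasure ?M B = 0"
    unfolding stieltjes_def
  proof (rule emeasure_SUP_null[of _ _ borel])
    show "{(a, b). a \<in> rep_dom T \<and> b \<in> rep_dom T \<and> a \<le> b} \<noteq> {}" using D by auto
    fix i assume "i \<in> {(a, b). a \<in> rep_dom T \<and> b \<in> rep_dom T \<and> a \<le> b}"
    then obtain a b where i: "i = (a, b)" "a \<in> rep_dom T" "b \<in> rep_dom T" "a \<le> b" by auto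
    show "sets (case i of (a, b) \<Rightarrow> stieltjes_Icc a b p) = sets borel" by (simp add: i)
    have "AE s in stieltjes_Icc a b p. J_nu T z s = 0"
      by (rule J_nu_stieltjes_Icc_null[OF T z zT p i(2-4)])
    then show "emeasure (case i of (a, b) \<Rightarrow> stieltjes_Icc a b p) B = 0"
      using AE_iff_measurable[of B "stieltjes_Icc a b p" "\<lambda>s. J_nu T z s = 0"] B by (auto simp: i B_def)
  qed (rule B)
  then have "AE s in ?M. J_nu T z s = 0"
    using AE_iff_measurable[of B ?M "\<lambda>s. J_nu T z s = 0"] B sM sets_eq_imp_space_eq[OF sM] by (auto simp: B_def)
  then show ?thesis
    using Jm by (subst has_bochner_integral_cong_AE[of _ _ "\<lambda>_. 0"])
      (auto simp: measurable_cong_sets[OF sM refl] has_bochner_integral_zero)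
qed

section \<open>The densities\<close>

text \<open>\<open>T\<close> is Lebesgue-null, so Lebesgue measure on \<open>[0, 1]\<close> is \<open>nu T\<close> with the atoms removed.\<close>

lemma rho_0_AE:
  assumes "finite T"
  shows "AE u in nu T. rho_0 T u = indicator (- T) u"
proof -
  interpret finite_measure "nu T" by (rule finite_measure_nu[OF assms])
  have Tm[measurable]: "T \<in> sets borel"
    using assms by (simp add: borel_closed finite_imp_closed)
  have Tnull: "AE u in lborel. u \<notin> T"
    using assms by (intro AE_not_in finite_imp_null_set_lborel)
  have "density (nu T) (indicator (- T)) = density lborel (indicator {0..1})"
  proof (rule measure_eqI)
    fix A assume "A \<in> sets (density (nu T) (indicator (- T)))"
    then have A[measurable]: "A \<in> sets borel" by simp
    have "emeasure (density (nu T) (indicator (- T))) A = (\<integral>\<^sup>+u. indicator (- T) u * indicator A u \<partial>nu T)"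
      by (rule emeasure_density) (auto intro!: borel_measurable_indicator)
    also have "\<dots> = (\<integral>\<^sup>+u. indicator (- T) u * indicator A u * indicator {0..1} u \<partial>lborel)"
      by (subst nn_integral_nu[OF assms]) auto
    also have "\<dots> = (\<integral>\<^sup>+u. indicator {0..1} u * indicator A u \<partial>lborel)"
      by (rule nn_integral_cong_AE) (use Tnull in \<open>auto elim!: eventually_mono simp: indicator_def\<close>)
    also have "\<dots> = emeasure (density lborel (indicator {0..1})) A"
      by (rule emeasure_density[symmetric]) auto
    finally show "emeasure (density (nu T) (indicator (- T))) A = emeasure (density lborel (indicator {0..1})) A" .
  qed simp
  from RN_deriv_unique[OF _ this]
  have "AE u in nu T. indicator (- T) u = RN_deriv (nu T) (density lborel (indicator {0..1})) u"
    by (auto intro!: borel_measurable_indicator)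
  then show ?thesis
  proof eventually_elim
    case (elim u)
    then show ?case unfolding rho_0_def by (simp flip: elim) (simp add: indicator_def)
  qed
qed

locale distortion_atoms =
  fixes J :: nat and t m :: "nat \<Rightarrow> real" and T :: "real set" and \<phi> w :: "real \<Rightarrow> real"
  assumes inj: "inj_on t {1..J}" and tm: "\<forall>j\<in>{1..J}. 0 < t j \<and> t j \<le> 1 \<and> m j > 0"
    and T: "T = t ` {1..J}" and phi: "\<phi> \<in> distortions"
    and w_meas: "set_borel_measurable lborel {0<..<1} w"
    and w_bdd: "\<exists>C. AE u in lborel. u \<in> {0<..<1} \<longrightarrow> \<bar>w u\<bar> \<le> C"
    and w_phi: "\<forall>A\<in>sets borel. measure (stieltjes_Icc 0 1 \<phi>) A =
           (LBINT u:A \<inter> {0..1}. w u) + (\<Sum>j=1..J. m j * indicator A (t j))"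
begin

lemma finite_T: "finite T" and T_subset: "T \<subseteq> {0<..1}" and T_subset': "T \<subseteq> {0..1}"
  using T tm by (auto intro: less_imp_le)

lemma T_borel[measurable]: "T \<in> sets borel"
  using finite_T by (simp add: borel_closed finite_imp_closed)

lemma T_lborel_null: "AE u in lborel. u \<notin> T"
  using finite_T by (intro AE_not_in finite_imp_null_set_lborel)

lemma sum_T: "(\<Sum>x\<in>T. g x) = (\<Sum>j=1..J. g (t j))"
  unfolding T sum.reindex[OF inj] comp_def by (rule refl)

text \<open>The density \<open>w\<close> is measurable on the open unit interval; its cut-off is Borel on the line and gives
the same integrals over \<open>[0, 1]\<close>.\<close>

definition w01 :: "real \<Rightarrow> real" where "w01 u = indicator {0..1} u * w u"

lemma w01_measurable[measurable]: "w01 \<in> borel_measurable borel"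
proof -
  have [measurable]: "(\<lambda>u. indicator {0<..<1} u * w u) \<in> borel_measurable borel"
    using w_meas by (simp add: set_borel_measurable_def)
  have "w01 = (\<lambda>u. indicator {0<..<1} u * w u + w 0 * indicator {0} u + w 1 * indicator {1} u)"
    by (auto simp: w01_def fun_eq_iff split: split_indicator)
  then show ?thesis by simp
qed

lemma set_integral_w01:
  "(LBINT u:{0..1}. F u (w u)) = (LBINT u:{0..1}. F u (w01 u))"
  by (rule set_lebesgue_integral_cong) (auto simp: w01_def)

lemma w01_bounded: obtains C where "C \<ge> 0" "AE u in lborel. \<bar>w01 u\<bar> \<le> C"
proof -
  obtain C where C: "AE u in lborel. u \<in> {0<..<1} \<longrightarrow> \<bar>w u\<bar> \<le> C" using w_bdd by blast
  have "AE u in lborel. u \<noteq> (0::real)" "AE u in lborel. u \<noteq> (1::real)" by (rule AE_lborel_singleton)+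
  then have "AE u in lborel. \<bar>w01 u\<bar> \<le> max 0 C"
    using C by eventually_elim (auto simp: w01_def indicator_def)
  then show thesis using that[of "max 0 C"] by auto
qed

lemma w01_integrable: "integrable lborel w01"
proof -
  obtain C where C: "C \<ge> 0" "AE u in lborel. \<bar>w01 u\<bar> \<le> C" by (rule w01_bounded)
  show ?thesis
  proof (rule Bochner_Integration.integrable_bound)
    show "integrable lborel (\<lambda>u. C * indicator {0..1::real} u)"
      by (intro integrable_mult_right integrable_real_indicator) auto
    show "AE u in lborel. norm (w01 u) \<le> norm (C * indicator {0..1} u)"
      using C(2) by eventually_elim (auto simp: w01_def indicator_def)
  qed simp
qed

lemma phi_mono: "mono_on {0..1} \<phi>"
  using phi by (simp add: distortions_def)

text \<open>A positive measure has a nonnegative density: test the representation on \<open>{w < 0}\<close> with the atoms removed.\<close>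

lemma w01_nonneg: "AE u in lborel. 0 \<le> w01 u"
proof -
  define A where "A = {u. w01 u < 0} - T"
  have A[measurable]: "A \<in> sets borel" unfolding A_def by measurable
  have i: "integrable lborel (\<lambda>u. indicator A u * w01 u)"
    using integrable_mult_indicator[of A lborel w01] w01_integrable by simp
  have "(LBINT u:A \<inter> {0..1}. w u) = (LINT u|lborel. indicator A u * w01 u)"
    unfolding set_lebesgue_integral_def by (rule Bochner_Integration.integral_cong) (auto simp: w01_def indicator_def)
  moreover have "(\<Sum>j=1..J. m j * indicator A (t j)) = 0"
    by (rule sum.neutral) (auto simp: A_def T)
  ultimately have "(LINT u|lborel. indicator A u * w01 u) = measure (stieltjes_Icc 0 1 \<phi>) A"
    using w_phi A by simp
  then have "(LINT u|lborel. indicator A u * w01 u) \<ge> 0" by simp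
  moreover have "(LINT u|lborel. - (indicator A u * w01 u)) \<ge> 0"
    by (rule integral_nonneg_AE) (auto simp: A_def indicator_def)
  ultimately have "(LINT u|lborel. - (indicator A u * w01 u)) = 0" using i by simp
  then have "AE u in lborel. - (indicator A u * w01 u) = 0"
    using i by (subst (asm) integral_nonneg_eq_0_iff_AE) (auto simp: A_def indicator_def)
  then show ?thesis
    using T_lborel_null by eventually_elim (auto simp: A_def indicator_def split: if_splits)
qed

definition atoms :: "(nat \<Rightarrow> real) \<Rightarrow> real \<Rightarrow> real" where
  "atoms g u = (\<Sum>i=1..J. g i * indicator {t i} u)"

lemma atoms_measurable[measurable]: "atoms g \<in> borel_measurable borel"
  unfolding atoms_def[abs_def] by measurable

lemma atoms_at:
  assumes "j \<in> {1..J}"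
  shows "atoms g (t j) = g j"
proof -
  have "atoms g (t j) = (\<Sum>i\<in>{1..J}. if i = j then g i else 0)"
    unfolding atoms_def
  proof (rule sum.cong[OF refl])
    fix i assume "i \<in> {1..J}"
    then have "t j = t i \<longleftrightarrow> i = j" using inj_on_eq_iff[OF inj assms, of i] by blast
    then show "g i * indicator {t i} (t j) = (if i = j then g i else 0)" by simp
  qed
  also have "\<dots> = g j" using assms by simp
  finally show ?thesis .
qed

lemma atoms_off: "u \<notin> T \<Longrightarrow> atoms g u = 0"
  unfolding atoms_def by (rule sum.neutral) (auto simp: T indicator_def)

text \<open>The function on the right is a \<open>nu T\<close>-density of the Stieltjes measure of \<open>\<phi>\<close>, and such densities are
unique almost everywhere; at the atoms this determines them pointwise.\<close>

lemma rho_phi_AE: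
  "AE u in nu T. rho_phi T \<phi> u = indicator (- T) u * w01 u + atoms m u"
proof -
  interpret finite_measure "nu T" by (rule finite_measure_nu[OF finite_T])
  interpret S: finite_measure "stieltjes_Icc 0 1 \<phi>"
    by (rule finite_measure_stieltjes_Icc) (auto simp: phi_mono)
  define r where "r u = indicator (- T) u * w01 u + atoms m u" for u
  have r[measurable]: "r \<in> borel_measurable borel" unfolding r_def by measurable
  have rt: "r (t j) = m j" if "j \<in> {1..J}" for j
    using that by (auto simp: r_def T atoms_at)
  have rw: "AE u in lborel. r u = w01 u"
    using T_lborel_null by eventually_elim (simp add: r_def atoms_off)
  have "density (nu T) r = stieltjes_Icc 0 1 \<phi>"
  proof (rule measure_eqI)
    fix A assume "A \<in> sets (density (nu T) r)"
    then have A[measurable]: "A \<in> sets borel" by simp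
    have i: "integrable lborel (\<lambda>u. indicator A u * w01 u)"
      using integrable_mult_indicator[of A lborel w01] w01_integrable by simp
    have "emeasure (density (nu T) r) A = (\<integral>\<^sup>+u. ennreal (r u) * indicator A u \<partial>nu T)"
      by (rule emeasure_density) (auto intro!: borel_nu)
    also have "\<dots> = (\<integral>\<^sup>+u. ennreal (r u) * indicator A u * indicator {0..1} u \<partial>lborel) + (\<Sum>x\<in>T. ennreal (r x) * indicator A x)"
      by (subst nn_integral_nu[OF finite_T]) auto
    also have "(\<integral>\<^sup>+u. ennreal (r u) * indicator A u * indicator {0..1} u \<partial>lborel) = (\<integral>\<^sup>+u. ennreal (indicator A u * w01 u) \<partial>lborel)"
      by (rule nn_integral_cong_AE) (use rw in \<open>auto elim!: eventually_mono simp: indicator_def w01_def\<close>)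
    also have "\<dots> = ennreal (LINT u|lborel. indicator A u * w01 u)"
      by (rule nn_integral_eq_integral[OF i]) (use w01_nonneg in \<open>auto elim!: eventually_mono\<close>)
    also have "(\<Sum>x\<in>T. ennreal (r x) * indicator A x) = (\<Sum>j=1..J. ennreal (m j * indicator A (t j)))"
      unfolding sum_T by (rule sum.cong) (auto simp: rt indicator_def)
    also have "\<dots> = ennreal (\<Sum>j=1..J. m j * indicator A (t j))"
      by (rule sum_ennreal) (use tm in \<open>auto simp: less_imp_le\<close>)
    also have "ennreal (LINT u|lborel. indicator A u * w01 u) + ennreal (\<Sum>j=1..J. m j * indicator A (t j))
        = ennreal ((LINT u|lborel. indicator A u * w01 u) + (\<Sum>j=1..J. m j * indicator A (t j)))"
      by (rule ennreal_plus[symmetric])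
        (use w01_nonneg tm in \<open>auto intro!: integral_nonneg_AE sum_nonneg elim!: eventually_mono simp: less_imp_le\<close>)
    also have "(LINT u|lborel. indicator A u * w01 u) = (LBINT u:A \<inter> {0..1}. w u)"
      unfolding set_lebesgue_integral_def by (rule Bochner_Integration.integral_cong) (auto simp: w01_def indicator_def)
    also have "ennreal ((LBINT u:A \<inter> {0..1}. w u) + (\<Sum>j=1..J. m j * indicator A (t j)))
        = emeasure (stieltjes_Icc 0 1 \<phi>) A"
      using w_phi A by (simp add: S.emeasure_eq_measure)
    finally show "emeasure (density (nu T) r) A = emeasure (stieltjes_Icc 0 1 \<phi>) A" .
  qed simp
  from RN_deriv_unique[OF _ this]
  have "AE u in nu T. ennreal (r u) = RN_deriv (nu T) (stieltjes_Icc 0 1 \<phi>) u"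
    by (auto intro!: borel_nu)
  moreover have "AE u in nu T. 0 \<le> r u"
  proof -
    have "AE u in lborel. u \<in> {0..1} \<longrightarrow> 0 \<le> r u" using rw w01_nonneg by eventually_elim simp
    then show ?thesis
      unfolding AE_nu[OF finite_T] using rt tm by (auto simp: T less_imp_le)
  qed
  ultimately have "AE u in nu T. rho_phi T \<phi> u = r u"
  proof eventually_elim
    case (elim u)
    then show ?case unfolding rho_phi_def elim(1)[symmetric] by simp
  qed
  then show ?thesis unfolding r_def .
qed

abbreviation "\<rho> \<equiv> rho_phi T \<phi>"

lemma rho_measurable[measurable]: "\<rho> \<in> borel_measurable borel"
proof -
  have "RN_deriv (nu T) (stieltjes_Icc 0 1 \<phi>) \<in> borel_measurable (nu T)"
    by (rule borel_measurable_RN_deriv)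
  then have [measurable]: "RN_deriv (nu T) (stieltjes_Icc 0 1 \<phi>) \<in> borel_measurable borel"
    unfolding measurable_cong_sets[OF sets_nu refl] .
  show ?thesis unfolding rho_phi_def[abs_def] by measurable
qed

lemma rho_nonneg: "0 \<le> \<rho> u"
  by (simp add: rho_phi_def)

lemma rho_AE_w: "AE u in lborel. u \<in> {0..1} \<longrightarrow> \<rho> u = w01 u"
  using conjunct1[OF rho_phi_AE[unfolded AE_nu[OF finite_T]]] T_lborel_null
  by eventually_elim (simp add: atoms_off)

lemma rho_atom: "j \<in> {1..J} \<Longrightarrow> \<rho> (t j) = m j"
  using conjunct2[OF rho_phi_AE[unfolded AE_nu[OF finite_T]]] by (auto simp: T atoms_at)

lemma rho_bounded: obtains C where "C \<ge> 0" "AE u in nu T. \<rho> u \<le> C"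
proof -
  obtain C where C: "C \<ge> 0" "AE u in lborel. \<bar>w01 u\<bar> \<le> C" by (rule w01_bounded)
  have s: "0 \<le> (\<Sum>j=1..J. m j)" using tm by (intro sum_nonneg) (auto simp: less_imp_le)
  have "AE u in lborel. u \<in> {0..1} \<longrightarrow> \<rho> u \<le> C + (\<Sum>j=1..J. m j)"
    using C(2) rho_AE_w by eventually_elim (use s in linarith)
  moreover have "\<rho> (t j) \<le> C + (\<Sum>j=1..J. m j)" if "j \<in> {1..J}" for j
  proof -
    have "m j \<le> (\<Sum>j=1..J. m j)" using that tm by (intro member_le_sum) (auto simp: less_imp_le)
    then show ?thesis using rho_atom[OF that] C(1) by simp
  qed
  ultimately have "AE u in nu T. \<rho> u \<le> C + (\<Sum>j=1..J. m j)"
    unfolding AE_nu[OF finite_T] by (auto simp: T)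
  then show thesis using that[of "C + (\<Sum>j=1..J. m j)"] C(1) s by auto
qed

lemma rho_mult_integrable:
  assumes "integrable (nu T) f" shows "integrable (nu T) (\<lambda>u. \<rho> u * f u)"
proof -
  obtain C where C: "C \<ge> 0" "AE u in nu T. \<rho> u \<le> C" by (rule rho_bounded)
  show ?thesis
  proof (rule Bochner_Integration.integrable_bound)
    show "integrable (nu T) (\<lambda>u. C * f u)" using assms by simp
    show "AE u in nu T. norm (\<rho> u * f u) \<le> norm (C * f u)"
      using C(2) by eventually_elim (use C(1) rho_nonneg in \<open>auto simp: abs_mult intro!: mult_right_mono\<close>)
  qed (use assms in \<open>auto intro!: borel_measurable_times borel_nu rho_measurable\<close>)
qed

lemma rho_mult_L2:
  assumes "f \<in> L2 (nu T)" shows "(\<lambda>u. \<rho> u * f u) \<in> L2 (nu T)"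
proof -
  obtain C where C: "C \<ge> 0" "AE u in nu T. \<rho> u \<le> C" by (rule rho_bounded)
  show ?thesis
  proof (rule L2_bound[OF L2_cmult[OF assms, of C]])
    show "AE u in nu T. \<bar>\<rho> u * f u\<bar> \<le> \<bar>C * f u\<bar>"
      using C(2) by eventually_elim (use C(1) rho_nonneg in \<open>auto simp: abs_mult intro!: mult_right_mono\<close>)
  qed (use L2_measurable[OF assms] in \<open>auto intro!: borel_measurable_times borel_nu rho_measurable\<close>)
qed

lemma integral_rho:
  assumes "integrable (nu T) f"
  shows "(LINT u|nu T. \<rho> u * f u) = (LBINT u:{0..1}. w u * f u) + (\<Sum>j=1..J. m j * f (t j))"
proof -
  have [measurable]: "f \<in> borel_measurable borel"
    using borel_measurable_integrable[OF assms] by (simp add: measurable_cong_sets[OF sets_nu refl])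
  have "(LBINT u:{0..1}. \<rho> u * f u) = (LBINT u:{0..1}. w01 u * f u)"
    unfolding set_lebesgue_integral_def
    by (rule integral_cong_AE) (use rho_AE_w in \<open>auto elim!: eventually_mono simp: indicator_def\<close>)
  moreover have "(\<Sum>x\<in>T. \<rho> x * f x) = (\<Sum>j=1..J. m j * f (t j))"
    unfolding sum_T by (rule sum.cong) (auto simp: rho_atom)
  ultimately show ?thesis
    using integral_nu[OF finite_T rho_mult_integrable[OF assms]] set_integral_w01[of "\<lambda>u y. y * f u"] by simp
qed

lemma xi_hat_eq: "xi_hat J t \<xi> \<xi>s u = indicator (- T) u * \<xi> u + atoms \<xi>s u"
proof (cases "u \<in> T")
  case True
  then obtain j where j: "j \<in> {1..J}" "u = t j" by (auto simp: T)
  then show ?thesis using True inj by (simp add: xi_hat_def T atoms_at)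
next
  case False
  then show ?thesis unfolding xi_hat_def T[symmetric] by (simp add: atoms_off)
qed

lemma xi_hat_atom: "j \<in> {1..J} \<Longrightarrow> xi_hat J t \<xi> \<xi>s (t j) = \<xi>s j"
  unfolding xi_hat_eq by (auto simp: T atoms_at)

lemma xi_hat_off: "u \<notin> T \<Longrightarrow> xi_hat J t \<xi> \<xi>s u = \<xi> u"
  unfolding xi_hat_eq by (simp add: atoms_off)

lemma xi_hat_measurable: "\<xi> \<in> borel_measurable borel \<Longrightarrow> xi_hat J t \<xi> \<xi>s \<in> borel_measurable borel"
  unfolding xi_hat_eq[abs_def] using T_borel
  by (intro borel_measurable_add borel_measurable_times borel_measurable_indicator atoms_measurable) auto

end

section \<open>The moment constraints\<close>

definition unit_integral :: "(real \<Rightarrow> real) \<Rightarrow> real" where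
  "unit_integral f = (LBINT u:{0..1}. f u)"

lemma set_integrable_of_nu:
  fixes f :: "real \<Rightarrow> real"
  assumes "finite T" "integrable (nu T) f"
  shows "set_integrable lborel {0..1} f"
proof -
  have "f \<in> borel_measurable borel"
    using borel_measurable_integrable[OF assms(2)] by (simp add: measurable_cong_sets[OF sets_nu refl])
  then show ?thesis
    using assms integrable_nu_iff[of T f] by (simp add: set_integrable_def)
qed

context
  fixes T :: "real set"
  assumes fin: "finite T"
begin

lemma unit_integral_add: "integrable (nu T) f \<Longrightarrow> integrable (nu T) g \<Longrightarrow> unit_integral (\<lambda>u. f u + g u) = unit_integral f + unit_integral g"
  unfolding unit_integral_def by (intro set_integral_add set_integrable_of_nu[OF fin])

lemma unit_integral_diff: "integrable (nu T) f \<Longrightarrow> integrable (nu T) g \<Longrightarrow> unit_integral (\<lambda>u. f u - g u) = unit_integral f - unit_integral g"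
  unfolding unit_integral_def by (intro set_integral_diff set_integrable_of_nu[OF fin])

lemma unit_integral_le_integral_nu:
  assumes "integrable (nu T) f" "\<And>u. 0 \<le> f u"
  shows "unit_integral f \<le> (LINT u|nu T. f u)"
  using integral_nu[OF fin assms(1)] assms(2) by (simp add: unit_integral_def sum_nonneg)

lemma unit_integral_rho_0:
  assumes "integrable (nu T) f"
  shows "(LINT u|nu T. f u * rho_0 T u) = unit_integral f" "integrable (nu T) (\<lambda>u. f u * rho_0 T u)"
proof -
  have [measurable]: "f \<in> borel_measurable borel" "T \<in> sets borel"
    using borel_measurable_integrable[OF assms] fin
    by (auto simp: measurable_cong_sets[OF sets_nu refl] borel_closed finite_imp_closed)
  have "RN_deriv (nu T) N \<in> borel_measurable borel" for N
    using borel_measurable_RN_deriv[of "nu T" N] unfolding measurable_cong_sets[OF sets_nu refl] .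
  then have [measurable]: "rho_0 T \<in> borel_measurable borel"
    unfolding rho_0_def[abs_def] by measurable
  have i: "integrable (nu T) (\<lambda>u. indicator (- T) u * f u)"
    using integrable_mult_indicator[of "- T" "nu T" f] assms by simp
  have ae: "AE u in nu T. f u * rho_0 T u = indicator (- T) u * f u"
    using rho_0_AE[OF fin] by eventually_elim simp
  have "(LINT u|nu T. f u * rho_0 T u) = (LINT u|nu T. indicator (- T) u * f u)"
    using ae by (rule integral_cong_AE[rotated 2]) (auto intro!: borel_nu)
  also have "\<dots> = (LBINT u:{0..1}. indicator (- T) u * f u)"
    by (subst integral_nu[OF fin i]) (auto intro!: sum.neutral)
  also have "\<dots> = unit_integral f"
    unfolding unit_integral_def set_lebesgue_integral_def
  proof (rule integral_cong_AE)
    have "AE u in lborel. u \<notin> T" using fin by (intro AE_not_in finite_imp_null_set_lborel)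
    then show "AE u in lborel. indicator {0..1} u *\<^sub>R (indicator (- T) u * f u) = indicator {0..1} u *\<^sub>R f u"
      by eventually_elim simp
  qed auto
  finally show "(LINT u|nu T. f u * rho_0 T u) = unit_integral f" .
  show "integrable (nu T) (\<lambda>u. f u * rho_0 T u)"
    using i ae by (subst integrable_cong_AE) (auto intro!: borel_nu)
qed

end

lemma unit_integral_cmult: "unit_integral (\<lambda>u. c * f u) = c * unit_integral f"
  by (simp add: unit_integral_def)

lemma unit_integral_const: "unit_integral (\<lambda>u. c) = c"
  by (simp add: unit_integral_def set_lebesgue_integral_def)

lemma moment1_unit_integral: "moment1 = unit_integral" and moment2_unit_integral: "moment2 = (\<lambda>q. unit_integral (\<lambda>u. (q u)\<^sup>2))"
  by (auto simp: moment1_def moment2_def unit_integral_def fun_eq_iff)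

lemma L2_integrable_power2: "f \<in> L2 M \<Longrightarrow> integrable M (\<lambda>u. (f u)\<^sup>2)"
  by (simp add: L2_def)

text \<open>The second moment after an affine change about \<open>c\<close> and a perturbation by \<open>d\<close>; it serves both the
gradient of the second moment and the standardized curve.\<close>

lemma moment2_affine:
  assumes T: "finite T" and q: "q \<in> moment_set T \<mu> \<sigma>" and d: "d \<in> L2 (nu T)"
  shows "unit_integral (\<lambda>u. (c + s * (q u - c) + s' * d u)\<^sup>2) = (c + s * (\<mu> - c))\<^sup>2 + s\<^sup>2 * \<sigma>\<^sup>2
    + 2 * c * (1 - s) * s' * unit_integral d + 2 * s * s' * unit_integral (\<lambda>u. q u * d u) + s'\<^sup>2 * unit_integral (\<lambda>u. (d u)\<^sup>2)"
proof -
  have fm: "finite_measure (nu T)" by (rule finite_measure_nu[OF T])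
  have qL: "q \<in> L2 (nu T)" and m: "unit_integral q = \<mu>" "unit_integral (\<lambda>u. (q u)\<^sup>2) = \<mu>\<^sup>2 + \<sigma>\<^sup>2"
    using q by (auto simp: moment_set_def moment1_unit_integral moment2_unit_integral)
  note i = integrable_L2[OF fm qL] integrable_L2[OF fm d] L2_integrable_power2[OF qL] L2_integrable_power2[OF d]
    integrable_L2_mult[OF qL d]
  have "unit_integral (\<lambda>u. (c + s * (q u - c) + s' * d u)\<^sup>2) =
    unit_integral (\<lambda>u. (c * (1 - s))\<^sup>2 + (2 * c * (1 - s) * s) * q u + (2 * c * (1 - s) * s') * d u
      + s\<^sup>2 * (q u)\<^sup>2 + (2 * s * s') * (q u * d u) + s'\<^sup>2 * (d u)\<^sup>2)"
    by (rule arg_cong[where f=unit_integral]) (auto simp: power2_eq_square algebra_simps)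
  also have "\<dots> = (c * (1 - s))\<^sup>2 + (2 * c * (1 - s) * s) * \<mu> + (2 * c * (1 - s) * s') * unit_integral d
      + s\<^sup>2 * (\<mu>\<^sup>2 + \<sigma>\<^sup>2) + (2 * s * s') * unit_integral (\<lambda>u. q u * d u) + s'\<^sup>2 * unit_integral (\<lambda>u. (d u)\<^sup>2)"
    using i by (simp add: unit_integral_add[OF T] unit_integral_cmult unit_integral_const m finite_measure.integrable_const[OF fm])
  finally show ?thesis by (simp add: power2_eq_square algebra_simps)
qed

text \<open>If the variance vanishes then \<open>q = \<mu>\<close> almost everywhere on \<open>[0, 1]\<close>, and \<open>moment2 - 2 \<mu> moment1\<close> changes
by exactly the second moment of the increment. So its gradient \<open>D = g2 - 2 \<mu> g1\<close> is zero, which is a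
linear dependence.\<close>

lemma LICQ_imp_variance_nonzero:
  assumes T: "finite T" and q: "q \<in> moment_set T \<mu> \<sigma>" and licq: "LICQ T q"
  shows "\<sigma> \<noteq> 0"
proof
  assume s0: "\<sigma> = 0"
  have fm: "finite_measure (nu T)" by (rule finite_measure_nu[OF T])
  obtain g1 g2 where g: "has_L2_gradient (nu T) moment1 q g1" "has_L2_gradient (nu T) moment2 q g2"
    and li: "\<And>c1 c2. (AE u in nu T. c1 * g1 u + c2 * g2 u = 0) \<Longrightarrow> c1 = 0 \<and> c2 = 0"
    using licq unfolding LICQ_def by blast
  have gL: "g1 \<in> L2 (nu T)" "g2 \<in> L2 (nu T)" using g by (auto simp: has_L2_gradient_def)
  have qL: "q \<in> L2 (nu T)" and m: "unit_integral q = \<mu>" using q by (auto simp: moment_set_def moment1_unit_integral)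
  define D where "D u = g2 u - (2 * \<mu>) * g1 u" for u
  have DL: "D \<in> L2 (nu T)" unfolding D_def[abs_def] by (intro L2_diff L2_cmult gL)
  define N where "N = L2_norm (nu T) D"
  have N2: "N\<^sup>2 = (LINT u|nu T. (D u)\<^sup>2)" unfolding N_def by (rule L2_norm_square)
  have N0: "N \<ge> 0" unfolding N_def L2_norm_def by (simp add: L2_inner_def)
  have qmL: "(\<lambda>u. q u - \<mu>) \<in> L2 (nu T)" by (intro L2_diff qL L2_const fm)
  have "unit_integral (\<lambda>u. (q u - \<mu>)\<^sup>2) = unit_integral (\<lambda>u. ((q u)\<^sup>2 - (2 * \<mu>) * q u) + \<mu>\<^sup>2)"
    by (rule arg_cong[where f=unit_integral]) (auto simp: power2_eq_square algebra_simps)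
  also have "\<dots> = 0"
    using q s0 L2_integrable_power2[OF qL] integrable_L2[OF fm qL]
    by (simp add: finite_measure.integrable_const[OF fm] unit_integral_add[OF T] unit_integral_diff[OF T] unit_integral_cmult unit_integral_const moment_set_def moment1_unit_integral moment2_unit_integral power2_eq_square)
  finally have v0: "unit_integral (\<lambda>u. (q u - \<mu>)\<^sup>2) = 0" .
  have "AE u in lborel. indicator {0..1} u * (q u - \<mu>)\<^sup>2 = 0"
    using v0 set_integrable_of_nu[OF T L2_integrable_power2[OF qmL]]
    unfolding unit_integral_def set_lebesgue_integral_def set_integrable_def
    by (subst (asm) integral_nonneg_eq_0_iff_AE) auto
  then have q\<mu>: "AE u in lborel. u \<in> {0..1} \<longrightarrow> q u = \<mu>"
    by eventually_elim (auto simp: indicator_def split: if_splits)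
  have cross: "unit_integral (\<lambda>u. q u * h u) = \<mu> * unit_integral h" if h: "h \<in> L2 (nu T)" for h
    unfolding unit_integral_cmult[symmetric] unfolding unit_integral_def set_lebesgue_integral_def
    by (rule integral_cong_AE) (use q\<mu> L2_nu_borel[OF qL] L2_nu_borel[OF h] in \<open>auto elim!: eventually_mono simp: indicator_def\<close>)
  have "N = 0"
  proof (rule ccontr)
    assume "N \<noteq> 0"
    then have Np: "N > 0" using N0 by simp
    \<comment> \<open>makes the combined gradient error for \<open>h = s D\<close> at most \<open>s N\<^sup>2 / 4\<close>; with \<open>s \<le> 1/2\<close> the quadratic term is at most \<open>s N\<^sup>2 / 2\<close>\<close>
    define \<epsilon> where "\<epsilon> = N / (4 * (1 + 2 * \<bar>\<mu>\<bar>))"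
    have e: "\<epsilon> > 0" using Np by (simp add: \<epsilon>_def add_pos_nonneg)
    obtain d1 where d1: "d1 > 0" "\<And>h. h \<in> L2 (nu T) \<Longrightarrow> L2_norm (nu T) h < d1 \<Longrightarrow>
        \<bar>moment1 (\<lambda>u. q u + h u) - moment1 q - L2_inner (nu T) g1 h\<bar> \<le> \<epsilon> * L2_norm (nu T) h"
      using g(1) e unfolding has_L2_gradient_def by blast
    obtain d2 where d2: "d2 > 0" "\<And>h. h \<in> L2 (nu T) \<Longrightarrow> L2_norm (nu T) h < d2 \<Longrightarrow>
        \<bar>moment2 (\<lambda>u. q u + h u) - moment2 q - L2_inner (nu T) g2 h\<bar> \<le> \<epsilon> * L2_norm (nu T) h"
      using g(2) e unfolding has_L2_gradient_def by blast
    define s where "s = min (1/2) (min d1 d2 / (2 * N))"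
    have s: "s > 0" "s \<le> 1/2" using d1(1) d2(1) Np by (auto simp: s_def)
    have "s * N \<le> min d1 d2 / (2 * N) * N" using Np by (intro mult_right_mono) (auto simp: s_def)
    then have sN: "s * N < d1" "s * N < d2" using Np d1(1) d2(1) by (auto simp: field_simps min_def split: if_splits)
    define h where "h u = s * D u" for u
    have hL: "h \<in> L2 (nu T)" unfolding h_def[abs_def] by (rule L2_cmult[OF DL])
    have "(L2_norm (nu T) h)\<^sup>2 = (s * N)\<^sup>2"
      unfolding L2_norm_square by (simp add: h_def power_mult_distrib N2)
    then have hN: "L2_norm (nu T) h = s * N"
      using s Np by (subst (asm) power2_eq_iff_nonneg) (auto simp: L2_norm_def L2_inner_def)
    have e1: "moment1 (\<lambda>u. q u + h u) - moment1 q = unit_integral h"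
      unfolding moment1_unit_integral using integrable_L2[OF fm qL] integrable_L2[OF fm hL] by (simp add: unit_integral_add[OF T])
    have e2: "moment2 (\<lambda>u. q u + h u) - moment2 q = 2 * \<mu> * unit_integral h + unit_integral (\<lambda>u. (h u)\<^sup>2)"
      using moment2_affine[OF T q hL, of 0 1 1] moment2_affine[OF T q hL, of 0 1 0] cross[OF hL]
      by (simp add: moment2_unit_integral)
    have ip: "L2_inner (nu T) g2 h - 2 * \<mu> * L2_inner (nu T) g1 h = s * N\<^sup>2"
    proof -
      have "L2_inner (nu T) g2 h - 2 * \<mu> * L2_inner (nu T) g1 h = (LINT u|nu T. g2 u * h u - 2 * \<mu> * (g1 u * h u))"
        unfolding L2_inner_def using integrable_L2_mult[OF gL(1) hL] integrable_L2_mult[OF gL(2) hL] by simp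
      also have "\<dots> = (LINT u|nu T. s * (D u)\<^sup>2)"
        by (rule Bochner_Integration.integral_cong) (auto simp: D_def h_def power2_eq_square algebra_simps)
      finally show ?thesis by (simp add: N2)
    qed
    have a1: "\<bar>unit_integral h - L2_inner (nu T) g1 h\<bar> \<le> \<epsilon> * (s * N)" using d1(2)[OF hL] sN(1) hN e1 by simp
    have a2: "\<bar>2 * \<mu> * unit_integral h + unit_integral (\<lambda>u. (h u)\<^sup>2) - L2_inner (nu T) g2 h\<bar> \<le> \<epsilon> * (s * N)"
      using d2(2)[OF hL] sN(2) hN e2 by simp
    have "\<bar>2 * \<mu> * (unit_integral h - L2_inner (nu T) g1 h)\<bar> \<le> 2 * \<bar>\<mu>\<bar> * (\<epsilon> * (s * N))"
      using mult_left_mono[OF a1, of "2 * \<bar>\<mu>\<bar>"] by (simp add: abs_mult)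
    moreover have "unit_integral (\<lambda>u. (h u)\<^sup>2) \<le> s\<^sup>2 * N\<^sup>2"
      using unit_integral_le_integral_nu[OF T L2_integrable_power2[OF hL]] by (simp add: h_def power_mult_distrib N2)
    ultimately have "s * N\<^sup>2 \<le> s\<^sup>2 * N\<^sup>2 + (1 + 2 * \<bar>\<mu>\<bar>) * (\<epsilon> * (s * N))"
      using a2 ip by (simp add: algebra_simps abs_le_iff)
    also have "(1 + 2 * \<bar>\<mu>\<bar>) * (\<epsilon> * (s * N)) = s * N\<^sup>2 / 4"
    proof -
      have "1 + 2 * \<bar>\<mu>\<bar> \<noteq> 0" by linarith
      then have "(1 + 2 * \<bar>\<mu>\<bar>) * \<epsilon> = N / 4" unfolding \<epsilon>_def by (simp add: field_simps)
      then have "(1 + 2 * \<bar>\<mu>\<bar>) * \<epsilon> * (s * N) = N / 4 * (s * N)" by simp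
      then show ?thesis by (simp add: power2_eq_square mult_ac)
    qed
    also have "s\<^sup>2 * N\<^sup>2 \<le> (s / 2) * N\<^sup>2"
      using s by (intro mult_right_mono) (auto simp: power2_eq_square)
    finally have "s * N\<^sup>2 \<le> s / 2 * N\<^sup>2 + s * N\<^sup>2 / 4" by simp
    moreover have "s * N\<^sup>2 > 0" using s Np by simp
    ultimately show False by (simp add: field_simps)
  qed
  then have "AE u in nu T. (D u)\<^sup>2 = 0"
    using N2 L2_integrable_power2[OF DL] by (simp add: integral_nonneg_eq_0_iff_AE)
  then have "AE u in nu T. (- 2 * \<mu>) * g1 u + 1 * g2 u = 0"
    by eventually_elim (simp add: D_def)
  from li[OF this] show False by simp
qed

section \<open>First-order condition\<close>

locale moment_constrained_minimizer = distortion_atoms J t m T \<phi> w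
  for J :: nat and t m :: "nat \<Rightarrow> real" and T :: "real set" and \<phi> w :: "real \<Rightarrow> real" +
  fixes \<mu> \<sigma> a b :: real and U qs :: "real \<Rightarrow> real"
  assumes \<sigma>_nonneg: "\<sigma> \<ge> 0" and U_mono: "mono U"
    and U_lip: "local_lipschitz (UNIV :: real set) UNIV (\<lambda>_. U)"
    and a_nonneg: "a \<ge> 0" and b_nonneg: "b \<ge> 0"
    and U_growth: "\<forall>x. \<forall>\<zeta>\<in>clarke_subdiff U x. \<bar>\<zeta>\<bar> \<le> a + b * \<bar>x\<bar>"
    and qs: "qs \<in> mono_cone T \<inter> moment_set T \<mu> \<sigma>"
    and licq: "LICQ T qs"
    and local_min: "L2_local_min (nu T) (Psi J t m w U) (mono_cone T \<inter> moment_set T \<mu> \<sigma>) qs"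
begin

lemma finite_nu: "finite_measure (nu T)"
  by (rule finite_measure_nu[OF finite_T])

lemma qs_cone: "qs \<in> mono_cone T" and qs_moment: "qs \<in> moment_set T \<mu> \<sigma>"
  using qs by auto

lemma qs_L2: "qs \<in> L2 (nu T)"
  by (rule mono_cone_L2[OF qs_cone])

lemma qs_borel[measurable]: "qs \<in> borel_measurable borel"
  by (rule L2_nu_borel[OF qs_L2])

lemma qs_moments: "unit_integral qs = \<mu>" "unit_integral (\<lambda>u. (qs u)\<^sup>2) = \<mu>\<^sup>2 + \<sigma>\<^sup>2"
  using qs_moment by (auto simp: moment_set_def moment1_unit_integral moment2_unit_integral)

lemma \<sigma>_pos: "\<sigma> > 0"
  using LICQ_imp_variance_nonzero[OF finite_T qs_moment licq] \<sigma>_nonneg by simp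

lemma U_borel[measurable]: "U \<in> borel_measurable borel"
  by (rule borel_measurable_mono[OF U_mono])

lemma growth_bound_integrable:
  assumes "f \<in> L2 (nu T)" "g \<in> L2 (nu T)"
  shows "integrable (nu T) (\<lambda>u. (a + b * (\<bar>f u\<bar> + \<bar>g u\<bar>)) * \<bar>g u\<bar>)"
  using assms by (intro integrable_L2_mult L2_add L2_cmult L2_abs L2_const finite_nu)

lemma U_integrable:
  assumes "q \<in> L2 (nu T)" shows "integrable (nu T) (\<lambda>u. U (q u))"
proof (rule Bochner_Integration.integrable_bound)
  note [measurable] = L2_nu_borel[OF assms]
  show "integrable (nu T) (\<lambda>u. \<bar>U 0\<bar> + (a + b * (\<bar>0\<bar> + \<bar>q u\<bar>)) * \<bar>q u\<bar>)"
    using growth_bound_integrable[OF L2_const[OF finite_nu, of 0] assms]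
      finite_measure.integrable_const[OF finite_nu] by (intro Bochner_Integration.integrable_add) auto
  have "\<bar>U (q u)\<bar> \<le> \<bar>U 0\<bar> + (a + b * (\<bar>0\<bar> + \<bar>q u\<bar>)) * \<bar>q u\<bar>" for u
    using mono_clarke_growth_increment[OF U_lip U_mono a_nonneg b_nonneg U_growth, of 0 "q u"] by simp
  then show "AE u in nu T. norm (U (q u)) \<le> norm (\<bar>U 0\<bar> + (a + b * (\<bar>0\<bar> + \<bar>q u\<bar>)) * \<bar>q u\<bar>)"
    by (intro AE_I2) (simp add: order_trans[OF _ abs_ge_self])
  show "(\<lambda>u. U (q u)) \<in> borel_measurable (nu T)" by (intro borel_nu) measurable
qed

lemma Psi_eq: "q \<in> L2 (nu T) \<Longrightarrow> Psi J t m w U q = (LINT u|nu T. \<rho> u * U (q u))"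
  using integral_rho[OF U_integrable] by (simp add: Psi_def)

text \<open>Midpoint and radius of the subdifferential interval at \<open>qs u\<close>, so that Clarke's derivative in direction \<open>y\<close>
is \<open>mid u * y + rad u * \<bar>y\<bar>\<close>.\<close>

definition mid :: "real \<Rightarrow> real" where
  "mid u = (clarke_dir U (qs u) 1 - clarke_dir U (qs u) (-1)) / 2"

definition rad :: "real \<Rightarrow> real" where
  "rad u = (clarke_dir U (qs u) 1 + clarke_dir U (qs u) (-1)) / 2"

lemma rad_nonneg: "0 \<le> rad u"
  using clarke_dir_opposite[OF U_lip, of "qs u"] by (simp add: rad_def)

lemma mid_rad_max: "max (clarke_dir U (qs u) 1 * y) (- clarke_dir U (qs u) (-1) * y) = mid u * y + rad u * \<bar>y\<bar>"
proof -
  let ?p = "clarke_dir U (qs u) 1" and ?n = "clarke_dir U (qs u) (-1)"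
  have "?p * y - (- ?n * y) = 2 * rad u * y" by (simp add: rad_def algebra_simps)
  moreover have "0 \<le> rad u * \<bar>y\<bar>" using rad_nonneg[of u] by simp
  ultimately show ?thesis
    by (cases "y \<ge> 0") (auto simp: max_def mid_def rad_def field_simps)
qed

lemma clarke_dir_qs_bound:
  "\<bar>clarke_dir U (qs u) 1\<bar> \<le> a + b * \<bar>qs u\<bar>" "\<bar>clarke_dir U (qs u) (-1)\<bar> \<le> a + b * \<bar>qs u\<bar>"
  using clarke_dir_bound[OF U_lip] U_growth by blast+

lemma qs_growth_L2: "(\<lambda>u. a + b * \<bar>qs u\<bar>) \<in> L2 (nu T)"
  by (intro L2_add L2_cmult L2_abs L2_const finite_nu qs_L2)

lemma clarke_dir_qs_borel[measurable]: "(\<lambda>u. clarke_dir U (qs u) h) \<in> borel_measurable borel"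
  by (rule measurable_compose[OF qs_borel clarke_dir_measurable[OF U_lip]])

lemma mid_borel[measurable]: "mid \<in> borel_measurable borel"
  and rad_borel[measurable]: "rad \<in> borel_measurable borel"
  unfolding mid_def[abs_def] rad_def[abs_def] by measurable

lemma mid_L2: "mid \<in> L2 (nu T)" and rad_L2: "rad \<in> L2 (nu T)"
proof -
  have "\<bar>mid u\<bar> \<le> a + b * \<bar>qs u\<bar>" "\<bar>rad u\<bar> \<le> a + b * \<bar>qs u\<bar>" for u
    using clarke_dir_qs_bound[of u] unfolding mid_def rad_def by (auto simp: abs_le_iff field_simps)
  then have "\<bar>mid u\<bar> \<le> \<bar>a + b * \<bar>qs u\<bar>\<bar>" "\<bar>rad u\<bar> \<le> \<bar>a + b * \<bar>qs u\<bar>\<bar>" for u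
    by (meson order_trans abs_ge_self)+
  then show "mid \<in> L2 (nu T)" "rad \<in> L2 (nu T)"
    by (auto intro!: L2_bound[OF qs_growth_L2] borel_nu)
qed

text \<open>Directions from \<open>qs\<close> into the cone along which both moments have derivative zero.\<close>

definition feasible_dirs :: "(real \<Rightarrow> real) set" where
  "feasible_dirs = {d \<in> L2 (nu T). unit_integral d = 0 \<and> unit_integral (\<lambda>u. qs u * d u) = 0 \<and>
     (\<exists>s>0. (\<lambda>u. qs u + s * d u) \<in> mono_cone T)}"

text \<open>The curve is \<open>\<mu> + \<kappa> (qs + s d - \<mu>)\<close>. For \<open>d\<close> in \<open>feasible_dirs\<close> the function \<open>qs + s d\<close> still has mean
\<open>\<mu>\<close> and has variance \<open>\<sigma>\<^sup>2 + s\<^sup>2 D\<close>, where \<open>D\<close> is the second moment of \<open>d\<close>. The factor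
\<open>\<kappa> = \<sigma> / sqrt (\<sigma>\<^sup>2 + s\<^sup>2 D)\<close> restores the variance, differs from \<open>1\<close> by \<open>O(s\<^sup>2)\<close>, and as it is positive it
preserves monotonicity.\<close>

lemma feasible_curve:
  assumes d: "d \<in> feasible_dirs"
  obtains G e s0 where "G \<in> L2 (nu T)" "s0 > 0"
    "\<And>s. 0 < s \<Longrightarrow> s < s0 \<Longrightarrow> (\<lambda>u. qs u + s * e s u) \<in> mono_cone T \<inter> moment_set T \<mu> \<sigma>"
    "\<And>s u. 0 < s \<Longrightarrow> s < s0 \<Longrightarrow> \<bar>e s u\<bar> \<le> G u"
    "\<And>u. ((\<lambda>s. e s u) \<longlongrightarrow> d u) (at_right 0)"
    "\<And>s. e s \<in> borel_measurable borel"
proof -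
  have dL: "d \<in> L2 (nu T)" and d0: "unit_integral d = 0" "unit_integral (\<lambda>u. qs u * d u) = 0"
    using d by (auto simp: feasible_dirs_def)
  obtain s1 where s1: "s1 > 0" "(\<lambda>u. qs u + s1 * d u) \<in> mono_cone T"
    using d by (auto simp: feasible_dirs_def)
  define D where "D = unit_integral (\<lambda>u. (d u)\<^sup>2)"
  have D0: "D \<ge> 0" unfolding D_def unit_integral_def set_lebesgue_integral_def by simp
  define \<kappa> where "\<kappa> s = \<sigma> / sqrt (\<sigma>\<^sup>2 + s\<^sup>2 * D)" for s
  have den: "\<sigma>\<^sup>2 + s\<^sup>2 * D > 0" for s using \<sigma>_pos D0 by (simp add: add_pos_nonneg)
  have \<kappa>0: "\<kappa> s > 0" for s unfolding \<kappa>_def using \<sigma>_pos den[of s] by simp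
  have \<kappa>2: "(\<kappa> s)\<^sup>2 * (\<sigma>\<^sup>2 + s\<^sup>2 * D) = \<sigma>\<^sup>2" for s
    unfolding \<kappa>_def using den[of s] by (simp add: power_divide)
  have \<kappa>1: "\<kappa> s \<le> 1" for s
  proof -
    have "\<sigma> \<le> sqrt (\<sigma>\<^sup>2 + s\<^sup>2 * D)" using D0 by (intro real_le_rsqrt) auto
    then show ?thesis unfolding \<kappa>_def using den[of s] by simp
  qed
  have \<kappa>lin: "1 - \<kappa> s \<le> s\<^sup>2 * D / \<sigma>\<^sup>2" for s
  proof -
    have "\<kappa> s * \<kappa> s \<le> \<kappa> s" using \<kappa>0[of s] \<kappa>1[of s] by (intro mult_left_le) auto
    then have "1 - \<kappa> s \<le> 1 - (\<kappa> s)\<^sup>2" by (simp add: power2_eq_square)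
    also have "\<dots> = (\<kappa> s)\<^sup>2 * s\<^sup>2 * D / \<sigma>\<^sup>2" using \<kappa>2[of s] \<sigma>_pos by (simp add: field_simps)
    also have "\<dots> \<le> 1 * s\<^sup>2 * D / \<sigma>\<^sup>2"
      using \<kappa>0[of s] \<kappa>1[of s] D0 by (intro divide_right_mono mult_right_mono) (auto simp: power_le_one)
    finally show ?thesis by simp
  qed
  define e where "e s u = \<kappa> s * d u - ((1 - \<kappa> s) / s) * (qs u - \<mu>)" for s u
  define G where "G u = \<bar>d u\<bar> + (D / \<sigma>\<^sup>2) * \<bar>qs u - \<mu>\<bar>" for u
  define s0 where "s0 = min s1 1"
  have curve: "qs u + s * e s u = \<mu> + \<kappa> s * (qs u - \<mu>) + (\<kappa> s * s) * d u" if "s > 0" for s u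
    using that by (simp add: e_def field_simps)
  show thesis
  proof (rule that[of G s0 e])
    show "G \<in> L2 (nu T)"
      unfolding G_def[abs_def] by (intro L2_add L2_abs L2_cmult L2_diff dL qs_L2 L2_const finite_nu)
    show "s0 > 0" using s1 by (simp add: s0_def)
    show "e s \<in> borel_measurable borel" for s
      unfolding e_def[abs_def] using L2_nu_borel[OF dL] by measurable
    fix s :: real assume s: "0 < s" "s < s0"
    then have ss: "s < s1" "s < 1" by (auto simp: s0_def)
    show "\<bar>e s u\<bar> \<le> G u" for u
    proof -
      have k: "0 \<le> (1 - \<kappa> s) / s" using \<kappa>1[of s] s by simp
      have "(1 - \<kappa> s) / s \<le> s * (D / \<sigma>\<^sup>2)"
        using \<kappa>lin[of s] s by (simp add: pos_divide_le_eq power2_eq_square mult_ac)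
      also have "\<dots> \<le> 1 * (D / \<sigma>\<^sup>2)" using ss D0 by (intro mult_right_mono) auto
      finally have k2: "(1 - \<kappa> s) / s \<le> D / \<sigma>\<^sup>2" by simp
      have "\<bar>e s u\<bar> \<le> \<kappa> s * \<bar>d u\<bar> + ((1 - \<kappa> s) / s) * \<bar>qs u - \<mu>\<bar>"
        unfolding e_def using abs_triangle_ineq4[of "\<kappa> s * d u" "((1 - \<kappa> s) / s) * (qs u - \<mu>)"]
        unfolding abs_mult abs_of_nonneg[OF k] abs_of_pos[OF \<kappa>0[of s]] .
      also have "\<dots> \<le> 1 * \<bar>d u\<bar> + (D / \<sigma>\<^sup>2) * \<bar>qs u - \<mu>\<bar>"
        using \<kappa>1[of s] k2 by (intro add_mono mult_right_mono) auto
      finally show ?thesis by (simp add: G_def)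
    qed
    have cone: "(\<lambda>u. qs u + s * e s u) \<in> mono_cone T"
    proof -
      have "(\<lambda>u. \<mu> * (1 - \<kappa> s) + (\<kappa> s * (1 - s / s1)) * qs u + (\<kappa> s * (s / s1)) * (qs u + s1 * d u)) \<in> mono_cone T"
        using \<kappa>0[of s] s ss s1(1) by (intro mono_cone_affine finite_T qs_cone s1(2)) auto
      moreover have "\<mu> * (1 - \<kappa> s) + (\<kappa> s * (1 - s / s1)) * qs u + (\<kappa> s * (s / s1)) * (qs u + s1 * d u) = qs u + s * e s u" for u
        unfolding curve[OF s(1)] using s1(1) by (simp add: field_simps)
      ultimately show ?thesis by simp
    qed
    have "unit_integral (\<lambda>u. qs u + s * e s u) = unit_integral (\<lambda>u. \<mu> * (1 - \<kappa> s) + \<kappa> s * qs u + (\<kappa> s * s) * d u)"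
      unfolding curve[OF s(1)] by (rule arg_cong[where f=unit_integral]) (auto simp: algebra_simps)
    also have "\<dots> = \<mu> * (1 - \<kappa> s) + \<kappa> s * \<mu>"
      using integrable_L2[OF finite_nu qs_L2] integrable_L2[OF finite_nu dL]
      by (simp add: finite_measure.integrable_const[OF finite_nu] unit_integral_add[OF finite_T] unit_integral_cmult unit_integral_const qs_moments d0)
    also have "\<dots> = \<mu>" by (simp add: algebra_simps)
    finally have "unit_integral (\<lambda>u. qs u + s * e s u) = \<mu>" .
    moreover have "unit_integral (\<lambda>u. (qs u + s * e s u)\<^sup>2) = \<mu>\<^sup>2 + \<sigma>\<^sup>2"
    proof -
      have "unit_integral (\<lambda>u. (qs u + s * e s u)\<^sup>2) = \<mu>\<^sup>2 + (\<kappa> s)\<^sup>2 * \<sigma>\<^sup>2 + (\<kappa> s * s)\<^sup>2 * D"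
        unfolding curve[OF s(1)] using moment2_affine[OF finite_T qs_moment dL, of \<mu> "\<kappa> s" "\<kappa> s * s"] d0 D_def by simp
      also have "\<dots> = \<mu>\<^sup>2 + (\<kappa> s)\<^sup>2 * (\<sigma>\<^sup>2 + s\<^sup>2 * D)" by (simp add: power_mult_distrib algebra_simps)
      finally show ?thesis unfolding \<kappa>2 .
    qed
    ultimately show "(\<lambda>u. qs u + s * e s u) \<in> mono_cone T \<inter> moment_set T \<mu> \<sigma>"
      using cone mono_cone_L2[OF cone] by (simp add: moment_set_def moment1_unit_integral moment2_unit_integral)
  next
    fix u
    have "((\<lambda>s. s * D / \<sigma>\<^sup>2) \<longlongrightarrow> 0 * D / \<sigma>\<^sup>2) (at_right 0)"
      by (intro tendsto_intros) (use \<sigma>_pos in auto)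
    then have lim0: "((\<lambda>s. s * D / \<sigma>\<^sup>2) \<longlongrightarrow> 0) (at_right 0)" by simp
    have pos: "\<forall>\<^sub>F s::real in at_right 0. 0 < s" by (rule eventually_at_right_less)
    have k0: "((\<lambda>s. (1 - \<kappa> s) / s) \<longlongrightarrow> 0) (at_right 0)"
    proof (rule tendsto_sandwich[OF _ _ tendsto_const lim0])
      show "\<forall>\<^sub>F s in at_right 0. 0 \<le> (1 - \<kappa> s) / s"
        using pos by eventually_elim (use \<kappa>1 in simp)
      show "\<forall>\<^sub>F s in at_right 0. (1 - \<kappa> s) / s \<le> s * D / \<sigma>\<^sup>2"
        using pos
      proof eventually_elim
        case (elim s)
        then show ?case using \<kappa>lin[of s] by (simp add: pos_divide_le_eq power2_eq_square mult_ac)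
      qed
    qed
    have "(\<kappa> \<longlongrightarrow> \<sigma> / sqrt (\<sigma>\<^sup>2 + 0\<^sup>2 * D)) (at_right 0)"
      unfolding \<kappa>_def[abs_def] by (intro tendsto_intros) (use \<sigma>_pos in auto)
    then have k1: "(\<kappa> \<longlongrightarrow> 1) (at_right 0)" using \<sigma>_pos by simp
    have "((\<lambda>s. \<kappa> s * d u - ((1 - \<kappa> s) / s) * (qs u - \<mu>)) \<longlongrightarrow> 1 * d u - 0 * (qs u - \<mu>)) (at_right 0)"
      by (intro tendsto_intros k0 k1)
    then show "((\<lambda>s. e s u) \<longlongrightarrow> d u) (at_right 0)" by (simp add: e_def)
  qed
qed

text \<open>Difference quotients of the objective along the feasible curve are nonnegative, and they are dominated
because the curve has a square-integrable speed bound \<open>G\<close> and \<open>U\<close> has increments of quadratic growth.\<close>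

lemma directional_nonneg:
  assumes d: "d \<in> feasible_dirs"
  shows "0 \<le> (LINT u|nu T. \<rho> u * (mid u * d u + rad u * \<bar>d u\<bar>))"
proof -
  have dL: "d \<in> L2 (nu T)" using d by (simp add: feasible_dirs_def)
  obtain G e s0 where G: "G \<in> L2 (nu T)" and s0: "s0 > 0"
    and S: "\<And>s. 0 < s \<Longrightarrow> s < s0 \<Longrightarrow> (\<lambda>u. qs u + s * e s u) \<in> mono_cone T \<inter> moment_set T \<mu> \<sigma>"
    and eG: "\<And>s u. 0 < s \<Longrightarrow> s < s0 \<Longrightarrow> \<bar>e s u\<bar> \<le> G u"
    and elim: "\<And>u. ((\<lambda>s. e s u) \<longlongrightarrow> d u) (at_right 0)"
    and em: "\<And>s. e s \<in> borel_measurable borel"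
    by (rule feasible_curve[OF d]) (rule that)
  note [measurable] = L2_nu_borel[OF dL] L2_nu_borel[OF G] em
  have eL: "e s \<in> L2 (nu T)" if "0 < s" "s < s0" for s
    by (rule L2_bound[OF G]) (use eG[OF that] in \<open>auto intro!: borel_nu AE_I2 intro: order_trans[OF _ abs_ge_self]\<close>)
  obtain \<epsilon> where \<epsilon>: "\<epsilon> > 0" "\<And>h. h \<in> mono_cone T \<inter> moment_set T \<mu> \<sigma> \<Longrightarrow>
      L2_norm (nu T) (\<lambda>u. h u - qs u) < \<epsilon> \<Longrightarrow> Psi J t m w U qs \<le> Psi J t m w U h"
    using local_min unfolding L2_local_min_def by blast
  define K where "K = L2_norm (nu T) G"
  have K0: "K \<ge> 0" by (simp add: K_def L2_norm_def L2_inner_def)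
  \<comment> \<open>keeps the curve inside the ball of local minimality; \<open>s1 \<le> 1\<close> lets \<open>G\<close> also bound the displacement\<close>
  define s1 where "s1 = min (min s0 1) (\<epsilon> / (1 + K)) / 2"
  have s1: "s1 > 0" "s1 < s0" "s1 * K < \<epsilon>" "s1 \<le> 1"
  proof -
    have "\<epsilon> / (1 + K) > 0" using \<epsilon>(1) K0 by simp
    then show "s1 > 0" "s1 < s0" "s1 \<le> 1" using s0 by (auto simp: s1_def)
    have "s1 * (1 + K) \<le> \<epsilon> / (1 + K) / 2 * (1 + K)"
      unfolding s1_def using K0 by (intro mult_right_mono divide_right_mono min.cobounded2) auto
    also have "\<dots> = \<epsilon> / 2" using K0 by (simp add: field_simps)
    also have "\<dots> < \<epsilon>" using \<epsilon>(1) by simp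
    finally have "s1 * (1 + K) < \<epsilon>" .
    then show "s1 * K < \<epsilon>" using \<open>s1 > 0\<close> by (simp add: algebra_simps)
  qed
  define s where "s n = s1 / real (Suc n)" for n
  have s: "0 < s n" "s n \<le> s1" "s n < s0" for n
  proof -
    show "0 < s n" using s1 by (simp add: s_def)
    show "s n \<le> s1" using s1(1) by (simp add: s_def divide_le_eq)
    then show "s n < s0" using s1(2) by simp
  qed
  have s_lim: "s \<longlonglongrightarrow> 0"
    unfolding s_def using tendsto_mult[OF tendsto_const LIMSEQ_inverse_real_of_nat, of s1]
    by (simp add: divide_inverse)
  have s_right: "filterlim s (at_right 0) sequentially"
    using s_lim s(1) less_imp_neq[OF s(1), THEN not_sym] by (simp add: filterlim_at)
  define X where "X n u = (U (qs u + s n * e (s n) u) - U (qs u)) / s n" for n u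
  define Y where "Y u = mid u * d u + rad u * \<bar>d u\<bar>" for u
  define W where "W u = (a + b * (\<bar>qs u\<bar> + \<bar>G u\<bar>)) * \<bar>G u\<bar>" for u
  have Wi: "integrable (nu T) W" unfolding W_def[abs_def] by (rule growth_bound_integrable[OF qs_L2 G])
  have Yi: "integrable (nu T) Y"
    unfolding Y_def[abs_def]
    by (intro Bochner_Integration.integrable_add integrable_L2_mult mid_L2 rad_L2 L2_abs dL)
  have [measurable]: "X n \<in> borel_measurable borel" "Y \<in> borel_measurable borel" "W \<in> borel_measurable borel" for n
    unfolding X_def[abs_def] Y_def[abs_def] W_def[abs_def] by measurable
  have XW: "\<bar>X n u\<bar> \<le> W u" for n u
  proof -
    have eg: "\<bar>e (s n) u\<bar> \<le> \<bar>G u\<bar>" using eG[OF s(1,3), of n u] by linarith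
    have "s n \<le> 1" using s(2) s1(4) by (rule order_trans)
    then have "s n * \<bar>e (s n) u\<bar> \<le> 1 * \<bar>G u\<bar>" using eg s(1)[of n] by (intro mult_mono) auto
    then have se: "\<bar>s n * e (s n) u\<bar> \<le> \<bar>G u\<bar>" using s(1)[of n] by (simp add: abs_mult)
    have se': "\<bar>s n * e (s n) u\<bar> \<le> s n * \<bar>G u\<bar>" using eg s(1)[of n] by (simp add: abs_mult)
    have "\<bar>U (qs u + s n * e (s n) u) - U (qs u)\<bar> \<le> (a + b * (\<bar>qs u\<bar> + \<bar>s n * e (s n) u\<bar>)) * \<bar>s n * e (s n) u\<bar>"
      by (rule mono_clarke_growth_increment[OF U_lip U_mono a_nonneg b_nonneg U_growth])
    also have "\<dots> \<le> (a + b * (\<bar>qs u\<bar> + \<bar>G u\<bar>)) * (s n * \<bar>G u\<bar>)"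
      using se se' a_nonneg b_nonneg by (intro mult_mono add_left_mono mult_left_mono) auto
    finally show ?thesis
      unfolding X_def W_def using s(1)[of n] by (simp add: pos_divide_le_eq mult_ac)
  qed
  have X0: "0 \<le> (LINT u|nu T. \<rho> u * X n u)" for n
  proof -
    let ?q = "\<lambda>u. qs u + s n * e (s n) u"
    have q: "?q \<in> mono_cone T \<inter> moment_set T \<mu> \<sigma>" by (rule S[OF s(1,3)])
    have qL: "?q \<in> L2 (nu T)" using q mono_cone_L2 by blast
    have "(L2_norm (nu T) (\<lambda>u. ?q u - qs u))\<^sup>2 \<le> (s n * K)\<^sup>2"
    proof -
      have "(LINT u|nu T. (s n * e (s n) u)\<^sup>2) \<le> (LINT u|nu T. (s n * G u)\<^sup>2)"
      proof (rule integral_mono)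
        show "(s n * e (s n) u)\<^sup>2 \<le> (s n * G u)\<^sup>2" for u
          using eG[OF s(1,3), of n u] s(1)[of n] by (auto simp: power_mult_distrib intro!: mult_left_mono abs_le_square_iff[THEN iffD1])
      qed (use L2_integrable_power2[OF L2_cmult[OF eL[OF s(1,3)]]] L2_integrable_power2[OF L2_cmult[OF G]] in auto)
      then show ?thesis by (simp add: L2_norm_square K_def power_mult_distrib)
    qed
    then have "L2_norm (nu T) (\<lambda>u. ?q u - qs u) \<le> s n * K"
      by (rule power2_le_imp_le) (use s(1)[of n] K0 in simp)
    also have "\<dots> \<le> s1 * K" using s(2) K0 by (rule mult_right_mono)
    finally have "Psi J t m w U qs \<le> Psi J t m w U ?q" using \<epsilon>(2)[OF q] s1(3) by simp
    then have "0 \<le> (LINT u|nu T. \<rho> u * U (?q u)) - (LINT u|nu T. \<rho> u * U (qs u))"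
      by (simp add: Psi_eq[OF qs_L2] Psi_eq[OF qL])
    also have "\<dots> = (LINT u|nu T. \<rho> u * U (?q u) - \<rho> u * U (qs u))"
      using rho_mult_integrable[OF U_integrable[OF qs_L2]] rho_mult_integrable[OF U_integrable[OF qL]] by simp
    also have "\<dots> = (LINT u|nu T. s n * (\<rho> u * X n u))"
      by (rule Bochner_Integration.integral_cong) (use s(1)[of n] in \<open>auto simp: X_def field_simps\<close>)
    also have "\<dots> = s n * (LINT u|nu T. \<rho> u * X n u)" by simp
    finally show ?thesis using s(1)[of n] by (simp add: zero_le_mult_iff)
  qed
  have lim: "(\<lambda>n. LINT u|nu T. \<rho> u * max (X n u) (Y u)) \<longlonglongrightarrow> (LINT u|nu T. \<rho> u * Y u)"
  proof (rule integral_dominated_convergence)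
    show "integrable (nu T) (\<lambda>u. \<rho> u * (W u + \<bar>Y u\<bar>))"
      using Wi Yi by (intro rho_mult_integrable) auto
    show "AE u in nu T. (\<lambda>n. \<rho> u * max (X n u) (Y u)) \<longlonglongrightarrow> \<rho> u * Y u"
    proof (intro AE_I2 tendsto_mult_left)
      fix u
      have "(\<lambda>n. e (s n) u) \<longlonglongrightarrow> d u" by (rule filterlim_compose[OF elim s_right])
      from clarke_difference_quotient_limsup[OF U_lip s(1) s_lim this, of "qs u"]
      show "(\<lambda>n. max (X n u) (Y u)) \<longlonglongrightarrow> Y u" unfolding X_def Y_def mid_rad_max .
    qed
    show "AE u in nu T. norm (\<rho> u * max (X n u) (Y u)) \<le> \<rho> u * (W u + \<bar>Y u\<bar>)" for n
    proof (intro AE_I2)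
      fix u
      have "\<bar>max (X n u) (Y u)\<bar> \<le> W u + \<bar>Y u\<bar>" using XW[of n u] by (auto simp: max_def)
      then show "norm (\<rho> u * max (X n u) (Y u)) \<le> \<rho> u * (W u + \<bar>Y u\<bar>)"
        using rho_nonneg[of u] by (simp add: abs_mult mult_left_mono)
    qed
  qed (intro borel_nu; measurable)+
  moreover have "0 \<le> (LINT u|nu T. \<rho> u * max (X n u) (Y u))" for n
  proof -
    have Xi: "integrable (nu T) (X n)"
      by (rule Bochner_Integration.integrable_bound[OF Wi]) (use XW in \<open>auto intro!: borel_nu AE_I2 intro: order_trans[OF _ abs_ge_self]\<close>)
    have "(LINT u|nu T. \<rho> u * X n u) \<le> (LINT u|nu T. \<rho> u * max (X n u) (Y u))"
      using Xi Yi rho_nonneg by (intro integral_mono rho_mult_integrable integrable_max mult_left_mono) auto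
    then show ?thesis using X0[of n] by simp
  qed
  ultimately show ?thesis unfolding Y_def by (intro LIMSEQ_le_const[of _ _ 0]) (auto simp: Y_def)
qed

section \<open>Selectors and multipliers\<close>

lemma feasible_dirs_zero: "(\<lambda>u. 0) \<in> feasible_dirs"
  using qs_cone L2_const[OF finite_nu, of 0] by (auto simp: feasible_dirs_def unit_integral_const intro!: exI[of _ 1])

text \<open>If \<open>qs + k d\<close> and \<open>qs + k' h\<close> are monotone, a convex combination of them is \<open>qs\<close> plus a positive multiple
\<open>r\<close> of \<open>d + s h\<close>; the weights \<open>r / k\<close> and \<open>r s / k'\<close> sum to one for the \<open>r\<close> below.\<close>

lemma feasible_dirs_combine:
  assumes "d \<in> feasible_dirs" "h \<in> feasible_dirs" "s > 0"
  shows "(\<lambda>u. d u + s * h u) \<in> feasible_dirs"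
proof -
  have dL: "d \<in> L2 (nu T)" "h \<in> L2 (nu T)" using assms by (auto simp: feasible_dirs_def)
  obtain k k' where k: "k > 0" "(\<lambda>u. qs u + k * d u) \<in> mono_cone T"
      "k' > 0" "(\<lambda>u. qs u + k' * h u) \<in> mono_cone T"
    using assms by (auto simp: feasible_dirs_def)
  define r where "r = 1 / (1 / k + s / k')"
  have r: "r > 0" "r / k + r * s / k' = 1"
  proof -
    have p: "1 / k + s / k' > 0" using k assms(3) by (simp add: add_pos_pos)
    then show "r > 0" by (simp add: r_def)
    have "r / k + r * s / k' = r * (1 / k + s / k')" by (simp add: algebra_simps)
    then show "r / k + r * s / k' = 1" using p by (simp add: r_def)
  qed
  have "(\<lambda>u. (r / k) * (qs u + k * d u) + (r * s / k') * (qs u + k' * h u)) \<in> mono_cone T"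
    using k r(1) assms(3) by (intro mono_cone_lincomb) auto
  moreover have "(r / k) * (qs u + k * d u) + (r * s / k') * (qs u + k' * h u) = qs u + r * (d u + s * h u)" for u
  proof -
    have "(r / k) * (qs u + k * d u) + (r * s / k') * (qs u + k' * h u)
        = (r / k + r * s / k') * qs u + r * (d u + s * h u)"
      using k(1,3) by (simp add: field_simps)
    then show ?thesis using r(2) by simp
  qed
  ultimately have "(\<lambda>u. qs u + r * (d u + s * h u)) \<in> mono_cone T" by simp
  moreover have "unit_integral (\<lambda>u. d u + s * h u) = 0"
    using assms integrable_L2[OF finite_nu dL(1)] integrable_L2[OF finite_nu dL(2)]
    by (simp add: unit_integral_add[OF finite_T] unit_integral_cmult feasible_dirs_def)
  moreover have "unit_integral (\<lambda>u. qs u * (d u + s * h u)) = 0"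
  proof -
    have "unit_integral (\<lambda>u. qs u * (d u + s * h u)) = unit_integral (\<lambda>u. qs u * d u + s * (qs u * h u))"
      by (rule arg_cong[where f=unit_integral]) (auto simp: algebra_simps)
    then show ?thesis
      using assms integrable_L2_mult[OF qs_L2 dL(1)] integrable_L2_mult[OF qs_L2 dL(2)]
      by (simp add: unit_integral_add[OF finite_T] unit_integral_cmult feasible_dirs_def)
  qed
  ultimately show ?thesis
    using r(1) L2_add[OF dL(1) L2_cmult[OF dL(2)]] by (auto simp: feasible_dirs_def)
qed

lemma exists_selector_on_feasible_dirs:
  obtains \<xi> where "\<xi> \<in> borel_measurable borel" "\<And>u. \<xi> u \<in> clarke_subdiff U (qs u)"
    "\<And>d. d \<in> feasible_dirs \<Longrightarrow> 0 \<le> (LINT u|nu T. \<rho> u * \<xi> u * d u)"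
proof (rule sublinear_selector[OF finite_nu rho_mult_L2[OF mid_L2] rho_mult_L2[OF rad_L2], of feasible_dirs])
  show "0 \<le> \<rho> u * rad u" for u using rho_nonneg rad_nonneg by simp
  show "feasible_dirs \<subseteq> L2 (nu T)" by (auto simp: feasible_dirs_def)
  show "feasible_dirs \<noteq> {}" using feasible_dirs_zero by blast
  show "(\<lambda>u. d u + s * h u) \<in> feasible_dirs"
    if "d \<in> feasible_dirs" "h \<in> feasible_dirs" "s > 0" for d h s
    by (rule feasible_dirs_combine[OF that])
  show "0 \<le> (LINT u|nu T. \<rho> u * mid u * d u + \<rho> u * rad u * \<bar>d u\<bar>)" if "d \<in> feasible_dirs" for d
    using directional_nonneg[OF that] by (simp add: distrib_left mult.assoc)
  fix \<theta> :: "real \<Rightarrow> real"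
  assume \<theta>: "\<theta> \<in> borel_measurable (nu T)" "\<And>x. \<bar>\<theta> x\<bar> \<le> 1"
    "\<And>h. h \<in> feasible_dirs \<Longrightarrow> 0 \<le> (LINT u|nu T. (\<rho> u * mid u + \<rho> u * rad u * \<theta> u) * h u)"
  define \<xi> where "\<xi> u = mid u + rad u * \<theta> u" for u
  have [measurable]: "\<theta> \<in> borel_measurable borel"
    using \<theta>(1) by (simp add: measurable_cong_sets[OF sets_nu refl])
  show thesis
  proof (rule that[of \<xi>])
    show "\<xi> \<in> borel_measurable borel" unfolding \<xi>_def[abs_def] by measurable
    show "\<xi> u \<in> clarke_subdiff U (qs u)" for u
    proof (rule clarke_subdiffI[OF U_lip])
      have "\<bar>rad u * \<theta> u\<bar> \<le> rad u"
        using \<theta>(2)[of u] rad_nonneg[of u] by (simp add: abs_mult mult_left_le)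
      then show "- clarke_dir U (qs u) (-1) \<le> \<xi> u" "\<xi> u \<le> clarke_dir U (qs u) 1"
        unfolding \<xi>_def mid_def rad_def abs_le_iff by (auto simp: field_simps)
    qed
    show "0 \<le> (LINT u|nu T. \<rho> u * \<xi> u * d u)" if "d \<in> feasible_dirs" for d
      using \<theta>(3)[OF that] by (simp add: \<xi>_def distrib_left mult.assoc)
  qed
qed

text \<open>Constants and multiples of \<open>qs\<close> may be added in either direction, and the \<open>2 \<times> 2\<close> system that cancels the two
moment derivatives of \<open>V - qs\<close> has determinant \<open>\<sigma>\<^sup>2\<close>.\<close>

lemma projected_dir_feasible:
  assumes V: "V \<in> mono_cone T"
  defines "I \<equiv> unit_integral (\<lambda>u. V u - qs u)" and "C \<equiv> unit_integral (\<lambda>u. qs u * (V u - qs u))"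
  defines "\<gamma> \<equiv> - (C - \<mu> * I) / \<sigma>\<^sup>2"
  shows "(\<lambda>u. (V u - qs u) + (- I - \<gamma> * \<mu>) + \<gamma> * qs u) \<in> feasible_dirs"
proof -
  let ?d = "\<lambda>u. (V u - qs u) + (- I - \<gamma> * \<mu>) + \<gamma> * qs u"
  have VL: "V \<in> L2 (nu T)" by (rule mono_cone_L2[OF V])
  have hL: "(\<lambda>u. V u - qs u) \<in> L2 (nu T)" by (rule L2_diff[OF VL qs_L2])
  have dL: "?d \<in> L2 (nu T)" by (intro L2_add L2_diff L2_cmult L2_const finite_nu VL qs_L2)
  have "unit_integral ?d = unit_integral (\<lambda>u. V u - qs u) + (- I - \<gamma> * \<mu>) + \<gamma> * unit_integral qs"
  proof -
    have i: "integrable (nu T) (\<lambda>u. V u - qs u)" "integrable (nu T) (\<lambda>u. - I - \<gamma> * \<mu>)"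
      "integrable (nu T) (\<lambda>u. \<gamma> * qs u)"
      by (rule integrable_L2[OF finite_nu hL], rule finite_measure.integrable_const[OF finite_nu],
        rule integrable_mult_right[OF integrable_L2[OF finite_nu qs_L2]])
    show ?thesis
      unfolding unit_integral_add[OF finite_T Bochner_Integration.integrable_add[OF i(1,2)] i(3)] unit_integral_add[OF finite_T i(1,2)]
        unit_integral_cmult unit_integral_const ..
  qed
  also have "\<dots> = 0" unfolding I_def[symmetric] qs_moments by (simp add: algebra_simps)
  finally have d1: "unit_integral ?d = 0" .
  have "unit_integral (\<lambda>u. qs u * ?d u) = unit_integral (\<lambda>u. qs u * (V u - qs u) + (- I - \<gamma> * \<mu>) * qs u + \<gamma> * (qs u)\<^sup>2)"
    by (rule arg_cong[where f=unit_integral]) (auto simp: power2_eq_square algebra_simps)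
  also have "\<dots> = unit_integral (\<lambda>u. qs u * (V u - qs u)) + (- I - \<gamma> * \<mu>) * unit_integral qs + \<gamma> * unit_integral (\<lambda>u. (qs u)\<^sup>2)"
  proof -
    have i: "integrable (nu T) (\<lambda>u. qs u * (V u - qs u))" "integrable (nu T) (\<lambda>u. (- I - \<gamma> * \<mu>) * qs u)"
      "integrable (nu T) (\<lambda>u. \<gamma> * (qs u)\<^sup>2)"
      using integrable_L2_mult[OF qs_L2 hL] integrable_L2[OF finite_nu qs_L2] L2_integrable_power2[OF qs_L2]
      by (auto intro!: integrable_mult_right)
    show ?thesis
      unfolding unit_integral_add[OF finite_T Bochner_Integration.integrable_add[OF i(1,2)] i(3)] unit_integral_add[OF finite_T i(1,2)]
        unit_integral_cmult ..
  qed
  also have "\<dots> = C - \<mu> * I + \<gamma> * \<sigma>\<^sup>2"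
    unfolding C_def[symmetric] qs_moments by (simp add: power2_eq_square algebra_simps)
  also have "\<dots> = 0" using \<sigma>_pos by (simp add: \<gamma>_def)
  finally have d2: "unit_integral (\<lambda>u. qs u * ?d u) = 0" .
  \<comment> \<open>small enough that \<open>qs\<close> keeps a nonnegative coefficient even when \<open>\<gamma>\<close> is very negative\<close>
  define s where "s = 1 / (1 + \<bar>1 - \<gamma>\<bar>)"
  have s: "s > 0" "0 \<le> 1 - s + s * \<gamma>"
  proof -
    show "s > 0" by (simp add: s_def add_pos_nonneg)
    have "s * (1 + \<bar>1 - \<gamma>\<bar>) = 1" by (simp add: s_def add_pos_nonneg less_imp_neq[symmetric])
    moreover have "s * (1 - \<gamma>) \<le> s * (1 + \<bar>1 - \<gamma>\<bar>)" using \<open>s > 0\<close> by (intro mult_left_mono) auto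
    ultimately show "0 \<le> 1 - s + s * \<gamma>" by (simp add: algebra_simps)
  qed
  have "(\<lambda>u. s * (- I - \<gamma> * \<mu>) + (1 - s + s * \<gamma>) * qs u + s * V u) \<in> mono_cone T"
    using s by (intro mono_cone_affine finite_T qs_cone V) auto
  moreover have "s * (- I - \<gamma> * \<mu>) + (1 - s + s * \<gamma>) * qs u + s * V u = qs u + s * ?d u" for u
    by (simp add: algebra_simps)
  ultimately have "(\<lambda>u. qs u + s * ?d u) \<in> mono_cone T" by simp
  then show ?thesis using dL d1 d2 s(1) unfolding feasible_dirs_def by blast
qed

text \<open>The \<open>nu T\<close>-density of the derivative of the Lagrangian at \<open>qs\<close>, for a chosen selector.\<close>

definition lagrange_density :: "real \<Rightarrow> real \<Rightarrow> (real \<Rightarrow> real) \<Rightarrow> (nat \<Rightarrow> real) \<Rightarrow> real \<Rightarrow> real" where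
  "lagrange_density l1 l2 \<xi> \<xi>s u = \<rho> u * xi_hat J t \<xi> \<xi>s u + (l1 + 2 * l2 * qs u) * rho_0 T u"

lemma lagrange_density_atom:
  assumes "j \<in> {1..J}"
  shows "lagrange_density l1 l2 \<xi> \<xi>s (t j) = m j * \<xi>s j"
proof -
  have "t j \<in> T" using assms by (auto simp: T)
  then have "rho_0 T (t j) = 0" using rho_0_AE[OF finite_T] unfolding AE_nu[OF finite_T] by auto
  then show ?thesis by (simp only: lagrange_density_def rho_atom[OF assms] xi_hat_atom[OF assms])
qed

lemma selectors_xi_hat_L2:
  assumes "selectors J t U qs \<xi> \<xi>s"
  shows "xi_hat J t \<xi> \<xi>s \<in> L2 (nu T)"
proof (rule L2_bound[OF qs_growth_L2])
  show "xi_hat J t \<xi> \<xi>s \<in> borel_measurable (nu T)"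
    using assms by (intro borel_nu xi_hat_measurable) (simp add: selectors_def)
  have "AE u in lborel. u \<in> {0..1} \<longrightarrow> \<bar>xi_hat J t \<xi> \<xi>s u\<bar> \<le> \<bar>a + b * \<bar>qs u\<bar>\<bar>"
  proof -
    have "AE u in lborel. u \<in> {0..1} \<longrightarrow> \<xi> u \<in> clarke_subdiff U (qs u)"
      using assms by (simp add: selectors_def)
    then show ?thesis using T_lborel_null
    proof eventually_elim
      case (elim u)
      then show ?case using U_growth by (auto simp: xi_hat_off intro: order_trans[OF _ abs_ge_self])
    qed
  qed
  moreover have "\<bar>xi_hat J t \<xi> \<xi>s u\<bar> \<le> \<bar>a + b * \<bar>qs u\<bar>\<bar>" if "u \<in> T" for u
  proof -
    obtain j where j: "j \<in> {1..J}" "u = t j" using \<open>u \<in> T\<close> unfolding T by blast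
    have "\<xi>s j \<in> clarke_subdiff U (qs (t j))" using assms j(1) unfolding selectors_def by blast
    then have "\<bar>\<xi>s j\<bar> \<le> a + b * \<bar>qs (t j)\<bar>" using U_growth by blast
    then show ?thesis unfolding j(2) xi_hat_atom[OF j(1)] by (rule order_trans[OF _ abs_ge_self])
  qed
  ultimately show "AE u in nu T. \<bar>xi_hat J t \<xi> \<xi>s u\<bar> \<le> \<bar>a + b * \<bar>qs u\<bar>\<bar>"
    unfolding AE_nu[OF finite_T] by blast
qed

lemma rho_0_mult_L2:
  assumes "f \<in> L2 (nu T)" shows "(\<lambda>u. f u * rho_0 T u) \<in> L2 (nu T)"
proof (rule L2_bound[OF assms])
  show "(\<lambda>u. f u * rho_0 T u) \<in> borel_measurable (nu T)"
    using unit_integral_rho_0(2)[OF finite_T integrable_L2[OF finite_nu assms]] by (rule borel_measurable_integrable)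
  show "AE u in nu T. \<bar>f u * rho_0 T u\<bar> \<le> \<bar>f u\<bar>"
    using rho_0_AE[OF finite_T] by eventually_elim (auto simp: indicator_def)
qed

lemma lagrange_density_L2:
  assumes "selectors J t U qs \<xi> \<xi>s"
  shows "lagrange_density l1 l2 \<xi> \<xi>s \<in> L2 (nu T)"
  unfolding lagrange_density_def[abs_def]
  by (intro L2_add[OF rho_mult_L2 rho_0_mult_L2] selectors_xi_hat_L2[OF assms] L2_add L2_cmult L2_const finite_nu qs_L2)

lemma variational_form_pairing:
  assumes sel: "selectors J t U qs \<xi> \<xi>s" and V: "V \<in> L2 (nu T)"
  shows "(LBINT u:{0..1}. (w u * \<xi> u + l1 + 2 * l2 * qs u) * (V u - qs u))
      + (\<Sum>j=1..J. m j * \<xi>s j * (V (t j) - qs (t j)))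
    = (LINT u|nu T. lagrange_density l1 l2 \<xi> \<xi>s u * (V u - qs u))"
proof -
  note [measurable] = L2_nu_borel[OF V] L2_nu_borel[OF lagrange_density_L2[OF sel]]
  have [measurable]: "\<xi> \<in> borel_measurable borel" using sel by (simp add: selectors_def)
  have i: "integrable (nu T) (\<lambda>u. lagrange_density l1 l2 \<xi> \<xi>s u * (V u - qs u))"
    by (intro integrable_L2_mult lagrange_density_L2 sel L2_diff V qs_L2)
  have r0: "AE u in lborel. u \<in> {0..1} \<longrightarrow> rho_0 T u = indicator (- T) u"
    using rho_0_AE[OF finite_T] unfolding AE_nu[OF finite_T] by blast
  have "(LBINT u:{0..1}. (w u * \<xi> u + l1 + 2 * l2 * qs u) * (V u - qs u))
      = (LBINT u:{0..1}. (w01 u * \<xi> u + l1 + 2 * l2 * qs u) * (V u - qs u))"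
    by (rule set_integral_w01[of "\<lambda>u y. (y * \<xi> u + l1 + 2 * l2 * qs u) * (V u - qs u)"])
  also have "\<dots> = (LBINT u:{0..1}. lagrange_density l1 l2 \<xi> \<xi>s u * (V u - qs u))"
    unfolding set_lebesgue_integral_def
  proof (rule integral_cong_AE)
    show "AE u in lborel. indicator {0..1} u *\<^sub>R ((w01 u * \<xi> u + l1 + 2 * l2 * qs u) * (V u - qs u)) =
        indicator {0..1} u *\<^sub>R (lagrange_density l1 l2 \<xi> \<xi>s u * (V u - qs u))"
      using r0 rho_AE_w T_lborel_null
    proof eventually_elim
      case (elim u)
      then show ?case
        by (cases "u \<in> {0..1}") (simp_all add: lagrange_density_def xi_hat_off add.assoc)
    qed
  qed measurable
  finally show ?thesis
    unfolding integral_nu[OF finite_T i] sum_T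
    by (simp add: lagrange_density_atom cong: sum.cong_simp)
qed

lemma stationarity_iff_variational:
  assumes sel: "selectors J t U qs \<xi> \<xi>s"
  shows "(\<exists>z. z \<in> normal_cone T qs \<and>
      (AE u in nu T. 0 = \<rho> u * xi_hat J t \<xi> \<xi>s u + (l1 + 2 * l2 * qs u) * rho_0 T u + z u)) \<longleftrightarrow>
    (\<forall>V\<in>mono_cone T. (LBINT u:{0..1}. (w u * \<xi> u + l1 + 2 * l2 * qs u) * (V u - qs u))
      + (\<Sum>j=1..J. m j * \<xi>s j * (V (t j) - qs (t j))) \<ge> 0)" (is "?L \<longleftrightarrow> ?R")
proof -
  let ?y = "lagrange_density l1 l2 \<xi> \<xi>s"
  have yL: "?y \<in> L2 (nu T)" by (rule lagrange_density_L2[OF sel])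
  have "?R \<longleftrightarrow> (\<forall>V\<in>mono_cone T. (LINT u|nu T. ?y u * (V u - qs u)) \<ge> 0)"
    using variational_form_pairing[OF sel mono_cone_L2] by simp
  also have "\<dots> \<longleftrightarrow> (\<lambda>u. - ?y u) \<in> normal_cone T qs"
    using L2_cmult[OF yL, of "-1"] by (simp add: normal_cone_def)
  also have "\<dots> \<longleftrightarrow> ?L"
  proof
    assume "(\<lambda>u. - ?y u) \<in> normal_cone T qs"
    then show ?L by (intro exI[of _ "\<lambda>u. - ?y u"]) (simp add: lagrange_density_def)
  next
    assume ?L
    then obtain z where z: "z \<in> normal_cone T qs" and "AE u in nu T. 0 = ?y u + z u"
      unfolding lagrange_density_def by blast
    then have z2: "AE u in nu T. - ?y u = z u" by (auto elim!: eventually_mono)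
    have zL: "z \<in> L2 (nu T)" using z by (simp add: normal_cone_def)
    have "(LINT u|nu T. - ?y u * (h u - qs u)) \<le> 0" if h: "h \<in> mono_cone T" for h
    proof -
      have "(LINT u|nu T. - ?y u * (h u - qs u)) = (LINT u|nu T. z u * (h u - qs u))"
      proof (rule integral_cong_AE)
        show "AE u in nu T. - ?y u * (h u - qs u) = z u * (h u - qs u)"
          using z2 by (rule eventually_mono) (simp only:)
      qed (use L2_measurable[OF zL] L2_measurable[OF yL] L2_measurable[OF mono_cone_L2[OF h]] L2_measurable[OF qs_L2]
            in auto)
      then show ?thesis using normal_cone_nonpos[OF z h] by simp
    qed
    then show "(\<lambda>u. - ?y u) \<in> normal_cone T qs"
      using L2_cmult[OF yL, of "-1"] by (simp add: normal_cone_def)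
  qed
  finally show ?thesis by blast
qed

text \<open>The value of the selector's functional on a projected direction is its value on \<open>V - qs\<close> plus a term linear
in the two moment derivatives \<open>I\<close> and \<open>C\<close> of \<open>V - qs\<close>; the coefficients of \<open>I\<close> and \<open>2 C\<close> are \<open>l1\<close> and
\<open>l2\<close>.\<close>

lemma exists_multipliers:
  obtains l1 l2 \<xi> \<xi>s where "selectors J t U qs \<xi> \<xi>s"
    "\<And>V. V \<in> mono_cone T \<Longrightarrow> 0 \<le> (LINT u|nu T. lagrange_density l1 l2 \<xi> \<xi>s u * (V u - qs u))"
proof (rule exists_selector_on_feasible_dirs)
  fix \<xi> :: "real \<Rightarrow> real"
  assume \<xi>: "\<xi> \<in> borel_measurable borel" "\<And>u. \<xi> u \<in> clarke_subdiff U (qs u)"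
    "\<And>d. d \<in> feasible_dirs \<Longrightarrow> 0 \<le> (LINT u|nu T. \<rho> u * \<xi> u * d u)"
  define \<xi>s where "\<xi>s j = \<xi> (t j)" for j
  have sel: "selectors J t U qs \<xi> \<xi>s" using \<xi>(1,2) by (simp add: selectors_def \<xi>s_def)
  have hat: "xi_hat J t \<xi> \<xi>s = \<xi>"
  proof
    fix u show "xi_hat J t \<xi> \<xi>s u = \<xi> u"
    proof (cases "u \<in> T")
      case True
      then obtain j where "j \<in> {1..J}" "u = t j" by (auto simp: T)
      then show ?thesis using xi_hat_atom by (simp add: \<xi>s_def)
    qed (rule xi_hat_off)
  qed
  have g: "(\<lambda>u. \<rho> u * \<xi> u) \<in> L2 (nu T)"
    using rho_mult_L2[OF selectors_xi_hat_L2[OF sel]] unfolding hat .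
  define A B where "A = (LINT u|nu T. \<rho> u * \<xi> u)" and "B = (LINT u|nu T. \<rho> u * \<xi> u * qs u)"
  define l2 where "l2 = - (B - \<mu> * A) / (2 * \<sigma>\<^sup>2)"
  define l1 where "l1 = - A - 2 * l2 * \<mu>"
  show thesis
  proof (rule that[OF sel, of l1 l2])
    fix V assume V: "V \<in> mono_cone T"
    have VL: "(\<lambda>u. V u - qs u) \<in> L2 (nu T)" by (rule L2_diff[OF mono_cone_L2[OF V] qs_L2])
    define I C where "I = unit_integral (\<lambda>u. V u - qs u)" and "C = unit_integral (\<lambda>u. qs u * (V u - qs u))"
    define \<gamma> where "\<gamma> = - (C - \<mu> * I) / \<sigma>\<^sup>2"
    define P where "P = (LINT u|nu T. \<rho> u * \<xi> u * (V u - qs u))"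
    note i = integrable_L2_mult[OF g VL] integrable_L2[OF finite_nu g] integrable_L2_mult[OF g qs_L2]
    have "0 \<le> (LINT u|nu T. \<rho> u * \<xi> u * ((V u - qs u) + (- I - \<gamma> * \<mu>) + \<gamma> * qs u))"
      using \<xi>(3)[OF projected_dir_feasible[OF V]] by (simp add: I_def C_def \<gamma>_def)
    also have "\<dots> = (LINT u|nu T. \<rho> u * \<xi> u * (V u - qs u) + (- I - \<gamma> * \<mu>) * (\<rho> u * \<xi> u) + \<gamma> * (\<rho> u * \<xi> u * qs u))"
      by (rule Bochner_Integration.integral_cong) (auto simp: algebra_simps)
    also have "\<dots> = P + (- I - \<gamma> * \<mu>) * A + \<gamma> * B"
      unfolding P_def A_def B_def using i by simp
    also have "\<dots> = P + l1 * I + 2 * l2 * C"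
      using \<sigma>_pos by (simp add: l1_def l2_def \<gamma>_def field_simps)
    also have "\<dots> = (LINT u|nu T. lagrange_density l1 l2 \<xi> \<xi>s u * (V u - qs u))"
    proof -
      have VI: "integrable (nu T) (\<lambda>u. V u - qs u)" "integrable (nu T) (\<lambda>u. qs u * (V u - qs u))"
        by (rule integrable_L2[OF finite_nu VL], rule integrable_L2_mult[OF qs_L2 VL])
      have "(LINT u|nu T. lagrange_density l1 l2 \<xi> \<xi>s u * (V u - qs u)) =
        (LINT u|nu T. \<rho> u * \<xi> u * (V u - qs u) + l1 * ((V u - qs u) * rho_0 T u)
           + 2 * l2 * (qs u * (V u - qs u) * rho_0 T u))"
        by (rule Bochner_Integration.integral_cong) (auto simp: lagrange_density_def hat algebra_simps)
      also have "\<dots> = P + l1 * I + 2 * l2 * C"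
        unfolding P_def I_def C_def unit_integral_rho_0(1)[OF finite_T VI(1), symmetric] unit_integral_rho_0(1)[OF finite_T VI(2), symmetric]
        using i(1) unit_integral_rho_0(2)[OF finite_T VI(1)] unit_integral_rho_0(2)[OF finite_T VI(2)] by simp
      finally show ?thesis by simp
    qed
    finally show "0 \<le> (LINT u|nu T. lagrange_density l1 l2 \<xi> \<xi>s u * (V u - qs u))" .
  qed
qed

text \<open>At an atom the stationarity equation holds pointwise with \<open>rho_0 = 0\<close>, and subgradients of the
nondecreasing \<open>U\<close> are nonnegative; this gives the sign \<open>z \<le> 0\<close> that complementarity needs.\<close>

lemma stationary_point_conditions:
  assumes sel: "selectors J t U qs \<xi> \<xi>s" and z: "z \<in> normal_cone T qs"
    and eq: "AE u in nu T. 0 = \<rho> u * xi_hat J t \<xi> \<xi>s u + (l1 + 2 * l2 * qs u) * rho_0 T u + z u"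
  shows "J_nu T z s \<ge> 0" "J_nu T z 1 = 0"
    "mono_rep T qs p \<Longrightarrow> has_bochner_integral (stieltjes (rep_dom T) p) (J_nu T z) 0"
proof -
  show "J_nu T z s \<ge> 0" by (rule normal_cone_J_nonneg[OF finite_T T_subset' qs_cone z])
  show "J_nu T z 1 = 0" by (rule normal_cone_J_one[OF finite_T T_subset' qs_cone z])
  have "z u \<le> 0" if "u \<in> T" for u
  proof -
    obtain j where j: "j \<in> {1..J}" "u = t j" using \<open>u \<in> T\<close> unfolding T by blast
    have "0 = lagrange_density l1 l2 \<xi> \<xi>s u + z u"
      using eq that unfolding AE_nu[OF finite_T] lagrange_density_def by blast
    then have "z u = - (m j * \<xi>s j)" using lagrange_density_atom[OF j(1)] unfolding j(2) by simp
    moreover have "\<xi>s j \<in> clarke_subdiff U (qs (t j))" using sel j(1) unfolding selectors_def by blast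
    then have "0 \<le> \<xi>s j" by (rule mono_clarke_subdiff_nonneg[OF U_lip U_mono])
    ultimately show ?thesis using tm j(1) by (simp add: less_imp_le)
  qed
  then show "has_bochner_integral (stieltjes (rep_dom T) p) (J_nu T z) 0" if "mono_rep T qs p"
    using that by (intro J_nu_stieltjes_integral_zero[OF finite_T T_subset qs_cone z])
qed

end

theorem theorem2:
  fixes \<mu> \<sigma> a b :: real and \<phi> w U qs :: "real \<Rightarrow> real"
    and J :: nat and t m :: "nat \<Rightarrow> real" and T :: "real set"
  assumes "\<sigma> \<ge> 0"
    and "inj_on t {1..J}" and "\<forall>j\<in>{1..J}. 0 < t j \<and> t j \<le> 1 \<and> m j > 0"
    and T: "T = t ` {1..J}"
    and "\<phi> \<in> distortions"
    and "set_borel_measurable lborel {0<..<1} w"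
    and "\<exists>C. AE u in lborel. u \<in> {0<..<1} \<longrightarrow> \<bar>w u\<bar> \<le> C"
    and "\<forall>A\<in>sets borel. measure (stieltjes_Icc 0 1 \<phi>) A =
           (LBINT u:A \<inter> {0..1}. w u) + (\<Sum>j=1..J. m j * indicator A (t j))"
    and "mono U" and "local_lipschitz (UNIV :: real set) UNIV (\<lambda>_. U)"
    and "a \<ge> 0" and "b \<ge> 0"
    and "\<forall>x. \<forall>\<zeta>\<in>clarke_subdiff U x. \<bar>\<zeta>\<bar> \<le> a + b * \<bar>x\<bar>"
    and "qs \<in> mono_cone T \<inter> moment_set T \<mu> \<sigma>"
    and "LICQ T qs"
    and "L2_local_min (nu T) (Psi J t m w U) (mono_cone T \<inter> moment_set T \<mu> \<sigma>) qs"
  defines "stat \<equiv> \<lambda>l1 l2 \<xi> \<xi>s z. z \<in> normal_cone T qs \<and>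
      (AE u in nu T. 0 = rho_phi T \<phi> u * xi_hat J t \<xi> \<xi>s u + (l1 + 2 * l2 * qs u) * rho_0 T u + z u)"
    and "vi \<equiv> \<lambda>l1 l2 \<xi> \<xi>s. \<forall>V\<in>mono_cone T.
      (LBINT u:{0..1}. (w u * \<xi> u + l1 + 2 * l2 * qs u) * (V u - qs u))
        + (\<Sum>j=1..J. m j * \<xi>s j * (V (t j) - qs (t j))) \<ge> 0"
  shows "(\<exists>l1 l2 \<xi> \<xi>s z.
      selectors J t U qs \<xi> \<xi>s \<and> stat l1 l2 \<xi> \<xi>s z \<and> vi l1 l2 \<xi> \<xi>s \<and>
      (\<forall>s\<in>{0..1}. J_nu T z s \<ge> 0) \<and> J_nu T z 1 = 0 \<and>
      (\<forall>p. mono_rep T qs p \<longrightarrow> has_bochner_integral (stieltjes (rep_dom T) p) (J_nu T z) 0))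
    \<and> (\<forall>l1 l2 \<xi> \<xi>s. selectors J t U qs \<xi> \<xi>s \<longrightarrow>
      ((\<exists>z. stat l1 l2 \<xi> \<xi>s z) \<longleftrightarrow> vi l1 l2 \<xi> \<xi>s))"
proof -
  interpret moment_constrained_minimizer J t m T \<phi> w \<mu> \<sigma> a b U qs
    by unfold_locales (fact assms)+
  have iff: "(\<exists>z. stat l1 l2 \<xi> \<xi>s z) \<longleftrightarrow> vi l1 l2 \<xi> \<xi>s" if "selectors J t U qs \<xi> \<xi>s" for l1 l2 \<xi> \<xi>s
    unfolding stat_def vi_def by (rule stationarity_iff_variational[OF that])
  obtain l1 l2 \<xi> \<xi>s where sel: "selectors J t U qs \<xi> \<xi>s"
    and pairing: "\<And>V. V \<in> mono_cone T \<Longrightarrow> 0 \<le> (LINT u|nu T. lagrange_density l1 l2 \<xi> \<xi>s u * (V u - qs u))"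
    by (rule exists_multipliers) (rule that)
  have vi: "vi l1 l2 \<xi> \<xi>s"
    unfolding vi_def using pairing variational_form_pairing[OF sel mono_cone_L2] by simp
  then obtain z where z: "stat l1 l2 \<xi> \<xi>s z" using iff[OF sel] by blast
  have "\<forall>s\<in>{0..1}. J_nu T z s \<ge> 0" "J_nu T z 1 = 0"
    "\<forall>p. mono_rep T qs p \<longrightarrow> has_bochner_integral (stieltjes (rep_dom T) p) (J_nu T z) 0"
    using stationary_point_conditions[OF sel, of z l1 l2] z unfolding stat_def by blast+
  then show ?thesis using sel z vi iff by blast
qed

end
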